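(* As formal power series in $q$ (or for $|q|<1$), \begin{align*} N^o(1,-1;1;q)&=-N^o(1,-1;-1;-q)=\sum_{n\ge1}2F(n)q^n,\\ N^o(0,-1;1;q)&=\sum_{n\ge1}H(8n-1)q^n,\\ N^o(1,1/q;-1;q)&=-\sum_{n\ge1}F(4n-1)(-q)^n=3\sum_{n\ge1}H(8n-5)q^{2n-1}-\sum_{n\ge1}H(8n-1)q^{2n}. \end{align*}
   Context: For $|q|<1$, $c\in\mathbb{C}$ and $n\in\mathbb{Z}_{\ge0}\cup\{\infty\}$ write $(c;q)_n=\prod_{k=0}^{n-1}(1-cq^k)$ and $(c_1,\dots,c_j;q)_n=(c_1;q)_n\cdots(c_j;q)_n$. For complex $a,b,z$ define \[ N^o(a,b;z;q):=\sum_{n\ge0}\frac{\left(-q/a,-q/b;q^2\right)_n(ab)^nq^{2n+1}}{\left(zq,q/z;q^2\right)_{n+1}}, \] where $(-q/a;q^2)_n a^n$ means $\prod_{k=0}^{n-1}(a+q^{2k+1})$ (similarly for $b$). $H(n)$ is the Hurwitz class number: for $n>0$, the number of $\mathrm{SL}_2(\mathbb{Z})$-classes of positive definite binary quadratic forms $Ax^2+Bxy+Cy^2$ with $B^2-4AC=-n$, where the classes of forms equivalent to a multiple of $x^2+y^2$ (resp. $x^2+xy+y^2$) are counted with weight $1/2$ (resp. $1/3$). $F(n)$ is the Kronecker class number: the number of $\mathrm{SL}_2(\mathbb{Z})$-classes of positive definite forms $ax^2+2bxy+cy^2$ with $ac-b^2=n$ in which at least one of $a,c$ is odd, the class of a multiple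 of $x^2+y^2$ being counted with weight $1/2$. *)

theory Defs
  imports "HOL-Analysis.Analysis"
begin

definition qpoch :: "complex \<Rightarrow> complex \<Rightarrow> nat \<Rightarrow> complex" where
  "qpoch c q n = (\<Prod>k<n. 1 - c * q ^ k)"

text \<open>The product over \<open>k < n\<close> stands for \<open>(-q/a;q\<^sup>2)\<^sub>n (-q/b;q\<^sup>2)\<^sub>n (ab)\<^sup>n\<close>; in this form
  \<open>a = 0\<close> or \<open>b = 0\<close> is allowed.\<close>

definition No_term :: "complex \<Rightarrow> complex \<Rightarrow> complex \<Rightarrow> complex \<Rightarrow> nat \<Rightarrow> complex" where
  "No_term a b z q n =
     (\<Prod>k<n. a + q ^ (2 * k + 1)) * (\<Prod>k<n. b + q ^ (2 * k + 1)) * q ^ (2 * n + 1)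
       / (qpoch (z * q) (q\<^sup>2) (n + 1) * qpoch (q / z) (q\<^sup>2) (n + 1))"

definition No :: "complex \<Rightarrow> complex \<Rightarrow> complex \<Rightarrow> complex \<Rightarrow> complex" where
  "No a b z q = (\<Sum>\<^sub>\<infinity>n. No_term a b z q n)"

text \<open>The triple \<open>(A, B, C)\<close> represents the form \<open>A x\<^sup>2 + B x y + C y\<^sup>2\<close>.\<close>

type_synonym qform = "int \<times> int \<times> int"

fun qf_eval :: "qform \<Rightarrow> 'a::comm_ring_1 \<Rightarrow> 'a \<Rightarrow> 'a" where
  "qf_eval (A, B, C) x y = of_int A * x\<^sup>2 + of_int B * x * y + of_int C * y\<^sup>2"

definition pos_def :: "qform \<Rightarrow> bool" where
  "pos_def f \<longleftrightarrow> (\<forall>x y :: real. (x, y) \<noteq> (0, 0) \<longrightarrow> qf_eval f x y > 0)"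

definition SL2_equiv :: "qform \<Rightarrow> qform \<Rightarrow> bool" where
  "SL2_equiv f g \<longleftrightarrow>
     (\<exists>p q r s :: int. p * s - q * r = 1 \<and>
        (\<forall>x y :: int. qf_eval g x y = qf_eval f (p * x + q * y) (r * x + s * y)))"

definition SL2_classes :: "qform set \<Rightarrow> qform set set" where
  "SL2_classes S = S // {(f, g). f \<in> S \<and> g \<in> S \<and> SL2_equiv f g}"

definition H_forms :: "nat \<Rightarrow> qform set" where
  "H_forms n = {(A, B, C). pos_def (A, B, C) \<and> B\<^sup>2 - 4 * A * C = - int n}"

text \<open>Only meaningful for \<open>n > 0\<close>; the convention \<open>H(0) = -1/12\<close> is not included.\<close>

definition hurwitz_H :: "nat \<Rightarrow> real" where
  "hurwitz_H n = (\<Sum>K \<in> SL2_classes (H_forms n).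
     if \<exists>m. (m, 0, m) \<in> K then 1 / 2 else if \<exists>m. (m, m, m) \<in> K then 1 / 3 else 1)"

definition F_forms :: "nat \<Rightarrow> qform set" where
  "F_forms n = {(a, 2 * b, c) | a b c.
     pos_def (a, 2 * b, c) \<and> a * c - b\<^sup>2 = int n \<and> (odd a \<or> odd c)}"

definition kronecker_F :: "nat \<Rightarrow> real" where
  "kronecker_F n = (\<Sum>K \<in> SL2_classes (F_forms n). if \<exists>m. (m, 0, m) \<in> K then 1 / 2 else 1)"

end

theory Submission
  imports Defs
begin

text \<open>
  All three series have the form \<open>G(a) = N\<^sup>o(a, -1; 1; q)\<close> with \<open>a \<in> {1, 0, 1/q}\<close>; in the third one
  \<open>q\<close> is replaced by \<open>-q\<close>. Expanding \<open>1 / (q; q\<^sup>2)\<^sup>2\<close> and the trivial sequence \<open>1, 0, 0, \<dots>\<close> in the same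
  kernel (Bailey pairs relative to \<open>q\<^sup>2\<close>) and summing the kernel by a two-term recurrence writes \<open>q\<close> and
  \<open>G(a)\<close> as multiples of one unknown constant. Eliminating it gives \<open>\<theta> G(a)\<close> as an explicit Lambert-type
  series for a theta series \<open>\<theta>\<close>, and shows \<open>\<theta> \<noteq> 0\<close> at the same time, so that no infinite product is needed.

  On the arithmetic side, a positive definite form is equivalent to an obtuse one,
  \<open>y u\<^sup>2 + z v\<^sup>2 + x (u + v)\<^sup>2\<close> with \<open>x, y, z \<ge> 0\<close> up to a factor 2, and \<open>(x, y, z)\<close> is unique up to cyclic
  rotation (up to all permutations if one entry vanishes). Since the determinant is \<open>x y + y z + z x\<close>, the
  class number series become sums of \<open>q\<close> to such a power over triples with congruence conditions, and summing
  one variable leaves an indefinite theta series. Multiplied by \<open>\<theta>\<close>, it becomes a double sum of products of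
  hyperbolic cotangents or cosecants, which the addition theorem telescopes to the same Lambert-type series.
\<close>

section \<open>Equivalence and reduction of binary quadratic forms\<close>

text \<open>The parameters \<open>x\<close>, \<open>y\<close>, \<open>z\<close> of an obtuse form
  are chosen because the determinant is then linear in each of them and the reduction conditions are
  mere nonnegativity. Gauss reduction would leave inequalities between the coefficients that
  obstruct the geometric summation over one variable. On the analytic side the common constant is
  \<open>kernel_sum a q 0\<close>, an infinite product by the q-Gauss sum. Only ratios of kernel
  sums are used, and for the three values of \<open>a\<close> they are simple enough to turn the
  unit pair into the theta series of the numbers \<open>r (r + 1)\<close>, of the triangular numbers
  and of the squares. The same theta series fits the arithmetic side. After one variable has been
  summed, a quadratic exponent in an inner variable \<open>a\<close> remains under a finite sum; a
  shift of the theta index by an amount depending on \<open>a\<close> makes the total exponent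
  linear in \<open>a\<close>, so this sum becomes geometric too and produces the second denominator
  of a double sum. The central theta term, where the ratio is 1, yields a factor \<open>m\<close>
  instead; these terms cancel against the term \<open>- g\<close> that telescoping leaves, because
  the hyperbolic cotangents tend to 1 and not to 0.\<close>

lemma pos_def_iff:
  "pos_def (A, B, C) \<longleftrightarrow> 0 < A \<and> B\<^sup>2 - 4 * A * C < 0"
proof
  assume pd: "pos_def (A, B, C)"
  have "qf_eval (A, B, C) (1::real) 0 > 0"
    using pd[unfolded pos_def_def, rule_format, of 1 0] by simp
  then have A: "0 < A" by simp
  \<comment> \<open>The vector \<open>(- B, 2 A)\<close> annihilates \<open>2 A x + B y\<close>, so
    only the discriminant part of the completed square survives.\<close>
  have "qf_eval (A, B, C) (- real_of_int B) (2 * real_of_int A) > 0"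
    using pd[unfolded pos_def_def, rule_format, of "- real_of_int B" "2 * real_of_int A"] A by simp
  moreover have "qf_eval (A, B, C) (- real_of_int B) (2 * real_of_int A)
      = real_of_int (A * (4 * A * C - B\<^sup>2))"
    by (simp add: power2_eq_square algebra_simps)
  ultimately have "0 < A * (4 * A * C - B\<^sup>2)"
    by (simp only: of_int_0_less_iff)
  with A show "0 < A \<and> B\<^sup>2 - 4 * A * C < 0"
    by (simp add: zero_less_mult_iff)
next
  assume h: "0 < A \<and> B\<^sup>2 - 4 * A * C < 0"
  show "pos_def (A, B, C)"
    unfolding pos_def_def
  proof (intro allI impI)
    fix x y :: real
    assume xy: "(x, y) \<noteq> (0, 0)"
    have d: "real_of_int (4 * A * C - B\<^sup>2) > 0"
      using h by (simp only: of_int_0_less_iff) simp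
    have id: "4 * real_of_int A * qf_eval (A, B, C) x y
        = (2 * A * x + B * y)\<^sup>2 + real_of_int (4 * A * C - B\<^sup>2) * y\<^sup>2"
      by (simp add: power2_eq_square algebra_simps)
    have "0 < (2 * A * x + B * y)\<^sup>2 + real_of_int (4 * A * C - B\<^sup>2) * y\<^sup>2"
    proof (cases "y = 0")
      case True
      with xy h show ?thesis by simp
    next
      case False
      then have "0 < real_of_int (4 * A * C - B\<^sup>2) * y\<^sup>2"
        using d by (simp only: zero_less_mult_iff zero_less_power2) simp
      then show ?thesis
        by (smt (verit) zero_le_power2)
    qed
    with id have "0 < 4 * real_of_int A * qf_eval (A, B, C) x y" by simp
    with h show "0 < qf_eval (A, B, C) x y"
      by (simp add: zero_less_mult_iff)
  qed
qed

section \<open>The action of SL2(Z) on forms\<close>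

lemma SL2_equivI:
  assumes "p * s - q * r = 1"
    and "\<And>x y :: int. qf_eval g x y = qf_eval f (p * x + q * y) (r * x + s * y)"
  shows "SL2_equiv f g"
  using assms unfolding SL2_equiv_def by blast

lemma SL2_equiv_refl: "SL2_equiv f f"
  by (rule SL2_equivI[of 1 1 0 0]) auto

lemma SL2_equiv_sym:
  assumes "SL2_equiv f g"
  shows "SL2_equiv g f"
proof -
  obtain p q r s where d: "p * s - q * r = 1"
    and e: "\<And>x y :: int. qf_eval g x y = qf_eval f (p * x + q * y) (r * x + s * y)"
    using assms unfolding SL2_equiv_def by blast
  show ?thesis
  \<comment> \<open>This is the inverse matrix; the instantiation follows the order
    \<open>p\<close>, \<open>s\<close>, \<open>q\<close>, \<open>r\<close> in which the rule
    mentions its variables.\<close>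
  proof (rule SL2_equivI[of s p "-q" "-r"])
    show "s * p - - q * - r = 1" using d by (simp add: algebra_simps)
    fix x y :: int
    have "p * (s * x + - q * y) + q * (- r * x + p * y) = (p * s - q * r) * x"
      by (simp add: algebra_simps)
    moreover have "r * (s * x + - q * y) + s * (- r * x + p * y) = (p * s - q * r) * y"
      by (simp add: algebra_simps)
    ultimately show "qf_eval f x y = qf_eval g (s * x + - q * y) (- r * x + p * y)"
      by (simp add: e d)
  qed
qed

lemma SL2_equiv_trans:
  assumes "SL2_equiv f g" "SL2_equiv g h"
  shows "SL2_equiv f h"
proof -
  obtain p q r s where d: "p * s - q * r = 1"
    and e: "\<And>x y :: int. qf_eval g x y = qf_eval f (p * x + q * y) (r * x + s * y)"
    using assms(1) unfolding SL2_equiv_def by blast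
  obtain p' q' r' s' where d': "p' * s' - q' * r' = 1"
    and e': "\<And>x y :: int. qf_eval h x y = qf_eval g (p' * x + q' * y) (r' * x + s' * y)"
    using assms(2) unfolding SL2_equiv_def by blast
  show ?thesis
  proof (rule SL2_equivI)
    show "(p * p' + q * r') * (r * q' + s * s') - (p * q' + q * s') * (r * p' + s * r') = 1"
    proof -
      have "(p * p' + q * r') * (r * q' + s * s') - (p * q' + q * s') * (r * p' + s * r')
          = (p * s - q * r) * (p' * s' - q' * r')" by (simp add: algebra_simps)
      then show ?thesis using d d' by simp
    qed
    show "qf_eval h x y = qf_eval f ((p * p' + q * r') * x + (p * q' + q * s') * y)
        ((r * p' + s * r') * x + (r * q' + s * s') * y)" for x y :: int
      unfolding e' e by (rule arg_cong2[where f="qf_eval f"]) (simp_all add: algebra_simps)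
  qed
qed

lemma SL2_equiv_coeffs:
  assumes "SL2_equiv (A, B, C) (A', B', C')"
  obtains p q r s where "p * s - q * r = 1"
    "A' = A * p\<^sup>2 + B * p * r + C * r\<^sup>2"
    "B' = 2 * A * p * q + B * (p * s + q * r) + 2 * C * r * s"
    "C' = A * q\<^sup>2 + B * q * s + C * s\<^sup>2"
proof -
  obtain p q r s where d: "p * s - q * r = 1"
    and e: "\<And>x y :: int. qf_eval (A', B', C') x y = qf_eval (A, B, C) (p * x + q * y) (r * x + s * y)"
    using assms unfolding SL2_equiv_def by blast
  have a: "A' = A * p\<^sup>2 + B * p * r + C * r\<^sup>2" using e[of 1 0] by simp
  have c: "C' = A * q\<^sup>2 + B * q * s + C * s\<^sup>2" using e[of 0 1] by simp
  have "A' + B' + C' = A * (p + q)\<^sup>2 + B * (p + q) * (r + s) + C * (r + s)\<^sup>2" using e[of 1 1] by simp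
  then have "B' = 2 * A * p * q + B * (p * s + q * r) + 2 * C * r * s"
    unfolding a c by (simp add: power2_eq_square algebra_simps)
  with d a c that show thesis by blast
qed

lemma SL2_equiv_disc:
  assumes "SL2_equiv (A, B, C) (A', B', C')"
  shows "B'\<^sup>2 - 4 * A' * C' = B\<^sup>2 - 4 * A * C"
proof -
  obtain p q r s where d: "p * s - q * r = 1"
    and e: "A' = A * p\<^sup>2 + B * p * r + C * r\<^sup>2"
    "B' = 2 * A * p * q + B * (p * s + q * r) + 2 * C * r * s"
    "C' = A * q\<^sup>2 + B * q * s + C * s\<^sup>2"
    by (rule SL2_equiv_coeffs[OF assms])
  have "B'\<^sup>2 - 4 * A' * C' = (B\<^sup>2 - 4 * A * C) * (p * s - q * r)\<^sup>2"
    unfolding e by algebra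
  then show ?thesis using d by simp
qed

lemma SL2_equiv_pos_def:
  assumes "SL2_equiv f g" "pos_def f"
  shows "pos_def g"
proof -
  obtain A B C where f: "f = (A, B, C)" by (cases f) auto
  obtain A' B' C' where g: "g = (A', B', C')" by (cases g) auto
  obtain p q r s where d: "p * s - q * r = 1"
    and e: "A' = A * p\<^sup>2 + B * p * r + C * r\<^sup>2"
    by (rule SL2_equiv_coeffs[OF assms(1)[unfolded f g]])
  have disc: "B'\<^sup>2 - 4 * A' * C' = B\<^sup>2 - 4 * A * C"
    using SL2_equiv_disc[OF assms(1)[unfolded f g]] .
  have "(p, r) \<noteq> (0, 0)" using d by auto
  then have "qf_eval (A, B, C) (real_of_int p) (real_of_int r) > 0"
    using assms(2) f unfolding pos_def_def by auto
  moreover have "qf_eval (A, B, C) (real_of_int p) (real_of_int r) = real_of_int A'"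
    unfolding e by simp
  ultimately have "0 < A'" by simp
  then show ?thesis
    using disc assms(2) unfolding f g pos_def_iff by simp
qed

section \<open>Obtuse forms: existence, symmetries, uniqueness\<close>

definition obtuse :: "qform \<Rightarrow> bool" where
  "obtuse = (\<lambda>(A, B, C). 0 \<le> B \<and> B \<le> 2 * A \<and> B \<le> 2 * C)"

lemma obtuse_representative:
  assumes "pos_def f"
  obtains g where "SL2_equiv f g" "obtuse g"
proof -
  \<comment> \<open>Descent on \<open>A + C\<close>: if \<open>B\<close> exceeds \<open>2 A\<close>
    or \<open>2 C\<close>, subtracting one basis vector from the other lowers this sum, and the new
    middle coefficient is still positive, so \<open>0 \<le> B\<close> persists through the
    induction.\<close>
  have "\<exists>g. SL2_equiv (A, B, C) g \<and> obtuse g" if "pos_def (A, B, C)" "0 \<le> B" for A B C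
    using that
  proof (induction "nat (A + C)" arbitrary: A B C rule: less_induct)
    case less
    have A: "0 < A" and disc: "B\<^sup>2 - 4 * A * C < 0" using less.prems(1) by (auto simp: pos_def_iff)
    have "0 < 4 * A * C" using disc by (smt (verit) zero_le_power2)
    then have C: "0 < C" using A by (simp add: zero_less_mult_iff)
    consider "obtuse (A, B, C)" | "2 * A < B" | "2 * C < B"
      using less.prems(2) unfolding obtuse_def by fastforce
    then show ?case
    proof cases
      case 1
      then show ?thesis using SL2_equiv_refl by blast
    next
      case 2
      have eq: "SL2_equiv (A, B, C) (A, B - 2 * A, A - B + C)"
        by (rule SL2_equivI[of 1 1 "-1" 0]) (auto simp: power2_eq_square algebra_simps)
      have pd: "pos_def (A, B - 2 * A, A - B + C)"
        using SL2_equiv_pos_def[OF eq less.prems(1)] .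
      then have "0 < A - B + C"
        using 2 A by (smt (verit) pos_def_iff mult_nonneg_nonpos zero_le_power2)
      then have "nat (A + (A - B + C)) < nat (A + C)" using 2 A by linarith
      then obtain g where "SL2_equiv (A, B - 2 * A, A - B + C) g" "obtuse g"
        using less.hyps[OF _ pd] 2 by auto
      then show ?thesis using eq SL2_equiv_trans by blast
    next
      case 3
      have eq: "SL2_equiv (A, B, C) (A - B + C, B - 2 * C, C)"
        by (rule SL2_equivI[of 1 1 0 "-1"]) (auto simp: power2_eq_square algebra_simps)
      have pd: "pos_def (A - B + C, B - 2 * C, C)"
        using SL2_equiv_pos_def[OF eq less.prems(1)] .
      then have "0 < A - B + C" by (simp add: pos_def_iff)
      then have "nat ((A - B + C) + C) < nat (A + C)" using 3 C by linarith
      then obtain g where "SL2_equiv (A - B + C, B - 2 * C, C) g" "obtuse g"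
        using less.hyps[OF _ pd] 3 by auto
      then show ?thesis using eq SL2_equiv_trans by blast
    qed
  qed note nonneg = this
  obtain A B C where f: "f = (A, B, C)" by (cases f) auto
  show thesis
  proof (cases "0 \<le> B")
    case True
    then show ?thesis using nonneg assms that f by blast
  next
    case False
    have eq: "SL2_equiv (A, B, C) (C, - B, A)"
      by (rule SL2_equivI[of 0 0 "-1" 1]) (auto simp: power2_eq_square algebra_simps)
    have "pos_def (C, - B, A)" using SL2_equiv_pos_def[OF eq] assms f by blast
    then obtain g where "SL2_equiv (C, - B, A) g" "obtuse g" using nonneg False by force
    then show ?thesis using eq SL2_equiv_trans that f by blast
  qed
qed

text \<open>In the Selling parameters \<open>x = B\<close>, \<open>y = 2 A - B\<close>,
  \<open>z = 2 C - B\<close> this is the rotation of \<open>(x, y, z)\<close> to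
  \<open>(y, z, x)\<close>, a symmetry of the superbase \<open>e1\<close>, \<open>- e2\<close>,
  \<open>e2 - e1\<close>. The predicate \<open>obtuse\<close> says that the parameters are
  nonnegative, that is, that no two vectors of the superbase enclose an acute angle.\<close>

lemma obtuse_rotate: "SL2_equiv (A, B, C) (A - B + C, 2 * A - B, A)"
  by (rule SL2_equivI[of 1 0 1 "-1"]) (auto simp: power2_eq_square algebra_simps)

text \<open>For \<open>B = 0\<close> a change of sign of one basis vector fixes the form, and it
  corrects the determinant of the interchange of the two basis vectors. So a vanishing parameter
  makes all permutations available.\<close>

lemma obtuse_flip: "SL2_equiv (A, 0, C) (C, 0, A)"
  by (rule SL2_equivI[of 0 0 "-1" 1]) (auto simp: power2_eq_square algebra_simps)

lemma odd_square_ge_1: "odd (x::int) \<Longrightarrow> 1 \<le> x\<^sup>2"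
  by (metis even_zero int_one_le_iff_zero_less zero_less_power2)

text \<open>An obtuse form is \<open>2 f(u, v) = (2 A - B) u\<^sup>2 + (2 C - B) v\<^sup>2 + B (u + v)\<^sup>2\<close> with nonnegative
  coefficients, and a nonzero class modulo 2 has exactly two of \<open>u, v, u + v\<close> odd.\<close>

lemma obtuse_identity:
  "2 * (A * u\<^sup>2 + B * u * v + C * v\<^sup>2) = (2 * A - B) * u\<^sup>2 + (2 * C - B) * v\<^sup>2 + B * (u + v)\<^sup>2"
  for A B C u v :: int
  by algebra

lemma two_odd_squares:
  fixes X Y Z a b c :: int
  assumes "0 \<le> X" "0 \<le> Y" "0 \<le> Z" "odd a" "odd b"
  shows "X + Y \<le> X * a\<^sup>2 + Y * b\<^sup>2 + Z * c\<^sup>2"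
    and "\<lbrakk>0 < X; 0 < Y; 0 < Z; X * a\<^sup>2 + Y * b\<^sup>2 + Z * c\<^sup>2 = X + Y\<rbrakk> \<Longrightarrow> \<bar>a\<bar> = 1 \<and> \<bar>b\<bar> = 1 \<and> c = 0"
proof -
  have a: "1 \<le> a\<^sup>2" and b: "1 \<le> b\<^sup>2" using assms odd_square_ge_1 by auto
  have 1: "0 \<le> X * (a\<^sup>2 - 1)" "0 \<le> Y * (b\<^sup>2 - 1)" "0 \<le> Z * c\<^sup>2"
    using mult_nonneg_nonneg[OF assms(1), of "a\<^sup>2 - 1"] mult_nonneg_nonneg[OF assms(2), of "b\<^sup>2 - 1"]
      mult_nonneg_nonneg[OF assms(3) zero_le_power2, of c] a b by linarith+
  have id: "X * a\<^sup>2 + Y * b\<^sup>2 + Z * c\<^sup>2 = X + Y + X * (a\<^sup>2 - 1) + Y * (b\<^sup>2 - 1) + Z * c\<^sup>2"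
    by (simp add: algebra_simps)
  show "X + Y \<le> X * a\<^sup>2 + Y * b\<^sup>2 + Z * c\<^sup>2" using 1 id by linarith
  assume p: "0 < X" "0 < Y" "0 < Z" and eq: "X * a\<^sup>2 + Y * b\<^sup>2 + Z * c\<^sup>2 = X + Y"
  have "X * (a\<^sup>2 - 1) = 0" "Y * (b\<^sup>2 - 1) = 0" "Z * c\<^sup>2 = 0" using 1 id eq by linarith+
  then show "\<bar>a\<bar> = 1 \<and> \<bar>b\<bar> = 1 \<and> c = 0" using p by (auto simp: power2_eq_1_iff)
qed

text \<open>The values \<open>A\<close>, \<open>C\<close>, \<open>A - B + C\<close> are attained at
  \<open>e1\<close>, \<open>e2\<close>, \<open>e1 - e2\<close>, so by these bounds they are the
  minima of the form on the three nonzero classes modulo 2. An equivalence permutes the classes,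
  which makes the minima the right invariants for uniqueness.\<close>

lemma obtuse_coset_minima:
  fixes A B C u v :: int
  assumes "obtuse (A, B, C)"
  shows "\<lbrakk>odd u; even v\<rbrakk> \<Longrightarrow> A \<le> A * u\<^sup>2 + B * u * v + C * v\<^sup>2"
    and "\<lbrakk>even u; odd v\<rbrakk> \<Longrightarrow> C \<le> A * u\<^sup>2 + B * u * v + C * v\<^sup>2"
    and "\<lbrakk>odd u; odd v\<rbrakk> \<Longrightarrow> A - B + C \<le> A * u\<^sup>2 + B * u * v + C * v\<^sup>2"
proof -
  have n: "0 \<le> B" "0 \<le> 2 * A - B" "0 \<le> 2 * C - B" using assms by (auto simp: obtuse_def)
  note id = obtuse_identity[of A u B v C]
  show "A \<le> A * u\<^sup>2 + B * u * v + C * v\<^sup>2" if "odd u" "even v"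
    using two_odd_squares(1)[OF n(2,1,3), of u "u + v" v] that id by simp
  show "C \<le> A * u\<^sup>2 + B * u * v + C * v\<^sup>2" if "even u" "odd v"
    using two_odd_squares(1)[OF n(3,1,2), of v "u + v" u] that id by simp
  show "A - B + C \<le> A * u\<^sup>2 + B * u * v + C * v\<^sup>2" if "odd u" "odd v"
    using two_odd_squares(1)[OF n(2,3,1), of u v "u + v"] that id by simp
qed

text \<open>With all three parameters positive, a vector that attains the minimum of its class lies
  on the line of \<open>e1\<close>, \<open>e2\<close> or \<open>e1 - e2\<close>. This rigidity
  excludes the odd permutations in \<open>obtuse_unique\<close>.\<close>

lemma obtuse_coset_minima_unique:
  fixes A B C u v :: int
  assumes "0 < B" "B < 2 * A" "B < 2 * C"
  shows "\<lbrakk>odd u; even v; A * u\<^sup>2 + B * u * v + C * v\<^sup>2 = A\<rbrakk> \<Longrightarrow> v = 0"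
    and "\<lbrakk>even u; odd v; A * u\<^sup>2 + B * u * v + C * v\<^sup>2 = C\<rbrakk> \<Longrightarrow> u = 0"
    and "\<lbrakk>odd u; odd v; A * u\<^sup>2 + B * u * v + C * v\<^sup>2 = A - B + C\<rbrakk> \<Longrightarrow> u + v = 0"
proof -
  have n: "0 < B" "0 < 2 * A - B" "0 < 2 * C - B" using assms by auto
  note n' = n[THEN less_imp_le]
  note id = obtuse_identity[of A u B v C]
  show "v = 0" if "odd u" "even v" "A * u\<^sup>2 + B * u * v + C * v\<^sup>2 = A"
    using two_odd_squares(2)[OF n'(2,1,3) _ _ n(2,1,3), of u "u + v" v] that id by simp
  show "u = 0" if "even u" "odd v" "A * u\<^sup>2 + B * u * v + C * v\<^sup>2 = C"
    using two_odd_squares(2)[OF n'(3,1,2) _ _ n(3,1,2), of v "u + v" u] that id by simp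
  show "u + v = 0" if "odd u" "odd v" "A * u\<^sup>2 + B * u * v + C * v\<^sup>2 = A - B + C"
    using two_odd_squares(2)[OF n'(2,3,1) _ _ n(2,3,1), of u v "u + v"] that id by simp
qed

text \<open>Modulo 2 the matrix is one of the six elements of GL2 over the field with two elements,
  hence a permutation of the three nonzero classes, and comparing minima in both directions shows
  that it permutes \<open>A\<close>, \<open>C\<close>, \<open>A - B + C\<close> in the same way.
  Even permutations are the rotations. An odd permutation with positive parameters would make the
  determinant minus a square.\<close>

lemma obtuse_unique:
  assumes f: "obtuse (A, B, C)" and g: "obtuse (A', B', C')"
    and eq: "SL2_equiv (A, B, C) (A', B', C')"
  shows "(A', B', C') \<in> {(A, B, C), (A - B + C, 2 * A - B, A), (C, 2 * C - B, A - B + C)} \<or>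
    (B = 0 \<or> B = 2 * A \<or> B = 2 * C) \<and>
    (A', B', C') \<in> {(C, B, A), (A, 2 * A - B, A - B + C), (A - B + C, 2 * C - B, C)}"
proof -
  obtain p q r s where d: "p * s - q * r = 1" and
    e: "A' = A * p\<^sup>2 + B * p * r + C * r\<^sup>2"
    "B' = 2 * A * p * q + B * (p * s + q * r) + 2 * C * r * s"
    "C' = A * q\<^sup>2 + B * q * s + C * s\<^sup>2"
    by (rule SL2_equiv_coeffs[OF eq])
  have D: "A' - B' + C' = A * (p - q)\<^sup>2 + B * (p - q) * (r - s) + C * (r - s)\<^sup>2"
    unfolding e by algebra
  have d2: "(p * s - q * r)\<^sup>2 = 1" using d by simp
  \<comment> \<open>The inverse matrix writes \<open>A\<close>, \<open>C\<close> and
    \<open>A - B + C\<close> as values of the primed form, which supplies the reverse inequalities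
    between the minima.\<close>
  have i1: "A = A' * s\<^sup>2 + B' * s * (- r) + C' * (- r)\<^sup>2"
  proof -
    have "A' * s\<^sup>2 + B' * s * (- r) + C' * (- r)\<^sup>2 = A * (p * s - q * r)\<^sup>2" unfolding e by algebra
    then show ?thesis using d2 by simp
  qed
  have i2: "C = A' * (- q)\<^sup>2 + B' * (- q) * p + C' * p\<^sup>2"
  proof -
    have "A' * (- q)\<^sup>2 + B' * (- q) * p + C' * p\<^sup>2 = C * (p * s - q * r)\<^sup>2" unfolding e by algebra
    then show ?thesis using d2 by simp
  qed
  have i3: "A - B + C = A' * (s + q)\<^sup>2 + B' * (s + q) * (- r - p) + C' * (- r - p)\<^sup>2"
  proof -
    have "A' * (s + q)\<^sup>2 + B' * (s + q) * (- r - p) + C' * (- r - p)\<^sup>2 = (A - B + C) * (p * s - q * r)\<^sup>2"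
      unfolding e by algebra
    then show ?thesis using d2 by simp
  qed
  note mf = obtuse_coset_minima[OF f] and mg = obtuse_coset_minima[OF g]
  note m = mf[of p r, folded e(1)] mf[of q s, folded e(3)] mf[of "p - q" "r - s", folded D]
    mg[of s "- r", folded i1] mg[of "- q" p, folded i2] mg[of "s + q" "- r - p", folded i3]
  have "odd (p * s - q * r)" using d by simp
  then have "(even p \<or> even s) \<noteq> (even q \<or> even r)" by simp
  then have "odd p \<and> even r \<and> even q \<and> odd s \<or> odd p \<and> even r \<and> odd q \<and> odd s
      \<or> even p \<and> odd r \<and> odd q \<and> even s \<or> even p \<and> odd r \<and> odd q \<and> odd s
      \<or> odd p \<and> odd r \<and> odd q \<and> even s \<or> odd p \<and> odd r \<and> even q \<and> odd s"
    by argo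
  then show ?thesis
  proof (elim disjE)
    assume 1: "odd p \<and> even r \<and> even q \<and> odd s"
    have "A' = A" using m 1 by simp
    moreover have "C' = C" using m 1 by simp
    moreover have "A' - B' + C' = A - B + C"
      using m 1 by simp
    ultimately show ?thesis by simp
  next
    assume 2: "odd p \<and> even r \<and> odd q \<and> odd s"
    have a: "A' = A" using m 2 by simp
    have b: "C' = A - B + C" using m 2 by simp
    have c: "A' - B' + C' = C"
      using m 2 by simp
    have "False" if h: "0 < B" "B < 2 * A" "B < 2 * C"
    proof -
      note u = obtuse_coset_minima_unique[OF h]
      have "r = 0" using u(1)[of p r, folded e(1)] 2 a by simp
      moreover have "q + s = 0" using u(3)[of q s, folded e(3)] 2 b by simp
      moreover have "p - q = 0" using u(2)[of "p - q" "r - s", folded D] 2 c by simp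
      ultimately have "s = - p" by simp
      then have "- (p\<^sup>2) = 1" using d \<open>r = 0\<close> by (simp add: power2_eq_square)
      then show False by (smt (verit) zero_le_power2)
    qed
    then have "B = 0 \<or> B = 2 * A \<or> B = 2 * C" using f by (fastforce simp: obtuse_def)
    moreover have "(A', B', C') = (A, 2 * A - B, A - B + C)" using a b c by simp
    ultimately show ?thesis by blast
  next
    assume 3: "even p \<and> odd r \<and> odd q \<and> even s"
    have a: "A' = C" using m 3 by simp
    have b: "C' = A" using m 3 by simp
    have c: "A' - B' + C' = A - B + C"
      using m 3 by simp
    have "False" if h: "0 < B" "B < 2 * A" "B < 2 * C"
    proof -
      note u = obtuse_coset_minima_unique[OF h]
      have "p = 0" using u(2)[of p r, folded e(1)] 3 a by simp
      moreover have "s = 0" using u(1)[of q s, folded e(3)] 3 b by simp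
      moreover have "p - q + (r - s) = 0" using u(3)[of "p - q" "r - s", folded D] 3 c by simp
      ultimately have "- (r\<^sup>2) = 1" using d by (simp add: power2_eq_square)
      then show False by (smt (verit) zero_le_power2)
    qed
    then have "B = 0 \<or> B = 2 * A \<or> B = 2 * C" using f by (fastforce simp: obtuse_def)
    moreover have "(A', B', C') = (C, B, A)" using a b c by simp
    ultimately show ?thesis by blast
  next
    assume 4: "even p \<and> odd r \<and> odd q \<and> odd s"
    have a: "A' = C" using m 4 by simp
    have b: "C' = A - B + C" using m 4 by simp
    have c: "A' - B' + C' = A"
      using m 4 by simp
    have "(A', B', C') = (C, 2 * C - B, A - B + C)" using a b c by simp
    then show ?thesis by blast
  next
    assume 5: "odd p \<and> odd r \<and> odd q \<and> even s"
    have a: "A' = A - B + C" using m 5 by simp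
    have b: "C' = A" using m 5 by simp
    have c: "A' - B' + C' = C"
      using m 5 by simp
    have "(A', B', C') = (A - B + C, 2 * A - B, A)" using a b c by simp
    then show ?thesis by blast
  next
    assume 6: "odd p \<and> odd r \<and> even q \<and> odd s"
    have a: "A' = A - B + C" using m 6 by simp
    have b: "C' = C" using m 6 by simp
    have c: "A' - B' + C' = A"
      using m 6 by simp
    have "False" if h: "0 < B" "B < 2 * A" "B < 2 * C"
    proof -
      note u = obtuse_coset_minima_unique[OF h]
      have "p + r = 0" using u(3)[of p r, folded e(1)] 6 a by simp
      moreover have "q = 0" using u(2)[of q s, folded e(3)] 6 b by simp
      moreover have "r - s = 0" using u(1)[of "p - q" "r - s", folded D] 6 c by simp
      ultimately have "p = - s" "q = 0" by linarith+
      then have "- (s\<^sup>2) = 1" using d by (simp add: power2_eq_square)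
      then show False by (smt (verit) zero_le_power2)
    qed
    then have "B = 0 \<or> B = 2 * A \<or> B = 2 * C" using f by (fastforce simp: obtuse_def)
    moreover have "(A', B', C') = (A - B + C, 2 * C - B, C)" using a b c by simp
    ultimately show ?thesis by blast
  qed
qed

section \<open>Class numbers as numbers of triples\<close>

text \<open>Several \<open>t\<close> may represent the same class; it suffices that their weights
  add up to the weight of the class. In this way the fractional weights of the definitions are
  spread over triples.\<close>

lemma sum_SL2_classes:
  fixes wt :: "'a \<Rightarrow> real"
  assumes "finite T" and \<phi>: "\<And>t. t \<in> T \<Longrightarrow> \<phi> t \<in> S"
    and rep: "\<And>f. f \<in> S \<Longrightarrow> \<exists>t\<in>T. SL2_equiv f (\<phi> t)"
    and wt: "\<And>t\<^sub>0. t\<^sub>0 \<in> T \<Longrightarrow>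
      (\<Sum>t\<in>{t \<in> T. SL2_equiv (\<phi> t\<^sub>0) (\<phi> t)}. wt t) = W {g \<in> S. SL2_equiv (\<phi> t\<^sub>0) g}"
  shows "(\<Sum>K\<in>SL2_classes S. W K) = (\<Sum>t\<in>T. wt t)"
proof -
  define \<kappa> where "\<kappa> t = {g \<in> S. SL2_equiv (\<phi> t) g}" for t
  have cls: "{g \<in> S. SL2_equiv f g} = {g \<in> S. SL2_equiv f' g}" if "SL2_equiv f f'" for f f'
    using that SL2_equiv_trans SL2_equiv_sym by blast
  have classes: "SL2_classes S = \<kappa> ` T"
  proof -
    have "SL2_classes S = (\<lambda>f. {g \<in> S. SL2_equiv f g}) ` S"
      by (auto simp: SL2_classes_def quotient_def)
    also have "\<dots> = \<kappa> ` T"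
    proof (intro equalityI subsetI)
      fix K assume "K \<in> (\<lambda>f. {g \<in> S. SL2_equiv f g}) ` S"
      then obtain f where f: "f \<in> S" "K = {g \<in> S. SL2_equiv f g}" by blast
      obtain t where "t \<in> T" "SL2_equiv f (\<phi> t)" using rep f(1) by blast
      then show "K \<in> \<kappa> ` T" using cls f(2) \<kappa>_def by blast
    qed (use \<phi> \<kappa>_def in blast)
    finally show ?thesis .
  qed
  have eq: "\<kappa> t = \<kappa> t\<^sub>0 \<longleftrightarrow> SL2_equiv (\<phi> t\<^sub>0) (\<phi> t)" if "t \<in> T" "t\<^sub>0 \<in> T" for t t\<^sub>0
  proof
    assume "\<kappa> t = \<kappa> t\<^sub>0"
    moreover have "\<phi> t \<in> \<kappa> t" using \<phi> that SL2_equiv_refl by (simp add: \<kappa>_def)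
    ultimately show "SL2_equiv (\<phi> t\<^sub>0) (\<phi> t)" by (simp add: \<kappa>_def)
  qed (use cls \<kappa>_def in blast)
  have "(\<Sum>t\<in>T. wt t) = (\<Sum>K\<in>\<kappa> ` T. \<Sum>t\<in>{t \<in> T. \<kappa> t = K}. wt t)"
    using \<open>finite T\<close> by (rule sum.image_gen)
  also have "\<dots> = (\<Sum>K\<in>\<kappa> ` T. W K)"
  proof (rule sum.cong[OF refl])
    fix K assume "K \<in> \<kappa> ` T"
    then obtain t\<^sub>0 where t\<^sub>0: "t\<^sub>0 \<in> T" "K = \<kappa> t\<^sub>0" by blast
    have "{t \<in> T. \<kappa> t = K} = {t \<in> T. SL2_equiv (\<phi> t\<^sub>0) (\<phi> t)}" using eq t\<^sub>0 by blast
    then show "(\<Sum>t\<in>{t \<in> T. \<kappa> t = K}. wt t) = W K" using wt[OF t\<^sub>0(1)] t\<^sub>0(2) \<kappa>_def by simp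
  qed
  finally show ?thesis using classes by simp
qed

text \<open>Every entry is at most \<open>n\<close>: an entry is multiplied by the sum of the other
  two, and this sum vanishes only if \<open>n = 0\<close>.\<close>

lemma finite_triples:
  assumes "0 < n"
  shows "finite {(x, y, z). x * y + y * z + z * x = (n::nat)}"
proof (rule finite_subset)
  show "{(x, y, z). x * y + y * z + z * x = n} \<subseteq> {..n} \<times> {..n} \<times> {..n}"
  proof safe
    fix x y z :: nat
    assume n: "n = x * y + y * z + z * x"
    have *: "a \<le> a * b + b * c + c * a" if "0 < a * b + b * c + c * a" for a b c :: nat
    proof (cases "b + c = 0")
      case False
      then have "a * 1 \<le> a * (b + c)" by (intro mult_le_mono) auto
      then show ?thesis by (simp add: algebra_simps)
    qed (use that in auto)
    show "x \<le> x * y + y * z + z * x" using *[of x y z] n assms by simp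
    show "y \<le> x * y + y * z + z * x" using *[of y z x] n assms by (simp add: algebra_simps)
    show "z \<le> x * y + y * z + z * x" using *[of z x y] n assms by (simp add: algebra_simps)
  qed
qed simp

section \<open>Kronecker class numbers and triples of mixed parity\<close>

definition F_triples :: "nat \<Rightarrow> (nat \<times> nat \<times> nat) set" where
  "F_triples n = {(x, y, z). even x = even y \<and> even x \<noteq> even z \<and> x * y + y * z + z * x = n}"

text \<open>This is \<open>y u^2 + z v^2 + x (u + v)^2\<close>. Its minima \<open>x + y\<close>,
  \<open>x + z\<close>, \<open>y + z\<close> on the classes modulo 2 have an even sum, so if one is
  odd, exactly two are. The condition in \<open>F_triples\<close> makes \<open>x + y\<close> the
  even one, which singles out one of the three rotations.\<close>

definition F_form :: "nat \<times> nat \<times> nat \<Rightarrow> qform" where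
  "F_form = (\<lambda>(x, y, z). (int x + int y, 2 * int x, int x + int z))"

lemma F_form_obtuse: "obtuse (F_form t)"
  by (auto simp: F_form_def obtuse_def split: prod.splits)

lemma F_forms_iff:
  "(A, B, C) \<in> F_forms n \<longleftrightarrow>
    pos_def (A, B, C) \<and> even B \<and> B\<^sup>2 - 4 * A * C = - 4 * int n \<and> (odd A \<or> odd C)"
proof
  assume "(A, B, C) \<in> F_forms n"
  then show "pos_def (A, B, C) \<and> even B \<and> B\<^sup>2 - 4 * A * C = - 4 * int n \<and> (odd A \<or> odd C)"
    by (auto simp: F_forms_def power2_eq_square algebra_simps)
next
  assume h: "pos_def (A, B, C) \<and> even B \<and> B\<^sup>2 - 4 * A * C = - 4 * int n \<and> (odd A \<or> odd C)"
  then obtain b where b: "B = 2 * b" by auto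
  then have "A * C - b\<^sup>2 = int n" using h by (simp add: power2_eq_square algebra_simps)
  then show "(A, B, C) \<in> F_forms n" using h b by (auto simp: F_forms_def)
qed

lemma F_forms_closed:
  assumes "f \<in> F_forms n" "SL2_equiv f g"
  shows "g \<in> F_forms n"
proof -
  obtain A B C where f: "f = (A, B, C)" by (cases f) auto
  obtain A' B' C' where g: "g = (A', B', C')" by (cases g) auto
  have F: "pos_def (A, B, C)" "even B" "B\<^sup>2 - 4 * A * C = - 4 * int n" "odd A \<or> odd C"
    using assms(1) by (auto simp: f F_forms_iff)
  have eq: "SL2_equiv (A, B, C) (A', B', C')" using assms(2) f g by simp
  have eq': "SL2_equiv (A', B', C') (A, B, C)" using SL2_equiv_sym[OF eq] .
  have B': "even B'"
    by (rule SL2_equiv_coeffs[OF eq]) (use F(2) in simp)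
  have "even A \<and> even C" if "even A' \<and> even C'"
    by (rule SL2_equiv_coeffs[OF eq']) (use B' that in simp)
  then show ?thesis
    using F B' SL2_equiv_disc[OF eq] SL2_equiv_pos_def[OF eq] by (auto simp: g F_forms_iff)
qed

lemma F_form_in_F_forms:
  assumes "t \<in> F_triples n" "0 < n"
  shows "F_form t \<in> F_forms n"
proof -
  obtain x y z where t: "t = (x, y, z)" by (cases t) auto
  have h: "even x = even y" "even x \<noteq> even z" "x * y + y * z + z * x = n"
    using assms(1) by (auto simp: t F_triples_def)
  have n: "int x * int y + int y * int z + int z * int x = int n"
    using h(3) by (simp flip: of_nat_mult of_nat_add)
  have "x + y \<noteq> 0" using h(3) assms(2) by (intro notI) auto
  moreover have "(2 * int x)\<^sup>2 - 4 * (int x + int y) * (int x + int z) = - 4 * int n"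
    unfolding n[symmetric] by algebra
  ultimately show ?thesis
    using assms(2) h unfolding t F_form_def prod.case F_forms_iff pos_def_iff by auto
qed

lemma F_form_rotate: "SL2_equiv (F_form (x, y, z)) (F_form (y, z, x))"
  using obtuse_rotate[of "int x + int y" "2 * int x" "int x + int z"]
  by (simp add: F_form_def algebra_simps)

lemma F_form_flip:
  assumes "x = 0 \<or> y = 0 \<or> z = 0"
  shows "SL2_equiv (F_form (x, y, z)) (F_form (y, x, z))"
proof -
  have 0: "SL2_equiv (F_form (0, a, b)) (F_form (0, b, a))" for a b
    using obtuse_flip[of "int a" "int b"] by (simp add: F_form_def)
  note tr = SL2_equiv_trans
  have "SL2_equiv (F_form (0, a, b)) (F_form (a, 0, b))" for a b
    using tr[OF 0 tr[OF F_form_rotate F_form_rotate]] .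
  moreover have "SL2_equiv (F_form (a, b, 0)) (F_form (b, a, 0))" for a b
    using tr[OF tr[OF F_form_rotate F_form_rotate] tr[OF 0 F_form_rotate]] .
  ultimately show ?thesis using assms SL2_equiv_sym by blast
qed

lemma F_form_representative:
  assumes "f \<in> F_forms n"
  shows "\<exists>t\<in>F_triples n. SL2_equiv f (F_form t)"
proof -
  have "pos_def f" using assms by (cases f) (auto simp: F_forms_iff)
  then obtain g where g: "SL2_equiv f g" "obtuse g" by (rule obtuse_representative)
  obtain A B C where ABC: "g = (A, B, C)" by (cases g) auto
  have F: "even B" "B\<^sup>2 - 4 * A * C = - 4 * int n" "odd A \<or> odd C"
    using F_forms_closed[OF assms g(1)] by (auto simp: ABC F_forms_iff)
  obtain b where b: "B = 2 * b" using F(1) by auto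
  have n: "0 \<le> b" "b \<le> A" "b \<le> C" using g(2) by (auto simp: ABC obtuse_def b)
  define x y z where "x = nat b" and "y = nat (A - b)" and "z = nat (C - b)"
  have i: "int x = b" "int y = A - b" "int z = C - b" using n by (auto simp: x_def y_def z_def)
  have gF: "g = F_form (x, y, z)" by (simp add: ABC F_form_def i b)
  have "int (x * y + y * z + z * x) = int n"
    using F(2) unfolding of_nat_add of_nat_mult i b by (simp add: power2_eq_square algebra_simps)
  then have s: "x * y + y * z + z * x = n" by (simp only: of_nat_eq_iff)
  have A: "A = int x + int y" and C: "C = int x + int z" using i by auto
  have "odd (x + y) \<or> odd (x + z)" using F(3) unfolding A C by (simp flip: of_nat_add)
  then have "even x = even y \<and> even x \<noteq> even z \<or> even y = even z \<and> even y \<noteq> even x \<or>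
      even z = even x \<and> even z \<noteq> even y" by auto
  then show ?thesis
  proof (elim disjE)
    assume "even x = even y \<and> even x \<noteq> even z"
    then show ?thesis using g(1) gF s by (auto simp: F_triples_def)
  next
    assume "even y = even z \<and> even y \<noteq> even x"
    then have "(y, z, x) \<in> F_triples n" using s by (auto simp: F_triples_def)
    then show ?thesis using SL2_equiv_trans[OF g(1)[unfolded gF] F_form_rotate] by blast
  next
    assume "even z = even x \<and> even z \<noteq> even y"
    then have "(z, x, y) \<in> F_triples n" using s by (auto simp: F_triples_def)
    then show ?thesis
      using SL2_equiv_trans[OF g(1)[unfolded gF] SL2_equiv_trans[OF F_form_rotate F_form_rotate]] by blast
  qed
qed

lemma inj_F_form: "F_form t = F_form t' \<longleftrightarrow> t = t'"
  by (cases t; cases t') (auto simp: F_form_def)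

lemma F_form_obtuse_unique:
  assumes "SL2_equiv (F_form (x, y, z)) g" "obtuse g"
  shows "g \<in> {F_form (x, y, z), F_form (y, z, x), F_form (z, x, y)} \<or>
    (x = 0 \<or> y = 0 \<or> z = 0) \<and> g \<in> {F_form (x, z, y), F_form (y, x, z), F_form (z, y, x)}"
proof -
  obtain A' B' C' where g: "g = (A', B', C')" by (cases g) auto
  define A B C where "A = int x + int y" and "B = 2 * int x" and "C = int x + int z"
  have f: "F_form (x, y, z) = (A, B, C)" by (simp add: F_form_def A_def B_def C_def)
  have rot: "(A - B + C, 2 * A - B, A) = F_form (y, z, x)" "(C, 2 * C - B, A - B + C) = F_form (z, x, y)"
    "(C, B, A) = F_form (x, z, y)" "(A, 2 * A - B, A - B + C) = F_form (y, x, z)"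
    "(A - B + C, 2 * C - B, C) = F_form (z, y, x)"
    by (simp_all add: F_form_def A_def B_def C_def)
  have bd: "(B = 0 \<or> B = 2 * A \<or> B = 2 * C) = (x = 0 \<or> y = 0 \<or> z = 0)"
    by (auto simp: A_def B_def C_def)
  show ?thesis
    using obtuse_unique[of A B C A' B' C'] assms F_form_obtuse[of "(x, y, z)"]
    unfolding rot bd f[symmetric] g[symmetric] by blast
qed

text \<open>Of the six permutations only the identity and the interchange of the first two entries
  keep the entry of exceptional parity in third place.\<close>

lemma F_form_equiv_iff:
  assumes "(x, y, z) \<in> F_triples n" "(x', y', z') \<in> F_triples n"
  shows "SL2_equiv (F_form (x, y, z)) (F_form (x', y', z')) \<longleftrightarrow>
    (x', y', z') = (x, y, z) \<or> (x = 0 \<or> y = 0 \<or> z = 0) \<and> (x', y', z') = (y, x, z)"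
proof
  assume "SL2_equiv (F_form (x, y, z)) (F_form (x', y', z'))"
  from F_form_obtuse_unique[OF this F_form_obtuse]
  have "(x', y', z') \<in> {(x, y, z), (y, z, x), (z, x, y)} \<or>
      (x = 0 \<or> y = 0 \<or> z = 0) \<and> (x', y', z') \<in> {(x, z, y), (y, x, z), (z, y, x)}"
    by (simp only: inj_F_form insert_iff empty_iff)
  moreover have "even x = even y" "even x \<noteq> even z" "even x' = even y'" "even x' \<noteq> even z'"
    using assms by (auto simp: F_triples_def)
  ultimately show "(x', y', z') = (x, y, z) \<or> (x = 0 \<or> y = 0 \<or> z = 0) \<and> (x', y', z') = (y, x, z)"
    by auto
next
  assume "(x', y', z') = (x, y, z) \<or> (x = 0 \<or> y = 0 \<or> z = 0) \<and> (x', y', z') = (y, x, z)"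
  then show "SL2_equiv (F_form (x, y, z)) (F_form (x', y', z'))"
    using SL2_equiv_refl F_form_flip by blast
qed

text \<open>The form \<open>(m, 0, m)\<close> has the parameters \<open>(0, m, m)\<close>, and
  \<open>m\<close> is odd for forms in \<open>F_forms\<close>; the rotation of this triple that lies
  in \<open>F_triples\<close> is \<open>(m, m, 0)\<close>.\<close>

lemma F_form_square_class:
  assumes "(x, y, z) \<in> F_triples n" "0 < n"
  shows "(\<exists>m. (m, 0, m) \<in> {g \<in> F_forms n. SL2_equiv (F_form (x, y, z)) g}) \<longleftrightarrow> x = y \<and> z = 0"
proof
  assume "\<exists>m. (m, 0, m) \<in> {g \<in> F_forms n. SL2_equiv (F_form (x, y, z)) g}"
  then obtain m where m: "(m, 0, m) \<in> F_forms n" "SL2_equiv (F_form (x, y, z)) (m, 0, m)" by blast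
  have "odd m" "0 < m" using m(1) by (auto simp: F_forms_iff pos_def_iff)
  then have "obtuse (m, 0, m)" by (simp add: obtuse_def)
  note u = F_form_obtuse_unique[OF m(2) this]
  have sq: "(m, 0, m) = F_form (0, nat m, nat m)" using \<open>0 < m\<close> by (simp add: F_form_def)
  have p: "even x = even y" "even x \<noteq> even z" using assms by (auto simp: F_triples_def)
  from u have "(0, nat m, nat m) \<in> {(x, y, z), (y, z, x), (z, x, y), (x, z, y), (y, x, z), (z, y, x)}"
    unfolding sq by (simp only: inj_F_form insert_iff empty_iff) argo
  then show "x = y \<and> z = 0" using p \<open>0 < m\<close> by auto
next
  assume h: "x = y \<and> z = 0"
  have "F_form (0, x, x) = (int x, 0, int x)" by (simp add: F_form_def)
  then have eq: "SL2_equiv (F_form (x, y, z)) (int x, 0, int x)"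
    using SL2_equiv_trans[OF F_form_rotate F_form_rotate] h by metis
  then show "\<exists>m. (m, 0, m) \<in> {g \<in> F_forms n. SL2_equiv (F_form (x, y, z)) g}"
    using F_forms_closed[OF F_form_in_F_forms[OF assms] eq] by blast
qed

text \<open>A class with a vanishing parameter comes from both \<open>(x, y, z)\<close> and
  \<open>(y, x, z)\<close>, which share the weight 1. If these coincide, the vanishing entry is
  \<open>z\<close> because \<open>n > 0\<close>, and the class is that of \<open>(m, 0, m)\<close>,
  which has weight 1/2 anyway.\<close>

lemma kronecker_F_eq_sum:
  assumes "0 < n"
  shows "kronecker_F n = (\<Sum>(x, y, z)\<in>F_triples n. if x = 0 \<or> y = 0 \<or> z = 0 then 1 / 2 else 1)"
  unfolding kronecker_F_def
proof (rule sum_SL2_classes[where \<phi> = F_form])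
  have "F_triples n \<subseteq> {(x, y, z). x * y + y * z + z * x = n}" by (auto simp: F_triples_def)
  then show "finite (F_triples n)" using finite_triples[OF assms] finite_subset by blast
  show "F_form t \<in> F_forms n" if "t \<in> F_triples n" for t
    using F_form_in_F_forms that assms by blast
  show "\<exists>t\<in>F_triples n. SL2_equiv f (F_form t)" if "f \<in> F_forms n" for f
    using F_form_representative[OF that] .
next
  fix t\<^sub>0 assume t\<^sub>0: "t\<^sub>0 \<in> F_triples n"
  obtain x y z where t: "t\<^sub>0 = (x, y, z)" by (cases t\<^sub>0) auto
  have p: "even x = even y" "even x \<noteq> even z" "x * y + y * z + z * x = n"
    using t\<^sub>0 by (auto simp: t F_triples_def)
  have mem: "(x, y, z) \<in> F_triples n" "(y, x, z) \<in> F_triples n"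
    using p by (auto simp: F_triples_def algebra_simps)
  let ?wt = "\<lambda>(x, y, z). if x = (0::nat) \<or> y = (0::nat) \<or> z = (0::nat) then 1 / 2 else (1::real)"
  have "(\<Sum>t\<in>{t \<in> F_triples n. SL2_equiv (F_form t\<^sub>0) (F_form t)}. ?wt t) = (if x = y \<and> z = 0 then 1 / 2 else 1)"
  proof (cases "x = 0 \<or> y = 0 \<or> z = 0")
    case False
    then have "{t \<in> F_triples n. SL2_equiv (F_form t\<^sub>0) (F_form t)} = {(x, y, z)}"
      using mem F_form_equiv_iff[OF mem(1)] SL2_equiv_refl by (auto simp: t)
    then show ?thesis using False by simp
  next
    case True
    then have "{t \<in> F_triples n. SL2_equiv (F_form t\<^sub>0) (F_form t)} = {(x, y, z), (y, x, z)}"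
      using mem F_form_equiv_iff[OF mem(1)] by (auto simp: t)
    moreover have "x = y \<Longrightarrow> z = 0" using True p(3) assms by auto
    ultimately show ?thesis using True by auto
  qed
  then show "(\<Sum>t\<in>{t \<in> F_triples n. SL2_equiv (F_form t\<^sub>0) (F_form t)}. ?wt t)
      = (if \<exists>m. (m, 0, m) \<in> {g \<in> F_forms n. SL2_equiv (F_form t\<^sub>0) g} then 1 / 2 else 1)"
    using F_form_square_class[OF mem(1) assms] by (simp add: t)
qed

section \<open>Forms of odd discriminant and odd triples\<close>

definition H_triples :: "nat \<Rightarrow> (nat \<times> nat \<times> nat) set" where
  "H_triples n = {(x, y, z). odd x \<and> odd y \<and> odd z \<and> x * y + y * z + z * x = n}"

text \<open>Half of \<open>y u^2 + z v^2 + x (u + v)^2\<close>. If the discriminant is odd, so is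
  the middle coefficient, and hence all three parameters are; in particular none vanishes, and the
  cyclic rotations are the only ambiguity.\<close>

definition H_form :: "nat \<times> nat \<times> nat \<Rightarrow> qform" where
  "H_form = (\<lambda>(x, y, z). ((int x + int y) div 2, int x, (int x + int z) div 2))"

lemma H_form_double:
  assumes "odd x" "odd y" "odd z"
  obtains A C where "H_form (x, y, z) = (A, int x, C)" "2 * A = int x + int y" "2 * C = int x + int z"
  using that assms by (simp add: H_form_def)

lemma H_triplesD:
  assumes "(x, y, z) \<in> H_triples n"
  shows "odd x" "odd y" "odd z" "x * y + y * z + z * x = n"
  using assms by (auto simp: H_triples_def)

lemma H_form_obtuse:
  assumes "(x, y, z) \<in> H_triples n"
  shows "obtuse (H_form (x, y, z))"
  by (rule H_form_double[OF H_triplesD(1-3)[OF assms]]) (simp add: obtuse_def)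

lemma inj_H_form:
  assumes "(x, y, z) \<in> H_triples n" "(x', y', z') \<in> H_triples n'"
  shows "H_form (x, y, z) = H_form (x', y', z') \<longleftrightarrow> (x, y, z) = (x', y', z')"
proof -
  obtain A C A' C' where "H_form (x, y, z) = (A, int x, C)" "2 * A = int x + int y" "2 * C = int x + int z"
    "H_form (x', y', z') = (A', int x', C')" "2 * A' = int x' + int y'" "2 * C' = int x' + int z'"
    by (rule H_form_double[OF H_triplesD(1-3)[OF assms(1)]], rule H_form_double[OF H_triplesD(1-3)[OF assms(2)]])
  then show ?thesis by auto
qed

lemma H_form_in_H_forms:
  assumes "(x, y, z) \<in> H_triples n"
  shows "H_form (x, y, z) \<in> H_forms n"
proof -
  note o = H_triplesD[OF assms]
  obtain A C where f: "H_form (x, y, z) = (A, int x, C)" "2 * A = int x + int y" "2 * C = int x + int z"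
    by (rule H_form_double[OF o(1-3)])
  have n: "int x * int y + int y * int z + int z * int x = int n"
    using o(4) by (simp flip: of_nat_mult of_nat_add)
  have "(int x)\<^sup>2 - 4 * A * C = (int x)\<^sup>2 - (2 * A) * (2 * C)" by simp
  also have "\<dots> = - int n"
    unfolding f(2,3) n[symmetric] by (simp add: power2_eq_square algebra_simps)
  finally have d: "(int x)\<^sup>2 - 4 * A * C = - int n" .
  have "0 < x" "0 < y" "0 < z" using o(1-3) odd_pos by auto
  then have "0 < n" using o(4) by (metis add_gr_0 nat_0_less_mult_iff)
  then show ?thesis
    using d f \<open>0 < x\<close> by (auto simp: H_forms_def pos_def_iff)
qed

lemma H_form_rotate:
  assumes "(x, y, z) \<in> H_triples n"
  shows "SL2_equiv (H_form (x, y, z)) (H_form (y, z, x))"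
proof -
  note o = H_triplesD[OF assms]
  obtain A C where f: "H_form (x, y, z) = (A, int x, C)" "2 * A = int x + int y" "2 * C = int x + int z"
    by (rule H_form_double[OF o(1-3)])
  obtain A' C' where f': "H_form (y, z, x) = (A', int y, C')" "2 * A' = int y + int z" "2 * C' = int y + int x"
    by (rule H_form_double[OF o(2,3,1)])
  have "(A', int y, C') = (A - int x + C, 2 * A - int x, A)" using f(2,3) f'(2,3) by simp
  then show ?thesis unfolding f(1) f'(1) using obtuse_rotate by metis
qed

lemma H_forms_closed:
  assumes "f \<in> H_forms n" "SL2_equiv f g"
  shows "g \<in> H_forms n"
proof -
  obtain A B C where f: "f = (A, B, C)" by (cases f) auto
  obtain A' B' C' where g: "g = (A', B', C')" by (cases g) auto
  have eq: "SL2_equiv (A, B, C) (A', B', C')" using assms(2) f g by simp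
  show ?thesis
    using assms(1) SL2_equiv_disc[OF eq] SL2_equiv_pos_def[OF eq] by (auto simp: f g H_forms_def)
qed

lemma H_form_obtuse_unique:
  assumes t: "(x, y, z) \<in> H_triples n" and "SL2_equiv (H_form (x, y, z)) g" "obtuse g"
  shows "g \<in> {H_form (x, y, z), H_form (y, z, x), H_form (z, x, y)}"
proof -
  note o = H_triplesD[OF t]
  obtain A' B' C' where g: "g = (A', B', C')" by (cases g) auto
  obtain A C where f: "H_form (x, y, z) = (A, int x, C)" "2 * A = int x + int y" "2 * C = int x + int z"
    by (rule H_form_double[OF o(1-3)])
  obtain A1 C1 where f1: "H_form (y, z, x) = (A1, int y, C1)" "2 * A1 = int y + int z" "2 * C1 = int y + int x"
    by (rule H_form_double[OF o(2,3,1)])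
  obtain A2 C2 where f2: "H_form (z, x, y) = (A2, int z, C2)" "2 * A2 = int z + int x" "2 * C2 = int z + int y"
    by (rule H_form_double[OF o(3,1,2)])
  have rot: "(A - int x + C, 2 * A - int x, A) = H_form (y, z, x)"
    "(C, 2 * C - int x, A - int x + C) = H_form (z, x, y)"
    unfolding f1(1) f2(1) using f f1 f2 by simp_all
  have bd: "\<not> (int x = 0 \<or> int x = 2 * A \<or> int x = 2 * C)"
    using f o(1-3) by (auto intro: Nat.gr0I)
  show ?thesis
    using obtuse_unique[of A "int x" C A' B' C'] assms H_form_obtuse[OF t] bd
    unfolding rot f(1)[symmetric] g[symmetric] by blast
qed

lemma H_form_equiv_iff:
  assumes "(x, y, z) \<in> H_triples n" "(x', y', z') \<in> H_triples n'"
  shows "SL2_equiv (H_form (x, y, z)) (H_form (x', y', z')) \<longleftrightarrow>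
    (x', y', z') \<in> {(x, y, z), (y, z, x), (z, x, y)}"
proof -
  have r: "(y, z, x) \<in> H_triples n" "(z, x, y) \<in> H_triples n"
    using assms(1) by (auto simp: H_triples_def algebra_simps)
  note tr = SL2_equiv_trans
  have "SL2_equiv (H_form (x, y, z)) (H_form (y, z, x))" "SL2_equiv (H_form (x, y, z)) (H_form (z, x, y))"
    using H_form_rotate[OF assms(1)] H_form_rotate[OF r(1)] tr by blast+
  moreover have "(x', y', z') \<in> {(x, y, z), (y, z, x), (z, x, y)}"
    if "SL2_equiv (H_form (x, y, z)) (H_form (x', y', z'))"
    using H_form_obtuse_unique[OF assms(1) that H_form_obtuse[OF assms(2)]]
    by (simp only: inj_H_form[OF assms(2,1)] inj_H_form[OF assms(2) r(1)] inj_H_form[OF assms(2) r(2)]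
        insert_iff empty_iff)
  ultimately show ?thesis using SL2_equiv_refl by blast
qed

lemma H_form_representative:
  assumes "f \<in> H_forms n" "odd n"
  shows "\<exists>t\<in>H_triples n. SL2_equiv f (H_form t)"
proof -
  have "pos_def f" using assms by (cases f) (auto simp: H_forms_def)
  then obtain g where g: "SL2_equiv f g" "obtuse g" by (rule obtuse_representative)
  obtain A B C where ABC: "g = (A, B, C)" by (cases g) auto
  have d: "B\<^sup>2 - 4 * A * C = - int n"
    using H_forms_closed[OF assms(1) g(1)] by (auto simp: ABC H_forms_def)
  have "odd B"
  proof
    assume "even B"
    then have "even (B\<^sup>2 - 4 * A * C)" by simp
    then show False using d assms(2) by simp
  qed
  have n: "0 \<le> B" "B \<le> 2 * A" "B \<le> 2 * C" using g(2) by (auto simp: ABC obtuse_def)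
  define x y z where "x = nat B" and "y = nat (2 * A - B)" and "z = nat (2 * C - B)"
  have i: "int x = B" "int y = 2 * A - B" "int z = 2 * C - B" using n by (auto simp: x_def y_def z_def)
  have "odd (int x)" "odd (int y)" "odd (int z)" unfolding i using \<open>odd B\<close> by simp_all
  then have o: "odd x" "odd y" "odd z" by simp_all
  have "int (x * y + y * z + z * x) = int n"
    using d unfolding of_nat_add of_nat_mult i by (simp add: power2_eq_square algebra_simps)
  then have "(x, y, z) \<in> H_triples n" using o by (simp add: H_triples_def del: of_nat_add of_nat_mult)
  moreover have "H_form (x, y, z) = g" by (simp add: H_form_def ABC i)
  ultimately show ?thesis using g(1) by auto
qed

lemma finite_H_triples: "odd n \<Longrightarrow> finite (H_triples n)"
  by (rule finite_subset[OF _ finite_triples[of n]]) (auto simp: H_triples_def intro: Nat.gr0I)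

lemma H_form_class_weights:
  assumes "(x, y, z) \<in> H_triples n"
  shows "\<not> (\<exists>m. (m, 0, m) \<in> {g \<in> H_forms n. SL2_equiv (H_form (x, y, z)) g})"
    and "(\<exists>m. (m, m, m) \<in> {g \<in> H_forms n. SL2_equiv (H_form (x, y, z)) g}) \<longleftrightarrow> x = y \<and> y = z"
proof -
  note o = H_triplesD[OF assms]
  have "odd n" using o by auto
  have "odd B" if "(A, B, C) \<in> H_forms n" for A B C
  proof
    assume "even B"
    then have "even (B\<^sup>2 - 4 * A * C)" by simp
    moreover have "B\<^sup>2 - 4 * A * C = - int n" using that by (simp add: H_forms_def)
    ultimately have "even (- int n)" by (simp only:)
    then show False using \<open>odd n\<close> by simp
  qed
  note oddB = this
  show "\<not> (\<exists>m. (m, 0, m) \<in> {g \<in> H_forms n. SL2_equiv (H_form (x, y, z)) g})"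
    using oddB by fastforce
  show "(\<exists>m. (m, m, m) \<in> {g \<in> H_forms n. SL2_equiv (H_form (x, y, z)) g}) \<longleftrightarrow> x = y \<and> y = z"
  proof
    assume "\<exists>m. (m, m, m) \<in> {g \<in> H_forms n. SL2_equiv (H_form (x, y, z)) g}"
    then obtain m where m: "(m, m, m) \<in> H_forms n" "SL2_equiv (H_form (x, y, z)) (m, m, m)" by blast
    have m0: "0 < m" using m(1) by (auto simp: H_forms_def pos_def_iff)
    have "odd (nat m)" using oddB[OF m(1)] m0 by (simp add: even_nat_iff)
    \<comment> \<open>This triple is taken with its own discriminant \<open>- 3 m^2\<close>;
      \<open>H_form_equiv_iff\<close> allows the two discriminants to differ a priori.\<close>
    then have sq: "(nat m, nat m, nat m) \<in> H_triples (3 * nat m * nat m)"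
      by (simp add: H_triples_def)
    have eq: "(m, m, m) = H_form (nat m, nat m, nat m)" using m0 by (simp add: H_form_def)
    have "(nat m, nat m, nat m) \<in> {(x, y, z), (y, z, x), (z, x, y)}"
      using m(2) H_form_equiv_iff[OF assms sq] unfolding eq by blast
    then show "x = y \<and> y = z" by auto
  next
    assume "x = y \<and> y = z"
    then have "H_form (x, y, z) = (int x, int x, int x)" by (simp add: H_form_def)
    then show "\<exists>m. (m, m, m) \<in> {g \<in> H_forms n. SL2_equiv (H_form (x, y, z)) g}"
      using H_form_in_H_forms[OF assms] SL2_equiv_refl by auto
  qed
qed

section \<open>Both class numbers as cardinalities of the same sets\<close>

definition T_triples :: "nat \<Rightarrow> (nat \<times> nat \<times> nat) set" where
  "T_triples n = {(x, y, z) \<in> H_triples n. x mod 4 = y mod 4}"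

lemma odd_mod_4: "odd (x::nat) \<Longrightarrow> x mod 4 = 1 \<or> x mod 4 = 3"
  by presburger

text \<open>A check of 64 residue triples. Two of three odd numbers always agree modulo 4, so the
  residue 7 means that exactly two of them agree.\<close>

lemma odd_triple_mod_8:
  fixes x y z :: nat
  assumes "odd x" "odd y" "odd z"
  shows "(x * y + y * z + z * x) mod 8 = (if x mod 4 = y mod 4 \<and> y mod 4 = z mod 4 then 3 else 7)"
proof -
  have r: "x mod 8 \<in> {1, 3, 5, 7}" if "odd x" for x :: nat
    using that by simp presburger
  have "\<forall>a\<in>{1, 3, 5, 7}. \<forall>b\<in>{1, 3, 5, 7}. \<forall>c\<in>{1, 3, 5, 7::nat}.
      (a * b + b * c + c * a) mod 8 = (if a mod 4 = b mod 4 \<and> b mod 4 = c mod 4 then 3 else 7)"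
    by simp
  then have "(x mod 8 * (y mod 8) + y mod 8 * (z mod 8) + z mod 8 * (x mod 8)) mod 8
      = (if x mod 8 mod 4 = y mod 8 mod 4 \<and> y mod 8 mod 4 = z mod 8 mod 4 then 3 else 7)"
    using r assms by blast
  moreover have "x mod 8 mod 4 = x mod 4" for x :: nat by (simp add: mod_mod_cancel)
  moreover have "(x * y + y * z + z * x) mod 8 =
      (x mod 8 * (y mod 8) + y mod 8 * (z mod 8) + z mod 8 * (x mod 8)) mod 8"
    by (intro mod_add_cong mod_mult_cong) simp_all
  ultimately show ?thesis by simp
qed

text \<open>Exactly two entries agree modulo 4, so exactly one of the three rotations has them in
  the first two places, and no triple is constant; hence each class has weight 1 and one
  representative.\<close>

lemma hurwitz_H_8n_minus_1:
  assumes "n mod 8 = 7"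
  shows "hurwitz_H n = real (card (T_triples n))"
proof -
  have "odd n" using assms by presburger
  have "hurwitz_H n = (\<Sum>t\<in>T_triples n. 1)"
    unfolding hurwitz_H_def
  proof (rule sum_SL2_classes[where \<phi> = H_form])
    show "finite (T_triples n)"
      by (rule finite_subset[OF _ finite_H_triples[OF \<open>odd n\<close>]]) (auto simp: T_triples_def)
    show "H_form t \<in> H_forms n" if "t \<in> T_triples n" for t
      using that H_form_in_H_forms by (auto simp: T_triples_def)
    show "\<exists>t\<in>T_triples n. SL2_equiv f (H_form t)" if f: "f \<in> H_forms n" for f
    proof -
      obtain x y z where t: "(x, y, z) \<in> H_triples n" "SL2_equiv f (H_form (x, y, z))"
        using H_form_representative[OF f \<open>odd n\<close>] by auto
      have r: "(y, z, x) \<in> H_triples n" "(z, x, y) \<in> H_triples n"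
        using t(1) by (auto simp: H_triples_def algebra_simps)
      have "SL2_equiv f (H_form (y, z, x))" "SL2_equiv f (H_form (z, x, y))"
        using t(2) H_form_rotate[OF t(1)] H_form_rotate[OF r(1)] SL2_equiv_trans by blast+
      moreover have "x mod 4 = y mod 4 \<or> y mod 4 = z mod 4 \<or> z mod 4 = x mod 4"
        using odd_mod_4 H_triplesD[OF t(1)] by metis
      ultimately show ?thesis using t r unfolding T_triples_def by blast
    qed
  next
    fix t\<^sub>0 assume "t\<^sub>0 \<in> T_triples n"
    then obtain x y z where t: "t\<^sub>0 = (x, y, z)" "(x, y, z) \<in> H_triples n" "x mod 4 = y mod 4"
      by (auto simp: T_triples_def)
    have z: "z mod 4 \<noteq> x mod 4"
      using odd_triple_mod_8[OF H_triplesD(1-3)[OF t(2)]] H_triplesD(4)[OF t(2)] t(3) assms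
      by (auto split: if_splits)
    have fib: "{t \<in> T_triples n. SL2_equiv (H_form t\<^sub>0) (H_form t)} = {(x, y, z)}"
      using t z H_form_equiv_iff[OF t(2)] unfolding T_triples_def by auto
    have "\<not> (x = y \<and> y = z)" using z by auto
    then show "(\<Sum>t\<in>{t \<in> T_triples n. SL2_equiv (H_form t\<^sub>0) (H_form t)}. 1) =
      (if \<exists>m. (m, 0, m) \<in> {g \<in> H_forms n. SL2_equiv (H_form t\<^sub>0) g} then 1 / 2
       else if \<exists>m. (m, m, m) \<in> {g \<in> H_forms n. SL2_equiv (H_form t\<^sub>0) g} then 1 / 3 else 1 :: real)"
      unfolding fib unfolding t(1)
      by (simp only: H_form_class_weights[OF t(2)] if_False) simp
  qed
  then show ?thesis by simp
qed

text \<open>All three entries agree modulo 4. With weight 1/3 per triple, an orbit of three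
  rotations adds up to 1, and a constant triple has the weight 1/3 of its class.\<close>

lemma hurwitz_H_8n_minus_5:
  assumes "n mod 8 = 3"
  shows "3 * hurwitz_H n = real (card (T_triples n))"
proof -
  have "odd n" using assms by presburger
  have T: "T_triples n = H_triples n"
    using odd_triple_mod_8 assms unfolding T_triples_def H_triples_def by (auto split: if_splits)
  have "hurwitz_H n = (\<Sum>t\<in>H_triples n. 1 / 3)"
    unfolding hurwitz_H_def
  proof (rule sum_SL2_classes[where \<phi> = H_form])
    show "finite (H_triples n)" using finite_H_triples \<open>odd n\<close> .
    show "H_form t \<in> H_forms n" if "t \<in> H_triples n" for t
      using that H_form_in_H_forms by (cases t) auto
    show "\<exists>t\<in>H_triples n. SL2_equiv f (H_form t)" if "f \<in> H_forms n" for f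
      using H_form_representative[OF that \<open>odd n\<close>] .
  next
    fix t\<^sub>0 assume t\<^sub>0: "t\<^sub>0 \<in> H_triples n"
    obtain x y z where t: "t\<^sub>0 = (x, y, z)" by (cases t\<^sub>0) auto
    have m: "(x, y, z) \<in> H_triples n" "(y, z, x) \<in> H_triples n" "(z, x, y) \<in> H_triples n"
      using t\<^sub>0 by (auto simp: t H_triples_def algebra_simps)
    have fib: "{t \<in> H_triples n. SL2_equiv (H_form t\<^sub>0) (H_form t)} = {(x, y, z), (y, z, x), (z, x, y)}"
    proof (intro set_eqI)
      fix u :: "nat \<times> nat \<times> nat"
      obtain a b c where u: "u = (a, b, c)" by (cases u) auto
      show "u \<in> {t \<in> H_triples n. SL2_equiv (H_form t\<^sub>0) (H_form t)} \<longleftrightarrow> u \<in> {(x, y, z), (y, z, x), (z, x, y)}"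
      proof (cases "u \<in> H_triples n")
        case True
        then show ?thesis unfolding t u mem_Collect_eq using H_form_equiv_iff[OF m(1), of a b c n] by blast
      next
        case False
        then show ?thesis using m by blast
      qed
    qed
    have "(\<Sum>t\<in>{(x, y, z), (y, z, x), (z, x, y)}. 1 / 3 :: real) = (if x = y \<and> y = z then 1 / 3 else 1)"
    proof (cases "x = y \<and> y = z")
      case False
      then have "(x, y, z) \<noteq> (y, z, x)" "(y, z, x) \<noteq> (z, x, y)" "(x, y, z) \<noteq> (z, x, y)"
        by (simp; blast)+
      with False show ?thesis by simp
    qed simp
    then show "(\<Sum>t\<in>{t \<in> H_triples n. SL2_equiv (H_form t\<^sub>0) (H_form t)}. 1 / 3) =
      (if \<exists>m. (m, 0, m) \<in> {g \<in> H_forms n. SL2_equiv (H_form t\<^sub>0) g} then 1 / 2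
       else if \<exists>m. (m, m, m) \<in> {g \<in> H_forms n. SL2_equiv (H_form t\<^sub>0) g} then 1 / 3 else 1 :: real)"
      unfolding fib unfolding t
      by (simp only: H_form_class_weights[OF m(1)] if_False)
  qed
  then show ?thesis by (simp add: T)
qed

text \<open>If \<open>x\<close> and \<open>y\<close> agreed modulo 4, then \<open>x y\<close> would
  be 1 modulo 4 and \<open>z (x + y)\<close> a product of two even numbers, so \<open>n\<close>
  would be 1 modulo 4.\<close>

lemma F_triples_3_mod_4:
  assumes "(x, y, z) \<in> F_triples n" "n mod 4 = 3"
  shows "odd x" "odd y" "even z" "x mod 4 \<noteq> y mod 4"
proof -
  have p: "even x = even y" "even x \<noteq> even z" "x * y + y * z + z * x = n"
    using assms(1) by (auto simp: F_triples_def)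
  have n: "odd n" using assms(2) by presburger
  show x: "odd x"
  proof
    assume "even x"
    then have "even (x * y + y * z + z * x)" using p(1) by simp
    then show False using p(3) n by simp
  qed
  show y: "odd y" and z: "even z" using x p by auto
  show "x mod 4 \<noteq> y mod 4"
  proof
    assume e: "x mod 4 = y mod 4"
    obtain k where z: "z = 2 * k" using z by auto
    have "even (x + y)" using x y by simp
    then obtain l where l: "x + y = 2 * l" by (rule evenE)
    have "n = x * y + z * (x + y)" using p(3) by (simp add: algebra_simps)
    also have "\<dots> = x * y + 4 * (k * l)" by (simp add: z l)
    finally have "n mod 4 = (x * y) mod 4" by simp
    also have "\<dots> = (x mod 4) * (y mod 4) mod 4" by (simp add: mod_mult_eq)
    also have "\<dots> = 1" using odd_mod_4[OF y] e by auto
    finally show False using assms(2) by simp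
  qed
qed

text \<open>Write the larger of the first two entries as the smaller one, \<open>x\<close>, plus
  \<open>2 s\<close>. Then \<open>n = x^2 + 2 x s + 2 x z + 2 s z\<close> is symmetric in
  \<open>s\<close> and \<open>z\<close>. Interchanging them carries triples with \<open>s\<close>
  odd and \<open>z\<close> even (\<open>F_triples\<close>) to triples with \<open>s\<close> even and
  \<open>z\<close> odd (\<open>T_triples\<close>). Triples with \<open>z = 0\<close> have weight
  1/2, so one of each mirror pair is kept; it corresponds to a triple of \<open>T_triples\<close>
  with equal first entries.\<close>

lemma kronecker_F_3_mod_4:
  assumes n: "n mod 4 = 3"
  shows "kronecker_F n = real (card (T_triples n))"
proof -
  have "0 < n" using n by (intro Nat.gr0I) simp
  have fin: "finite (F_triples n)"
    by (rule finite_subset[OF _ finite_triples[OF \<open>0 < n\<close>]]) (auto simp: F_triples_def)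
  define A where "A = {(x, y, z) \<in> F_triples n. z \<noteq> 0}"
  define L where "L = {(x, y, z) \<in> F_triples n. z = 0 \<and> x < y}"
  define G where "G = {(x, y, z) \<in> F_triples n. z = 0 \<and> y < x}"
  note F = F_triples_3_mod_4[OF _ n]
  have split: "F_triples n = A \<union> (L \<union> G)"
    using F(4) unfolding A_def L_def G_def by (auto simp: not_less) (metis le_neq_implies_less)
  have finA: "finite A" "finite L" "finite G"
    using fin split by (auto intro: finite_subset)
  have disj: "A \<inter> (L \<union> G) = {}" "L \<inter> G = {}" "A \<inter> L = {}"
    by (auto simp: A_def L_def G_def)
  let ?wt = "\<lambda>(x, y, z). if x = (0::nat) \<or> y = (0::nat) \<or> z = (0::nat) then 1 / 2 else (1::real)"
  have "card L = card G"
    by (rule bij_betw_same_card[of "\<lambda>(x, y, z). (y, x, z)"],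
        rule bij_betwI[of _ _ _ "\<lambda>(x, y, z). (y, x, z)"])
      (auto simp: L_def G_def F_triples_def algebra_simps)
  have "sum ?wt A = real (card A)"
  proof -
    have "sum ?wt A = (\<Sum>t\<in>A. 1)"
      by (rule sum.cong[OF refl]) (use F in \<open>fastforce simp: A_def intro: Nat.gr0I\<close>)
    then show ?thesis by simp
  qed
  moreover have "sum ?wt L = real (card L) / 2"
  proof -
    have "sum ?wt L = (\<Sum>t\<in>L. 1 / 2)" by (rule sum.cong[OF refl]) (auto simp: L_def)
    then show ?thesis by simp
  qed
  moreover have "sum ?wt G = real (card G) / 2"
  proof -
    have "sum ?wt G = (\<Sum>t\<in>G. 1 / 2)" by (rule sum.cong[OF refl]) (auto simp: G_def)
    then show ?thesis by simp
  qed
  moreover have "kronecker_F n = sum ?wt A + (sum ?wt L + sum ?wt G)"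
    unfolding kronecker_F_eq_sum[OF \<open>0 < n\<close>] split
    using finA disj by (subst sum.union_disjoint) (auto intro!: sum.union_disjoint simp del: sum_of_bool_eq)
  ultimately have "kronecker_F n = real (card A + card L)"
    using \<open>card L = card G\<close> by simp
  also have "card A + card L = card (A \<union> L)"
    using finA disj by (simp add: card_Un_disjoint)
  also have "card (A \<union> L) = card (T_triples n)"
  proof (rule bij_betw_same_card, rule bij_betwI)
    \<comment> \<open>Both maps make the same interchange. The tie \<open>x = y\<close> occurs only
      in \<open>T_triples\<close>, and \<open>?g\<close> must send it to the retained half
      \<open>x < y\<close>, \<open>z = 0\<close>; this is why it compares with
      \<open>\<le>\<close>.\<close>
    let ?f = "\<lambda>(x, y, z). if x < y then (x, x + 2 * z, (y - x) div 2) else (y + 2 * z, y, (x - y) div (2::nat))"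
    let ?g = "\<lambda>(x, y, z). if x \<le> y then (x, x + 2 * z, (y - x) div 2) else (y + 2 * z, y, (x - y) div (2::nat))"
    have mem: "t \<in> A \<union> L \<longleftrightarrow> (case t of (x, y, z) \<Rightarrow> (x, y, z) \<in> F_triples n \<and> (z = 0 \<longrightarrow> x < y))" for t
      by (auto simp: A_def L_def)
    have core: "(x, x + 2 * z, s) \<in> T_triples n \<and> (x + 2 * z, x, s) \<in> T_triples n"
      if "(x, x + 2 * s, z) \<in> F_triples n" for x s z
    proof -
      note o = F[OF that]
      have s: "x * (x + 2 * s) + (x + 2 * s) * z + z * x = n" using that by (simp add: F_triples_def)
      obtain k where k: "z = 2 * k" using o(3) by auto
      have "odd s"
      proof
        assume "even s"
        then have "(x + 2 * s) mod 4 = x mod 4" by auto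
        then show False using o(4) by simp
      qed
      moreover have "x mod 4 = (x + 2 * z) mod 4" by (simp add: k)
      ultimately show ?thesis
        using o s by (auto simp: T_triples_def H_triples_def algebra_simps)
    qed
    have core': "(x, x + 2 * s, z) \<in> F_triples n" "(x + 2 * s, x, z) \<in> F_triples n"
      if h: "(x, x + 2 * z, s) \<in> H_triples n" "x mod 4 = (x + 2 * z) mod 4" for x s z
    proof -
      have "even z"
      proof (rule ccontr)
        assume "odd z"
        then obtain k where "z = 2 * k + 1" by (auto elim: oddE)
        then have "x + 2 * z = x + 2 + k * 4" by simp
        then have "(x + 2 * z) mod 4 = (x + 2) mod 4" by (simp only: mod_mult_self1)
        then have "x mod 4 = (x + 2) mod 4" using h(2) by (simp only:)
        then show False by presburger
      qed
      then show "(x, x + 2 * s, z) \<in> F_triples n" "(x + 2 * s, x, z) \<in> F_triples n"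
        using h by (auto simp: F_triples_def H_triples_def algebra_simps)
    qed
    have rot: "(x, y, z) \<in> H_triples n \<longleftrightarrow> (y, x, z) \<in> H_triples n" for x y z
      by (auto simp: H_triples_def algebra_simps)
    have Fsym: "(x, y, z) \<in> F_triples n \<longleftrightarrow> (y, x, z) \<in> F_triples n" for x y z
      by (auto simp: F_triples_def algebra_simps)
    have diff: "\<exists>s. y = x + 2 * s" if "odd x" "odd y" "x \<le> y" for x y :: nat
    proof -
      have "even (y - x)" using that by simp
      then obtain s where "y - x = 2 * s" by (rule evenE)
      then show ?thesis using that(3) by (intro exI[of _ s]) simp
    qed
    show "?f \<in> A \<union> L \<rightarrow> T_triples n"
    proof
      fix t assume t: "t \<in> A \<union> L"
      obtain x y z where xyz: "t = (x, y, z)" by (cases t) auto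
      have h: "(x, y, z) \<in> F_triples n" using t mem xyz by simp
      note o = F[OF h]
      show "?f t \<in> T_triples n"
      proof (cases "x < y")
        case True
        then obtain s where "y = x + 2 * s" using diff o by fastforce
        then show ?thesis using core[of x s z] h True xyz by simp
      next
        case False
        then obtain s where "x = y + 2 * s" using diff o by fastforce
        then show ?thesis using core[of y s z] h False xyz Fsym by simp
      qed
    qed
    show "?g \<in> T_triples n \<rightarrow> A \<union> L"
    proof
      fix t assume t: "t \<in> T_triples n"
      obtain x y z where xyz: "t = (x, y, z)" by (cases t) auto
      have h: "(x, y, z) \<in> H_triples n" "x mod 4 = y mod 4" using t xyz by (auto simp: T_triples_def)
      note o = H_triplesD[OF h(1)]
      have z: "0 < z" using o(3) odd_pos by blast
      show "?g t \<in> A \<union> L"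
      proof (cases "x \<le> y")
        case True
        then obtain s where "y = x + 2 * s" using diff o by fastforce
        then show ?thesis using core'(1)[of x s z] h True xyz mem z by simp
      next
        case False
        then obtain s where s: "x = y + 2 * s" using diff o by fastforce
        then have "0 < s" using False by (intro Nat.gr0I) simp
        then show ?thesis using core'(2)[of y s z] h False xyz mem z s rot by simp
      qed
    qed
    show "?g (?f t) = t" if t: "t \<in> A \<union> L" for t
    proof -
      obtain x y z where xyz: "t = (x, y, z)" by (cases t) auto
      have h: "(x, y, z) \<in> F_triples n" "z = 0 \<longrightarrow> x < y" using t mem xyz by simp_all
      note o = F[OF h(1)]
      show ?thesis
      proof (cases "x < y")
        case True
        then obtain s where "y = x + 2 * s" using diff o by fastforce
        then show ?thesis using True xyz by simp
      next
        case False
        then obtain s where "x = y + 2 * s" using diff o by fastforce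
        then show ?thesis using False xyz h by simp
      qed
    qed
    show "?f (?g t) = t" if t: "t \<in> T_triples n" for t
    proof -
      obtain x y z where xyz: "t = (x, y, z)" by (cases t) auto
      have h: "(x, y, z) \<in> H_triples n" "x mod 4 = y mod 4" using t xyz by (auto simp: T_triples_def)
      note o = H_triplesD[OF h(1)]
      have z: "0 < z" using o(3) odd_pos by blast
      show ?thesis
      proof (cases "x \<le> y")
        case True
        then obtain s where "y = x + 2 * s" using diff o by fastforce
        then show ?thesis using True xyz z by simp
      next
        case False
        then obtain s where "x = y + 2 * s" using diff o by fastforce
        then show ?thesis using False xyz z by simp
      qed
    qed
  qed
  finally show ?thesis .
qed

section \<open>Generating functions\<close>

lemma geometric_has_sum:
  fixes z :: complex
  assumes "norm z < 1"
  shows "((\<lambda>k. z ^ k) has_sum 1 / (1 - z)) UNIV"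
proof -
  have "summable (\<lambda>k. norm (z ^ k))" using assms by (simp add: norm_power summable_geometric)
  from norm_summable_imp_has_sum[OF this geometric_sums[OF assms]] show ?thesis .
qed

lemma summable_on_power: "0 \<le> r \<Longrightarrow> r < 1 \<Longrightarrow> (\<lambda>k. r ^ k) summable_on (UNIV :: nat set)" for r :: real
  by (rule summable_nonneg_imp_summable_on) (auto intro: summable_geometric)

lemma summable_on_prod:
  fixes f g :: "_ \<Rightarrow> real"
  assumes "f summable_on A" "g summable_on B" "\<And>x. x \<in> A \<Longrightarrow> 0 \<le> f x" "\<And>y. y \<in> B \<Longrightarrow> 0 \<le> g y"
  shows "(\<lambda>(x, y). f x * g y) summable_on A \<times> B"
proof (rule summable_on_SigmaI)
  show "((\<lambda>y. case (x, y) of (x, y) \<Rightarrow> f x * g y) has_sum f x * infsum g B) B" for x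
    using assms(2) by (auto intro: has_sum_cmult_right)
  show "(\<lambda>x. f x * infsum g B) summable_on A"
    using assms(1) by (rule summable_on_cmult_left)
qed (use assms in auto)

lemma generating_function_has_sum:
  fixes q :: complex and e :: "'a \<Rightarrow> nat" and c :: "'a \<Rightarrow> real"
  assumes S: "((\<lambda>t. of_real (c t) * q ^ e t) has_sum S) A"
    and pos: "\<And>t. t \<in> A \<Longrightarrow> 1 \<le> e t"
    and fin: "\<And>n. 1 \<le> n \<Longrightarrow> finite {t \<in> A. e t = n}"
    and h: "\<And>n. 1 \<le> n \<Longrightarrow> h n = (\<Sum>t\<in>{t \<in> A. e t = n}. c t)"
  shows "((\<lambda>n. of_real (h n) * q ^ n) has_sum S) {1..}"
proof -
  have "((\<lambda>(n, t). of_real (c t) * q ^ e t) has_sum S) (SIGMA n:{1..}. {t \<in> A. e t = n})"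
    by (rule iffD1[OF has_sum_reindex_bij_witness[of A snd "\<lambda>t. (e t, t)"] S]) (use pos in auto)
  then show ?thesis
  proof (rule has_sum_SigmaD)
    fix n :: nat assume n: "n \<in> {1..}"
    have "of_real (h n) * q ^ n = (\<Sum>t\<in>{t \<in> A. e t = n}. of_real (c t) * q ^ e t)"
      using h[of n] n by (simp add: sum_distrib_right)
    then show "((\<lambda>t. case (n, t) of (n, t) \<Rightarrow> of_real (c t) * q ^ e t) has_sum of_real (h n) * q ^ n)
        {t \<in> A. e t = n}"
      using fin n by (auto intro!: has_sum_finiteI)
  qed
qed

text \<open>All index sets below consist of \<open>(m, a, k)\<close> with \<open>a < m\<close>; such a triple is counted by
  \<open>a\<close>, \<open>m - 1 - a\<close> and \<open>k\<close>, whose sum is the exponent in the bound.\<close>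

lemma summable_on_triples:
  fixes f :: "nat \<times> nat \<times> nat \<Rightarrow> complex"
  assumes r: "0 \<le> r" "r < 1" and B: "\<And>m a k. (m, a, k) \<in> B \<Longrightarrow> a < m"
    and f: "\<And>m a k. (m, a, k) \<in> B \<Longrightarrow> norm (f (m, a, k)) \<le> C * r ^ (m - 1 + k)"
  shows "f summable_on B"
proof -
  have g: "(\<lambda>k. r ^ k) summable_on (UNIV :: nat set)" using r by (rule summable_on_power)
  have "(\<lambda>(b, k). r ^ b * r ^ k) summable_on (UNIV \<times> UNIV :: (nat \<times> nat) set)"
    by (rule summable_on_prod[OF g g]) (use r in auto)
  from summable_on_prod[OF g this]
  have "(\<lambda>(a, p). r ^ a * (case p of (b, k) \<Rightarrow> r ^ b * r ^ k)) summable_on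
      (UNIV \<times> UNIV \<times> UNIV :: (nat \<times> nat \<times> nat) set)"
    using r by auto
  then have s: "(\<lambda>(a, b, k). r ^ (a + b + k)) summable_on (UNIV :: (nat \<times> nat \<times> nat) set)"
    by (simp add: case_prod_unfold power_add mult.assoc)
  let ?g = "\<lambda>(m, a, k). (a, m - 1 - a, k :: nat) :: nat \<times> nat \<times> nat"
  have "inj_on ?g B"
  proof (rule inj_onI)
    fix s t assume "s \<in> B" "t \<in> B" "?g s = ?g t"
    then show "s = t" using B by (cases s; cases t) fastforce
  qed
  then have "((\<lambda>(a, b, k). r ^ (a + b + k)) \<circ> ?g) summable_on B"
    using summable_on_subset[OF s, of "?g ` B"] by (simp add: summable_on_reindex)
  then have 1: "(\<lambda>t. C * ((\<lambda>(a, b, k). r ^ (a + b + k)) \<circ> ?g) t) summable_on B"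
    by (rule summable_on_cmult_right)
  have 2: "norm (f t) \<le> C * ((\<lambda>(a, b, k). r ^ (a + b + k)) \<circ> ?g) t" if "t \<in> B" for t
    using f B that by (cases t) (fastforce simp: o_def)
  show ?thesis
    using Infinite_Sum.abs_summable_on_comparison_test'[OF 1 2] by (rule abs_summable_summable)
qed

lemma has_sum_triples_iterated:
  fixes f :: "nat \<Rightarrow> nat \<Rightarrow> nat \<Rightarrow> complex"
  assumes S: "((\<lambda>(m, a, k). f m a k) has_sum S) (SIGMA m:X. {..<m} \<times> UNIV)"
    and f: "\<And>m a. \<lbrakk>m \<in> X; a < m\<rbrakk> \<Longrightarrow> (f m a has_sum g m a) UNIV"
  shows "((\<lambda>m. \<Sum>a<m. g m a) has_sum S) X"
proof (rule has_sum_SigmaD[OF S])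
  fix m assume m: "m \<in> X"
  have "((\<lambda>(a, k). f m a k) has_sum (\<Sum>a<m. g m a)) ({..<m} \<times> UNIV)"
  proof (rule has_sum_SigmaI)
    have "(\<lambda>(m, t). case t of (a, k) \<Rightarrow> f m a k) summable_on (SIGMA m:X. {..<m} \<times> UNIV)"
      using S by (auto simp: summable_on_def)
    from summable_on_SigmaD1[OF this m]
    show "(\<lambda>(a, k). f m a k) summable_on {..<m} \<times> UNIV" .
  qed (use f m in \<open>auto intro: has_sum_finiteI\<close>)
  then show "((\<lambda>y. case (m, y) of (m, a, k) \<Rightarrow> f m a k) has_sum (\<Sum>a<m. g m a)) ({..<m} \<times> UNIV)"
    by simp
qed

lemma geometric_has_sum_scaled:
  fixes q :: complex
  assumes "norm q < 1" "0 < m"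
  shows "((\<lambda>k. q ^ (c + k * m)) has_sum q ^ c / (1 - q ^ m)) UNIV"
proof -
  have "norm (q ^ m) < 1" using assms by (simp add: norm_power power_less_one_iff)
  from has_sum_cmult_right[OF geometric_has_sum[OF this], of "q ^ c"]
  show ?thesis by (simp add: power_add mult.commute flip: power_mult)
qed

lemma norm_power_le:
  fixes q :: complex
  assumes "norm q < 1" "k \<le> e"
  shows "norm (q ^ e) \<le> norm q ^ k"
  using assms by (simp add: norm_power power_decreasing)

section \<open>The three class number series\<close>

lemma finite_T_triples: "odd n \<Longrightarrow> finite (T_triples n)"
  by (rule finite_subset[OF _ finite_H_triples]) (auto simp: T_triples_def)

lemma odd_triple_mod_4:
  fixes x y z :: nat
  assumes "odd x" "odd y" "odd z"
  shows "4 dvd x * y + y * z + z * x + 1"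
proof -
  have "4 dvd n + 1" if "n mod 8 = 3 \<or> n mod 8 = 7" for n :: nat
    using that by presburger
  moreover have "(x * y + y * z + z * x) mod 8 = 3 \<or> (x * y + y * z + z * x) mod 8 = 7"
    by (simp only: odd_triple_mod_8[OF assms] split: if_split) simp
  ultimately show ?thesis .
qed

text \<open>Put \<open>x = 2 a + 1\<close>, \<open>y = 2 b + 1\<close>, \<open>z = 2 k + 1\<close>
  and \<open>m = a + b + 1\<close>. Then
  \<open>x y + y z + z x + 1 = 4 ((a + 1) (b + 1) + k m)\<close>, and \<open>x\<close>,
  \<open>y\<close> agree modulo 4 exactly if \<open>m\<close> is odd. The sum over \<open>k\<close>
  is geometric.\<close>

lemma F_4n_minus_1_generating_function:
  fixes q :: complex
  assumes q: "norm q < 1"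
  obtains S where "((\<lambda>n. of_real (kronecker_F (4 * n - 1)) * q ^ n) has_sum S) {1..}"
    "((\<lambda>m. (\<Sum>a<m. q ^ ((a + 1) * (m - a))) / (1 - q ^ m)) has_sum S) {m. odd m}"
proof -
  define \<Omega> :: "(nat \<times> nat \<times> nat) set" where "\<Omega> = {(x, y, z). odd x \<and> odd y \<and> odd z \<and> x mod 4 = y mod 4}"
  define e :: "nat \<times> nat \<times> nat \<Rightarrow> nat" where "e = (\<lambda>(x, y, z). (x * y + y * z + z * x + 1) div 4)"
  define B :: "(nat \<times> nat \<times> nat) set" where "B = (SIGMA m:{m. odd m}. {..<m} \<times> UNIV)"
  define d where "d = (\<lambda>(m, a, k). (a + 1) * (m - a) + k * m :: nat)"
  define enc where "enc = (\<lambda>(x, y, z). ((x + y) div 2, (x - 1) div 2, (z - 1) div 2) :: nat \<times> nat \<times> nat)"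
  define dec where "dec = (\<lambda>(m, a, k). (2 * a + 1, 2 * (m - 1 - a) + 1, 2 * k + 1) :: nat \<times> nat \<times> nat)"
  have e4: "4 * e t = (case t of (x, y, z) \<Rightarrow> x * y + y * z + z * x + 1)" if "t \<in> \<Omega>" for t
  proof -
    obtain x y z where t: "t = (x, y, z)" by (cases t) auto
    have o: "odd x" "odd y" "odd z" using that by (auto simp: \<Omega>_def t)
    have "4 dvd x * y + y * z + z * x + 1" using odd_triple_mod_4[OF o] .
    then show ?thesis unfolding t e_def prod.case by (rule dvd_mult_div_cancel)
  qed
  have "(\<lambda>t. q ^ d t) summable_on B"
  proof (rule summable_on_triples[where r = "norm q" and C = 1])
    fix m a k assume "(m, a, k) \<in> B"
    then have am: "a < m" by (auto simp: B_def)
    then show "a < m" .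
    obtain b where b: "m = a + 1 + b" using am less_imp_Suc_add[OF am] by auto
    have "m - 1 + k \<le> d (m, a, k)" unfolding d_def prod.case b by (simp add: algebra_simps)
    then show "norm (q ^ d (m, a, k)) \<le> 1 * norm q ^ (m - 1 + k)"
      using norm_power_le[OF q] by simp
  qed (use q in auto)
  then obtain S where S: "((\<lambda>t. q ^ d t) has_sum S) B" by (auto simp: summable_on_def)
  have "((\<lambda>t. q ^ d t) has_sum S) B \<longleftrightarrow> ((\<lambda>t. of_real 1 * q ^ e t) has_sum S) \<Omega>"
  proof (rule has_sum_reindex_bij_witness[of _ enc dec])
    fix t assume "t \<in> B"
    then obtain a b k where t: "t = (a + 1 + b, a, k)" and o: "odd (a + 1 + b)"
      by (cases t) (auto simp: B_def dest!: less_imp_Suc_add)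
    have fr: "dec t = (2 * a + 1, 2 * b + 1, 2 * k + 1)" by (simp add: dec_def t)
    show "enc (dec t) = t" unfolding fr enc_def by (simp add: t)
    have "(2 * a + 1) mod 4 = (2 * b + 1) mod 4" using o by presburger
    then show \<Omega>: "dec t \<in> \<Omega>" by (simp add: fr \<Omega>_def)
    have "4 * e (dec t) = 4 * d t"
      unfolding e4[OF \<Omega>] unfolding fr unfolding t d_def by (simp add: algebra_simps)
    then show "of_real 1 * q ^ e (dec t) = q ^ d t" by simp
  next
    fix t assume "t \<in> \<Omega>"
    then obtain x y z where t: "t = (x, y, z)" and o: "odd x" "odd y" "odd z" "x mod 4 = y mod 4"
      by (cases t) (auto simp: \<Omega>_def)
    obtain a b k where abk: "x = 2 * a + 1" "y = 2 * b + 1" "z = 2 * k + 1"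
      using o by (auto elim!: oddE)
    have enc: "enc t = (a + b + 1, a, k)" by (simp add: enc_def t abk)
    show "dec (enc t) = t" unfolding enc dec_def by (simp add: t abk)
    have "odd (a + b + 1)" using o(4) unfolding abk by presburger
    then show "enc t \<in> B" by (simp add: enc B_def)
  qed simp
  with S have S': "((\<lambda>t. of_real 1 * q ^ e t) has_sum S) \<Omega>" by simp
  have "((\<lambda>n. of_real (kronecker_F (4 * n - 1)) * q ^ n) has_sum S) {1..}"
  proof (rule generating_function_has_sum[OF S'])
    show "1 \<le> e t" if "t \<in> \<Omega>" for t
      using e4[OF that] by (cases t) auto
    fix n :: nat assume n: "1 \<le> n"
    have "4 * e t = 4 * n \<longleftrightarrow> t \<in> T_triples (4 * n - 1)" if "t \<in> \<Omega>" for t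
      using n that unfolding e4[OF that] by (cases t) (auto simp: T_triples_def H_triples_def \<Omega>_def)
    then have fib: "{t \<in> \<Omega>. e t = n} = T_triples (4 * n - 1)"
      by (auto simp: T_triples_def H_triples_def \<Omega>_def)
    obtain n' where "n = n' + 1" using n by (metis le_add_diff_inverse2)
    then have "4 * n - 1 = 3 + 4 * n'" by simp
    then have o: "odd (4 * n - 1)" "(4 * n - 1) mod 4 = 3" by simp_all
    show "finite {t \<in> \<Omega>. e t = n}" using finite_T_triples[OF o(1)] fib by simp
    show "kronecker_F (4 * n - 1) = (\<Sum>t\<in>{t \<in> \<Omega>. e t = n}. 1)"
      using kronecker_F_3_mod_4[OF o(2)] fib by simp
  qed
  moreover have "((\<lambda>m. (\<Sum>a<m. q ^ ((a + 1) * (m - a))) / (1 - q ^ m)) has_sum S) {m. odd m}"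
  proof -
    have "((\<lambda>(m, a, k). q ^ d (m, a, k)) has_sum S) (SIGMA m:{m. odd m}. {..<m} \<times> UNIV)"
      using S by (simp add: B_def case_prod_unfold)
    then have "((\<lambda>m. \<Sum>a<m. q ^ ((a + 1) * (m - a)) / (1 - q ^ m)) has_sum S) {m. odd m}"
    proof (rule has_sum_triples_iterated)
      fix m a :: nat assume "m \<in> {m. odd m}"
      then have "0 < m" using odd_pos by simp
      from geometric_has_sum_scaled[OF q this, of "(a + 1) * (m - a)"]
      show "((\<lambda>k. q ^ d (m, a, k)) has_sum q ^ ((a + 1) * (m - a)) / (1 - q ^ m)) UNIV"
        by (simp only: d_def prod.case)
    qed
    then show ?thesis by (simp add: sum_divide_distrib)
  qed
  ultimately show thesis using that by blast
qed

text \<open>Now \<open>x\<close> and \<open>z\<close> disagree modulo 4, so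
  \<open>x + z = 4 m\<close>. If \<open>2 a + 1\<close> is the smaller and \<open>2 b + 1\<close>
  the larger of them and \<open>y = 2 k + 1\<close>, then \<open>a + b + 1 = 2 m\<close> and the
  exponent is \<open>a b / 2 + m + k m\<close>. Which of the two is \<open>x\<close> is dictated by
  the residue of \<open>y\<close> modulo 4, so that \<open>k\<close> runs freely.\<close>

lemma H_8n_minus_1_generating_function:
  fixes q :: complex
  assumes q: "norm q < 1"
  obtains S where "((\<lambda>n. of_real (hurwitz_H (8 * n - 1)) * q ^ n) has_sum S) {1..}"
    "((\<lambda>m. (\<Sum>a<m. q ^ (a * (2 * m - 1 - a) div 2 + m)) / (1 - q ^ m)) has_sum S) {1..}"
proof -
  define \<Omega> :: "(nat \<times> nat \<times> nat) set"
    where "\<Omega> = {(x, y, z). odd x \<and> odd y \<and> odd z \<and> x mod 4 = y mod 4 \<and> y mod 4 \<noteq> z mod 4}"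
  define e :: "nat \<times> nat \<times> nat \<Rightarrow> nat" where "e = (\<lambda>(x, y, z). (x * y + y * z + z * x + 1) div 8)"
  define B :: "(nat \<times> nat \<times> nat) set" where "B = (SIGMA m:{1..}. {..<m} \<times> UNIV)"
  define d where "d = (\<lambda>(m, a, k). a * (2 * m - 1 - a) div 2 + m + k * m :: nat)"
  define enc where "enc = (\<lambda>(x, y, z). ((x + z) div 4, (min x z - 1) div 2, (y - 1) div 2) :: nat \<times> nat \<times> nat)"
  define dec where "dec = (\<lambda>(m, a, k). let u = 2 * a + 1; v = 4 * m - u; y = 2 * k + 1 in
    if u mod 4 = y mod 4 then (u, y, v) else (v, y, u) :: nat \<times> nat \<times> nat)"
  have e8: "8 * e t = (case t of (x, y, z) \<Rightarrow> x * y + y * z + z * x + 1)" if "t \<in> \<Omega>" for t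
  proof -
    obtain x y z where t: "t = (x, y, z)" by (cases t) auto
    have o: "odd x" "odd y" "odd z" and c: "y mod 4 \<noteq> z mod 4" using that by (auto simp: \<Omega>_def t)
    have "(x * y + y * z + z * x) mod 8 = 7" using odd_triple_mod_8[OF o] c by simp
    moreover have "8 dvd n + 1" if "n mod 8 = 7" for n :: nat using that by presburger
    ultimately have "8 dvd x * y + y * z + z * x + 1" by blast
    then show ?thesis unfolding t e_def prod.case by (rule dvd_mult_div_cancel)
  qed
  have "(\<lambda>t. q ^ d t) summable_on B"
  proof (rule summable_on_triples[where r = "norm q" and C = 1])
    fix m a k assume h: "(m, a, k) \<in> B"
    then have am: "a < m" by (auto simp: B_def)
    then show "a < m" .
    have "k * 1 \<le> k * m" using am by (intro mult_le_mono) auto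
    then have "m - 1 + k \<le> d (m, a, k)" unfolding d_def prod.case by linarith
    then show "norm (q ^ d (m, a, k)) \<le> 1 * norm q ^ (m - 1 + k)"
      using norm_power_le[OF q] by simp
  qed (use q in auto)
  then obtain S where S: "((\<lambda>t. q ^ d t) has_sum S) B" by (auto simp: summable_on_def)
  have "((\<lambda>t. q ^ d t) has_sum S) B \<longleftrightarrow> ((\<lambda>t. of_real 1 * q ^ e t) has_sum S) \<Omega>"
  proof (rule has_sum_reindex_bij_witness[of _ enc dec])
    fix t assume "t \<in> B"
    then obtain m a k where t: "t = (m, a, k)" and am: "a < m" by (cases t) (auto simp: B_def)
    define b where "b = 2 * m - 1 - a"
    have b: "a < b" "a + b + 1 = 2 * m" using am by (auto simp: b_def)
    have "4 * m - (2 * a + 1) = 2 * b + 1" using b by simp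
    then have dt: "dec t = (if (2 * a + 1) mod 4 = (2 * k + 1) mod 4 then (2 * a + 1, 2 * k + 1, 2 * b + 1)
        else (2 * b + 1, 2 * k + 1, 2 * a + 1))"
      by (simp add: dec_def t Let_def)
    have "(2 * a + 1 + (2 * b + 1)) div 4 = m" "(2 * b + 1 + (2 * a + 1)) div 4 = m" using b by linarith+
    then show "enc (dec t) = t" unfolding dt enc_def using b by (simp add: t)
    have ab: "even (a + b + 1)" using b(2) by simp
    then have c: "(2 * a + 1) mod 4 \<noteq> (2 * b + 1) mod 4" by presburger
    have k: "(2 * b + 1) mod 4 = (2 * k + 1) mod 4" if "(2 * a + 1) mod 4 \<noteq> (2 * k + 1) mod 4"
      using that c odd_mod_4[of "2 * a + 1"] odd_mod_4[of "2 * b + 1"] odd_mod_4[of "2 * k + 1"]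
      by (metis even_plus_one_iff dvd_triv_left)
    show \<Omega>: "dec t \<in> \<Omega>" using c k by (auto simp: dt \<Omega>_def)
    have "even (a * b)" using ab by auto
    then have d: "2 * d t = a * b + (a + b + 1) * (k + 1)"
      unfolding t d_def prod.case b_def[symmetric] b(2) by (simp add: algebra_simps)
    have "8 * e (dec t) = 4 * (2 * d t)"
      unfolding e8[OF \<Omega>] unfolding d dt by (simp add: algebra_simps)
    then show "of_real 1 * q ^ e (dec t) = q ^ d t" by simp
  next
    fix t assume "t \<in> \<Omega>"
    then obtain x y z where t: "t = (x, y, z)"
      and o: "odd x" "odd y" "odd z" "x mod 4 = y mod 4" "y mod 4 \<noteq> z mod 4"
      by (cases t) (auto simp: \<Omega>_def)
    obtain a b k where abk: "x = 2 * a + 1" "z = 2 * b + 1" "y = 2 * k + 1"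
      using o by (auto elim!: oddE)
    have ab: "odd (a + b)"
    proof
      assume "even (a + b)"
      then have "(2 * a + 1) mod 4 = (2 * b + 1) mod 4" by presburger
      then show False using o(4,5) unfolding abk by simp
    qed
    then obtain m where m: "a + b + 1 = 2 * m" by (metis evenE even_plus_one_iff)
    have "a \<noteq> b" using ab by auto
    have "(2 * a + 1 + (2 * b + 1)) div 4 = m" using m by linarith
    then have enc: "enc t = (m, min a b, k)" by (auto simp: enc_def t abk min_def)
    have "4 * m - (2 * a + 1) = 2 * b + 1" "4 * m - (2 * b + 1) = 2 * a + 1" using m by linarith+
    then show "dec (enc t) = t"
      using o(4,5) \<open>a \<noteq> b\<close> unfolding enc dec_def by (auto simp: t abk min_def Let_def)
    show "enc t \<in> B" using m \<open>a \<noteq> b\<close> by (auto simp: enc B_def min_def)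
  qed simp
  with S have S': "((\<lambda>t. of_real 1 * q ^ e t) has_sum S) \<Omega>" by simp
  have "((\<lambda>n. of_real (hurwitz_H (8 * n - 1)) * q ^ n) has_sum S) {1..}"
  proof (rule generating_function_has_sum[OF S'])
    show "1 \<le> e t" if "t \<in> \<Omega>" for t
      using e8[OF that] by (cases t) auto
    fix n :: nat assume n: "1 \<le> n"
    obtain n' where "n = n' + 1" using n by (metis le_add_diff_inverse2)
    then have "8 * n - 1 = 7 + 8 * n'" by simp
    then have o: "odd (8 * n - 1)" "(8 * n - 1) mod 8 = 7" by simp_all
    have "8 * e t = 8 * n \<longleftrightarrow> t \<in> T_triples (8 * n - 1)" if "t \<in> \<Omega>" for t
      using n that unfolding e8[OF that] by (cases t) (auto simp: T_triples_def H_triples_def \<Omega>_def)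
    moreover have "t \<in> \<Omega>" if "t \<in> T_triples (8 * n - 1)" for t
    proof -
      obtain x y z where t: "t = (x, y, z)" by (cases t) auto
      have h: "(x, y, z) \<in> H_triples (8 * n - 1)" "x mod 4 = y mod 4"
        using that by (auto simp: T_triples_def t)
      have "y mod 4 \<noteq> z mod 4"
        using odd_triple_mod_8[OF H_triplesD(1-3)[OF h(1)]] h(2) o(2) unfolding H_triplesD(4)[OF h(1)]
        by (auto split: if_splits)
      then show ?thesis using h H_triplesD[OF h(1)] by (simp add: t \<Omega>_def)
    qed
    ultimately have fib: "{t \<in> \<Omega>. e t = n} = T_triples (8 * n - 1)" by auto
    show "finite {t \<in> \<Omega>. e t = n}" using finite_T_triples[OF o(1)] fib by simp
    show "hurwitz_H (8 * n - 1) = (\<Sum>t\<in>{t \<in> \<Omega>. e t = n}. 1)"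
      using hurwitz_H_8n_minus_1[OF o(2)] fib by simp
  qed
  moreover have "((\<lambda>m. (\<Sum>a<m. q ^ (a * (2 * m - 1 - a) div 2 + m)) / (1 - q ^ m)) has_sum S) {1..}"
  proof -
    have "((\<lambda>(m, a, k). q ^ d (m, a, k)) has_sum S) (SIGMA m:{1..}. {..<m} \<times> UNIV)"
      using S by (simp add: B_def case_prod_unfold)
    then have "((\<lambda>m. \<Sum>a<m. q ^ (a * (2 * m - 1 - a) div 2 + m) / (1 - q ^ m)) has_sum S) {1..}"
    proof (rule has_sum_triples_iterated)
      fix m a :: nat assume "m \<in> {1..}"
      then have "0 < m" by simp
      from geometric_has_sum_scaled[OF q this, of "a * (2 * m - 1 - a) div 2 + m"]
      show "((\<lambda>k. q ^ d (m, a, k)) has_sum q ^ (a * (2 * m - 1 - a) div 2 + m) / (1 - q ^ m)) UNIV"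
        by (simp only: d_def prod.case)
    qed
    then show ?thesis by (simp add: sum_divide_distrib)
  qed
  ultimately show thesis using that by blast
qed

text \<open>The summation variable is \<open>k = y\<close>, with \<open>m = x + z\<close> odd and
  \<open>a\<close> the even one of \<open>x\<close>, \<open>z\<close>; the parity of
  \<open>k\<close> tells which one it is. The exponent is \<open>a (m - a) + k m\<close>. As
  \<open>m\<close> is odd, \<open>a\<close> and \<open>m - a\<close> have opposite parities, so
  twice the sum over even \<open>a\<close> is a sum over all \<open>a\<close>.\<close>

lemma F_generating_function:
  fixes q :: complex
  assumes q: "norm q < 1"
  obtains S where "((\<lambda>n. of_real (2 * kronecker_F n) * q ^ n) has_sum S) {1..}"
    "((\<lambda>m. (1 + q ^ m) / (1 - q ^ m) * (1 + (\<Sum>a\<in>{1..<m}. q ^ (a * (m - a)))) - 1) has_sum 2 * S) {m. odd m}"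
proof -
  define e :: "nat \<times> nat \<times> nat \<Rightarrow> nat" where "e = (\<lambda>(x, y, z). x * y + y * z + z * x)"
  define \<Omega> :: "(nat \<times> nat \<times> nat) set"
    where "\<Omega> = {t. case t of (x, y, z) \<Rightarrow> even x = even y \<and> even x \<noteq> even z \<and> 1 \<le> e t}"
  define B :: "(nat \<times> nat \<times> nat) set" where "B = (SIGMA m:{m. odd m}. {..<m} \<times> UNIV)"
  define c :: "nat \<times> nat \<times> nat \<Rightarrow> real"
    where "c = (\<lambda>(x, y, z). if x = 0 \<or> y = 0 \<or> z = 0 then 1 else 2)"
  define w :: "nat \<times> nat \<times> nat \<Rightarrow> real"
    \<comment> \<open>The zeros allow the plain index set \<open>B\<close>: they drop odd
      \<open>a\<close> and the triples \<open>(0, 0, m)\<close> of exponent 0. The other values are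
      those of \<open>c\<close> after the change of variables.\<close>
    where "w = (\<lambda>(m, a, k). if odd a \<or> a = 0 \<and> k = 0 then 0 else if a = 0 \<or> k = 0 then 1 else 2)"
  define B' where "B' = {(m, a, k) \<in> B. even a \<and> \<not> (a = 0 \<and> k = 0)}"
  define d where "d = (\<lambda>(m, a, k). a * (m - a) + k * m :: nat)"
  define enc where "enc = (\<lambda>(x, y, z). (x + z, if even x then x else z, y) :: nat \<times> nat \<times> nat)"
  define dec where "dec = (\<lambda>(m, a, k). if even k then (a, k, m - a) else (m - a, k, a) :: nat \<times> nat \<times> nat)"
  have bound: "m - 1 + k \<le> d (m, a, k)" if h: "(m, a, k) \<in> B" "\<not> (a = 0 \<and> k = 0)" for m a k
  proof (cases "a = 0")
    case True
    then obtain k' m' where "k = Suc k'" "m = Suc m'" using h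
      by (cases k; cases m) (simp_all add: B_def)
    then show ?thesis using True by (simp add: d_def)
  next
    case False
    have "a < m" using h by (auto simp: B_def)
    then obtain a' b where "a = Suc a'" "m = Suc a' + 1 + b" using False less_imp_Suc_add[of a m] by (cases a) auto
    then show ?thesis by (simp add: d_def algebra_simps)
  qed
  have "(\<lambda>t. of_real (w t) * q ^ d t) summable_on B"
  proof (rule summable_on_triples[where r = "norm q" and C = 2])
    fix m a k assume h: "(m, a, k) \<in> B"
    then show "a < m" by (auto simp: B_def)
    show "norm (of_real (w (m, a, k)) * q ^ d (m, a, k)) \<le> 2 * norm q ^ (m - 1 + k)"
    proof (cases "a = 0 \<and> k = 0")
      case False
      have "\<bar>w (m, a, k)\<bar> \<le> 2" by (simp add: w_def)
      with norm_power_le[OF q bound[OF h False]] show ?thesis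
        unfolding norm_mult norm_of_real by (intro mult_mono) auto
    qed (simp add: w_def)
  qed (use q in auto)
  then obtain S where S: "((\<lambda>t. of_real (w t) * q ^ d t) has_sum S) B" by (auto simp: summable_on_def)
  have "((\<lambda>t. of_real (w t) * q ^ d t) has_sum S) B \<longleftrightarrow> ((\<lambda>t. of_real (w t) * q ^ d t) has_sum S) B'"
    by (rule has_sum_cong_neutral) (auto simp: w_def B'_def split: if_splits)
  also have "\<dots> \<longleftrightarrow> ((\<lambda>t. of_real (c t) * q ^ e t) has_sum S) \<Omega>"
  proof (rule has_sum_reindex_bij_witness[of _ enc dec])
    fix t assume "t \<in> B'"
    then obtain m a k where t: "t = (m, a, k)" and h: "odd m" "a < m" "even a" "\<not> (a = 0 \<and> k = 0)"
      by (cases t) (auto simp: B'_def B_def)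
    obtain z where z: "m = a + z" "0 < z" using h(2) by (metis less_imp_add_positive)
    have oz: "odd z" using h z by simp
    have dt: "dec t = (if even k then (a, k, z) else (z, k, a))" by (simp add: dec_def t z)
    show "enc (dec t) = t" unfolding dt enc_def using h oz by (simp add: t z)
    have e: "e (dec t) = d t" unfolding dt e_def d_def unfolding t by (simp add: z algebra_simps)
    have "(m, a, k) \<in> B" using h by (simp add: B_def)
    have "1 \<le> d t"
    proof (cases "a = 0")
      case True then show ?thesis using h(4) z by (simp add: d_def t Suc_le_eq)
    next
      case False then show ?thesis using z by (simp add: d_def t Suc_le_eq)
    qed
    then show "dec t \<in> \<Omega>" unfolding \<Omega>_def mem_Collect_eq e[symmetric] unfolding dt using h oz by simp
    have "c (dec t) = w t" unfolding dt c_def w_def unfolding t using h z by auto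
    then show "of_real (c (dec t)) * q ^ e (dec t) = of_real (w t) * q ^ d t" using e by simp
  next
    fix t assume "t \<in> \<Omega>"
    then obtain x y z where t: "t = (x, y, z)" and h: "even x = even y" "even x \<noteq> even z" "1 \<le> e (x, y, z)"
      by (cases t) (auto simp: \<Omega>_def)
    show "dec (enc t) = t" using h(1,2) by (auto simp: t enc_def dec_def)
    show "enc t \<in> B'"
    proof (cases "even x")
      case True
      then have "odd z" using h by simp
      then have "0 < z" by (rule odd_pos)
      then show ?thesis using h True by (auto simp: t enc_def B'_def B_def e_def)
    next
      case False
      then have "0 < x" by (rule odd_pos)
      then show ?thesis using h False by (auto simp: t enc_def B'_def B_def intro: Nat.gr0I)
    qed
  qed simp
  finally have S': "((\<lambda>t. of_real (c t) * q ^ e t) has_sum S) \<Omega>" using S by simp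
  have "((\<lambda>n. of_real (2 * kronecker_F n) * q ^ n) has_sum S) {1..}"
  proof (rule generating_function_has_sum[OF S'])
    show "1 \<le> e t" if "t \<in> \<Omega>" for t using that by (auto simp: \<Omega>_def)
    fix n :: nat assume n: "1 \<le> n"
    have fib: "{t \<in> \<Omega>. e t = n} = F_triples n"
      using n by (auto simp: F_triples_def \<Omega>_def e_def)
    have "F_triples n \<subseteq> {(x, y, z). x * y + y * z + z * x = n}" by (auto simp: F_triples_def)
    then show "finite {t \<in> \<Omega>. e t = n}" unfolding fib
      by (rule finite_subset[OF _ finite_triples]) (use n in simp)
    show "2 * kronecker_F n = (\<Sum>t\<in>{t \<in> \<Omega>. e t = n}. c t)"
      unfolding fib using n kronecker_F_eq_sum[of n]
      by (auto simp: sum_distrib_left c_def intro!: sum.cong)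
  qed
  moreover have "((\<lambda>m. (1 + q ^ m) / (1 - q ^ m) * (1 + (\<Sum>a\<in>{1..<m}. q ^ (a * (m - a)))) - 1) has_sum 2 * S) {m. odd m}"
  proof -
    define g where "g m a = (if odd a then 0 else if a = 0 then q ^ m / (1 - q ^ m)
      else q ^ (a * (m - a)) * ((1 + q ^ m) / (1 - q ^ m)))" for m a
    have "((\<lambda>(m, a, k). of_real (w (m, a, k)) * q ^ d (m, a, k)) has_sum S) (SIGMA m:{m. odd m}. {..<m} \<times> UNIV)"
      using S by (simp add: B_def case_prod_unfold)
    then have "((\<lambda>m. \<Sum>a<m. g m a) has_sum S) {m. odd m}"
    proof (rule has_sum_triples_iterated)
      fix m a :: nat assume "m \<in> {m. odd m}" "a < m"
      then have "norm (q ^ m) < 1" using q by (simp add: norm_power power_less_one_iff)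
      note geo = has_sum_geometric_from_1[OF this]
      have ne: "1 - q ^ m \<noteq> 0" using \<open>norm (q ^ m) < 1\<close> by auto
      have z: "(UNIV :: nat set) = insert 0 {1..}" by auto
      consider "odd a" | "a = 0" | "even a" "a \<noteq> 0" by blast
      then show "((\<lambda>k. of_real (w (m, a, k)) * q ^ d (m, a, k)) has_sum g m a) UNIV"
      proof cases
        case 1
        then show ?thesis by (simp add: w_def g_def)
      next
        case 2
        have "((\<lambda>k. of_real (w (m, a, k)) * q ^ d (m, a, k)) has_sum g m a) UNIV
            \<longleftrightarrow> ((\<lambda>k. (q ^ m) ^ k) has_sum g m a) {1..}"
          by (rule has_sum_cong_neutral)
            (auto simp: w_def d_def 2 mult.commute not_less_eq_eq simp flip: power_mult)
        then show ?thesis using geo by (simp add: g_def 2)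
      next
        case 3
        have "((\<lambda>k. 2 * q ^ (a * (m - a)) * (q ^ m) ^ k) has_sum 2 * q ^ (a * (m - a)) * (q ^ m / (1 - q ^ m))) {1..}"
          by (rule has_sum_cmult_right[OF geo])
        also have "?this \<longleftrightarrow> ((\<lambda>k. of_real (w (m, a, k)) * q ^ d (m, a, k)) has_sum
            2 * q ^ (a * (m - a)) * (q ^ m / (1 - q ^ m))) {1..}"
          by (rule has_sum_cong) (use 3 in \<open>auto simp: w_def d_def power_add mult.commute simp flip: power_mult\<close>)
        finally have "((\<lambda>k. of_real (w (m, a, k)) * q ^ d (m, a, k)) has_sum
            of_real (w (m, a, 0)) * q ^ d (m, a, 0) + 2 * q ^ (a * (m - a)) * (q ^ m / (1 - q ^ m))) (insert 0 {1..})"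
          by (rule has_sum_insert[rotated]) simp
        also have "of_real (w (m, a, 0)) * q ^ d (m, a, 0) + 2 * q ^ (a * (m - a)) * (q ^ m / (1 - q ^ m)) = g m a"
          using 3 ne by (simp add: w_def d_def g_def field_simps)
        finally show ?thesis unfolding z .
      qed
    qed
    then have "((\<lambda>m. 2 * (\<Sum>a<m. g m a)) has_sum 2 * S) {m. odd m}"
      by (rule has_sum_cmult_right)
    also have "?this \<longleftrightarrow> ?thesis"
    proof (rule has_sum_cong)
      fix m :: nat assume "m \<in> {m. odd m}"
      then have m: "odd m" "0 < m" using odd_pos by auto
      then have "norm (q ^ m) < 1" using q by (simp add: norm_power power_less_one_iff)
      then have ne: "1 - q ^ m \<noteq> 0" by auto
      define h where "h a = q ^ (a * (m - a))" for a
      define E where "E = (\<Sum>a\<in>{1..<m}. if even a then h a else 0)"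
      have "E = (\<Sum>a\<in>{1..<m}. if odd a then h a else 0)"
        unfolding E_def
        by (rule sum.reindex_bij_witness[of _ "\<lambda>a. m - a" "\<lambda>a. m - a"])
          (use m in \<open>auto simp: h_def mult.commute\<close>)
      then have "E + E = (\<Sum>a\<in>{1..<m}. (if even a then h a else 0) + (if odd a then h a else 0))"
        unfolding sum.distrib E_def by simp
      also have "\<dots> = sum h {1..<m}" by (rule sum.cong) auto
      finally have 2: "sum h {1..<m} = E + E" ..
      have "{..<m} = insert 0 {1..<m}" using m by auto
      then have "(\<Sum>a<m. g m a) = g m 0 + (\<Sum>a\<in>{1..<m}. g m a)" by simp
      also have "(\<Sum>a\<in>{1..<m}. g m a) = (1 + q ^ m) / (1 - q ^ m) * E"
        unfolding E_def sum_distrib_left by (rule sum.cong) (auto simp: g_def h_def)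
      finally have "2 * (\<Sum>a<m. g m a) = 2 * (q ^ m / (1 - q ^ m)) + (1 + q ^ m) / (1 - q ^ m) * (E + E)"
        by (simp add: g_def algebra_simps)
      also have "\<dots> = (1 + q ^ m) / (1 - q ^ m) * (1 + (E + E)) - 1"
      proof -
        have "(1 + q ^ m) / (1 - q ^ m) = 1 + 2 * (q ^ m / (1 - q ^ m))" using ne by (simp add: field_simps)
        then show ?thesis by (simp add: algebra_simps add_divide_distrib)
      qed
      finally show "2 * (\<Sum>a<m. g m a) = (1 + q ^ m) / (1 - q ^ m) * (1 + (\<Sum>a\<in>{1..<m}. q ^ (a * (m - a)))) - 1"
        using 2 by (simp add: h_def)
    qed
    finally show ?thesis .
  qed
  ultimately show thesis using that by blast
qed

section \<open>A Bailey pair for the rank series\<close>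

text \<open>The product \<open>(q^2; q^2)_n\<close>.\<close>

definition qfact :: "complex \<Rightarrow> nat \<Rightarrow> complex" where
  "qfact q n = (\<Prod>k<n. 1 - q ^ (2 * k + 2))"

text \<open>Bailey's kernel in base \<open>q^2\<close> relative to \<open>q^2\<close>, up to the
  constant \<open>1 - q^2\<close>, which is absorbed into the sequences \<open>unit_alpha\<close>
  and \<open>rank_alpha\<close>.\<close>

definition bailey_kernel :: "complex \<Rightarrow> nat \<Rightarrow> nat \<Rightarrow> complex" where
  "bailey_kernel q r n = (if r \<le> n then 1 / (qfact q (n - r) * qfact q (n + r + 1)) else 0)"

text \<open>The unit Bailey pair; its partner is the sequence 1, 0, 0, and so on
  (\<open>unit_pair\<close>).\<close>

definition unit_alpha :: "complex \<Rightarrow> nat \<Rightarrow> complex" where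
  "unit_alpha q r = (- 1) ^ r * q ^ (r * (r - 1)) * (1 - q ^ (4 * r + 2))"

text \<open>Its partner is the reciprocal of the denominator of the series at \<open>z = 1\<close>
  (\<open>rank_pair\<close>).\<close>

definition rank_alpha :: "complex \<Rightarrow> nat \<Rightarrow> complex" where
  "rank_alpha q r = (- 1) ^ r * q ^ (r * (r + 1)) * ((1 + q ^ (2 * r + 1)) / (1 - q ^ (2 * r + 1)))"

lemma qfact_0: "qfact q 0 = 1"
  by (simp add: qfact_def)

lemma qfact_Suc: "qfact q (Suc n) = qfact q n * (1 - q ^ (2 * n + 2))"
  by (simp add: qfact_def)

lemma one_minus_power_nonzero:
  fixes q :: complex
  assumes "norm q < 1" "0 < k"
  shows "1 - q ^ k \<noteq> 0"
proof
  assume "1 - q ^ k = 0"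
  then have "norm q ^ k = 1" by (metis eq_iff_diff_eq_0 norm_one norm_power)
  then show False using assms by (metis norm_ge_zero power_less_one_iff less_irrefl)
qed

lemma one_plus_power_nonzero:
  fixes q :: complex
  assumes "norm q < 1" "0 < k"
  shows "1 + q ^ k \<noteq> 0"
proof
  assume "1 + q ^ k = 0"
  then have "q ^ k = - 1" by (simp add: add_eq_0_iff)
  then have "norm q ^ k = 1" by (metis norm_minus_cancel norm_one norm_power)
  then show False using assms by (metis norm_ge_zero power_less_one_iff less_irrefl)
qed

lemma qfact_nonzero:
  assumes "norm q < 1"
  shows "qfact q n \<noteq> 0"
proof -
  have "1 - q ^ (2 * k + 2) \<noteq> 0" for k by (rule one_minus_power_nonzero[OF assms]) simp
  then show ?thesis by (simp add: qfact_def)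
qed

text \<open>The infinite product converges to a nonzero limit, so the reciprocals of its partial
  products converge and are bounded.\<close>

lemma inverse_qfact_bounded:
  assumes "norm q < 1"
  obtains c where "0 < c" "\<And>n. norm (1 / qfact q n) \<le> c"
proof -
  have s: "summable (\<lambda>k. norm ((1 - q ^ (2 * k + 2)) - 1))"
  proof (rule summable_comparison_test'[where g = "\<lambda>k. norm q ^ k" and N = 0])
    show "summable (\<lambda>k. norm q ^ k)" using assms by (simp add: summable_geometric)
    show "norm (norm ((1 - q ^ (2 * k + 2)) - 1)) \<le> norm q ^ k" for k
      using assms by (simp add: norm_power power_decreasing del: power_Suc)
  qed
  have "convergent_prod (\<lambda>k. 1 - q ^ (2 * k + 2))"
    using abs_convergent_prod_imp_convergent_prod summable_imp_abs_convergent_prod[OF s] by blast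
  moreover have "1 - q ^ (2 * k + 2) \<noteq> 0" for k by (rule one_minus_power_nonzero[OF assms]) simp
  ultimately obtain L where L: "(\<lambda>n. \<Prod>k\<le>n. 1 - q ^ (2 * k + 2)) \<longlonglongrightarrow> L" "L \<noteq> 0"
    using convergent_prod_iff_nz_lim[of "\<lambda>k. 1 - q ^ (2 * k + 2)"] by blast
  have "(\<lambda>n. qfact q (Suc n)) \<longlonglongrightarrow> L"
    using L(1) by (simp add: qfact_def lessThan_Suc_atMost del: prod.lessThan_Suc)
  then have "(\<lambda>n. qfact q n) \<longlonglongrightarrow> L" by (rule LIMSEQ_imp_Suc)
  then have "(\<lambda>n. 1 / qfact q n) \<longlonglongrightarrow> 1 / L" using L(2) by (intro tendsto_divide) auto
  then have "Bseq (\<lambda>n. 1 / qfact q n)" by (intro convergent_imp_Bseq) (auto simp: convergent_def)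
  then show thesis using that by (auto simp: Bseq_def)
qed

text \<open>The sum is summable in closed form for every upper limit. At \<open>s = n - 1\<close>
  the closed form is the negative of the remaining term \<open>r = n\<close>, which is
  \<open>unit_pair\<close>.\<close>

lemma unit_pair_partial:
  assumes q: "norm q < 1" and "s < n"
  shows "(\<Sum>r\<le>s. unit_alpha q r * bailey_kernel q r n) =
    (- 1) ^ s * q ^ (s * (s + 1)) * (1 - q ^ (2 * s + 2)) /
      ((1 - q ^ (2 * n)) * qfact q (n - s - 1) * qfact q (n + s + 1))"
  using \<open>s < n\<close>
proof (induction s)
  case 0
  obtain k where n: "n = Suc k" using 0 by (cases n) auto
  have "qfact q n = qfact q k * (1 - q ^ (2 * n))" "n - 1 = k" using qfact_Suc[of q k] by (simp_all add: n)
  then show ?case by (simp add: unit_alpha_def bailey_kernel_def mult.commute mult.left_commute)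
next
  case (Suc s)
  obtain k where n: "n = s + 2 + k" using Suc.prems le_Suc_ex[of "s + 2" n] by auto
  \<comment> \<open>In these variables the step is \<open>(1 - x) (1 - x^2 y q^2) - (1 - x^2 q^2) (1
    - x y) = - x (1 - x q^2) (1 - y)\<close>.\<close>
  define x y where "x = q ^ (2 * s + 2)" and "y = q ^ (2 * k + 2)"
  have e: "q ^ (2 * n) = x * y" "q ^ (4 * s + 6) = x * x * q * q" "q ^ (2 * s + 4) = x * q * q"
    "q ^ (2 * (n + s + 1) + 2) = x * x * y * q * q"
  proof -
    have "2 * n = (2 * s + 2) + (2 * k + 2)" by (simp add: n)
    then show "q ^ (2 * n) = x * y" by (simp only: x_def y_def power_add power_one_right)
    have "4 * s + 6 = (2 * s + 2) + (2 * s + 2) + 1 + 1" by simp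
    then show "q ^ (4 * s + 6) = x * x * q * q" by (simp only: x_def power_add power_one_right)
    have "2 * s + 4 = (2 * s + 2) + 1 + 1" by simp
    then show "q ^ (2 * s + 4) = x * q * q" by (simp only: x_def power_add power_one_right)
    have "2 * (n + s + 1) + 2 = (2 * s + 2) + (2 * s + 2) + (2 * k + 2) + 1 + 1" by (simp add: n)
    then show "q ^ (2 * (n + s + 1) + 2) = x * x * y * q * q" by (simp only: x_def y_def power_add power_one_right)
  qed
  define d where "d = (- 1) ^ s * q ^ (s * (s + 1)) / ((1 - x * y) * qfact q (k + 1) * qfact q (n + s + 2))"
  have nz: "1 - x * y \<noteq> 0" "1 - x * x * y * q * q \<noteq> 0" "1 - y \<noteq> 0"
    using one_minus_power_nonzero[OF q, of "2 * n"] one_minus_power_nonzero[OF q, of "2 * (n + s + 1) + 2"]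
      one_minus_power_nonzero[OF q, of "2 * k + 2"] n unfolding e(1,4) y_def by auto
  have f1: "qfact q (n + s + 2) = qfact q (n + s + 1) * (1 - x * x * y * q * q)"
    using qfact_Suc[of q "n + s + 1"] unfolding e(4) by simp
  have f2: "qfact q (k + 1) = qfact q k * (1 - y)"
    using qfact_Suc[of q k] by (simp add: y_def)
  have nf: "qfact q j \<noteq> 0" for j using qfact_nonzero[OF q] .
  have IH: "(\<Sum>r\<le>s. unit_alpha q r * bailey_kernel q r n) =
    (- 1) ^ s * q ^ (s * (s + 1)) * (1 - q ^ (2 * s + 2)) /
      ((1 - q ^ (2 * n)) * qfact q (n - s - 1) * qfact q (n + s + 1))"
    by (rule Suc.IH) (use Suc.prems in simp)
  have ns: "n - s - 1 = k + 1" "n - Suc s - 1 = k" "n + Suc s + 1 = n + s + 2" "2 * Suc s + 2 = 2 * s + 4"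
    using n by simp_all
  have "(\<Sum>r\<le>Suc s. unit_alpha q r * bailey_kernel q r n) =
      (- 1) ^ s * q ^ (s * (s + 1)) * (1 - x) / ((1 - x * y) * qfact q (k + 1) * qfact q (n + s + 1))
      + unit_alpha q (Suc s) * bailey_kernel q (Suc s) n"
    unfolding sum.atMost_Suc IH e(1) ns x_def ..
  also have "(- 1) ^ s * q ^ (s * (s + 1)) * (1 - x) / ((1 - x * y) * qfact q (k + 1) * qfact q (n + s + 1))
      = d * ((1 - x) * (1 - x * x * y * q * q))"
    unfolding d_def f1 using nz nf by (simp add: divide_simps)
  also have "unit_alpha q (Suc s) * bailey_kernel q (Suc s) n = - d * ((1 - x * x * q * q) * (1 - x * y))"
  proof -
    have "unit_alpha q (Suc s) = - ((- 1) ^ s * q ^ (s * (s + 1)) * (1 - x * x * q * q))"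
    proof -
      have "4 * Suc s + 2 = 4 * s + 6" by simp
      then show ?thesis unfolding unit_alpha_def by (simp only: e(2)) (simp add: mult.commute)
    qed
    moreover have "bailey_kernel q (Suc s) n = 1 / (qfact q (k + 1) * qfact q (n + s + 2))"
      by (simp add: bailey_kernel_def n)
    ultimately show ?thesis unfolding d_def using nz nf by (simp add: divide_simps)
  qed
  also have "d * ((1 - x) * (1 - x * x * y * q * q)) + - d * ((1 - x * x * q * q) * (1 - x * y))
      = - d * x * (1 - x * q * q) * (1 - y)" by (simp add: algebra_simps)
  also have "\<dots> = (- 1) ^ Suc s * (q ^ (s * (s + 1)) * x) * (1 - x * q * q) / ((1 - x * y) * qfact q k * qfact q (n + s + 2))"
    unfolding d_def f2 using nz nf by (simp add: divide_simps)
  also have "q ^ (s * (s + 1)) * x = q ^ (Suc s * (Suc s + 1))"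
  proof -
    have "Suc s * (Suc s + 1) = s * (s + 1) + (2 * s + 2)" by simp
    then show ?thesis by (simp only: power_add x_def)
  qed
  finally show ?case unfolding ns e .
qed

lemma unit_pair:
  assumes q: "norm q < 1"
  shows "(\<Sum>r\<le>n. unit_alpha q r * bailey_kernel q r n) = (if n = 0 then 1 else 0)"
proof (cases n)
  case 0
  then show ?thesis using one_minus_power_nonzero[OF q, of 2]
    by (simp add: unit_alpha_def bailey_kernel_def qfact_def power2_eq_square)
next
  case (Suc s)
  have nz: "1 - q ^ (2 * n) \<noteq> 0" "1 - q ^ (4 * n + 2) \<noteq> 0"
    using one_minus_power_nonzero[OF q, of "2 * n"] one_minus_power_nonzero[OF q, of "4 * n + 2"] Suc
    by simp_all
  have nf: "qfact q j \<noteq> 0" for j using qfact_nonzero[OF q] .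
  have "(\<Sum>r\<le>n. unit_alpha q r * bailey_kernel q r n) =
      (- 1) ^ s * q ^ (s * (s + 1)) * (1 - q ^ (2 * n)) / ((1 - q ^ (2 * n)) * qfact q 0 * qfact q (2 * n))
      + unit_alpha q n * bailey_kernel q n n"
    using unit_pair_partial[OF q, of s n] by (simp add: Suc mult_2)
  also have "unit_alpha q n * bailey_kernel q n n = - ((- 1) ^ s * q ^ (s * (s + 1)) / qfact q (2 * n))"
  proof -
    have "qfact q (n + n + 1) = qfact q (2 * n) * (1 - q ^ (4 * n + 2))"
    proof -
      have "2 * (2 * n) + 2 = 4 * n + 2" "n + n + 1 = Suc (2 * n)" by simp_all
      then show ?thesis using qfact_Suc[of q "2 * n"] by (simp only:)
    qed
    then show ?thesis using nz nf
      by (simp add: unit_alpha_def bailey_kernel_def qfact_0 Suc mult.commute divide_simps)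
  qed
  finally show ?thesis using nz by (simp add: Suc qfact_0)
qed

text \<open>The two pairs are linked by \<open>rank_alpha q r * (1 - q ^ (2 * r + 1))\<^sup>2 =
  unit_alpha q r * q ^ (2 * r)\<close>. Multiplied by the square of the new factor, each summand for
  \<open>N = n + 1\<close> is therefore the summand for \<open>n\<close> plus
  \<open>q ^ (2 * N)\<close> times a summand of the unit pair, and the latter sum to 0 as
  \<open>N > 0\<close>.\<close>

lemma rank_pair:
  assumes q: "norm q < 1"
  shows "(\<Sum>r\<le>n. rank_alpha q r * bailey_kernel q r n) = 1 / (\<Prod>k\<le>n. 1 - q ^ (2 * k + 1))\<^sup>2"
proof (induction n)
  case 0
  have "1 - q \<noteq> 0" "1 + q \<noteq> 0"
    using one_minus_power_nonzero[OF q, of 1] one_plus_power_nonzero[OF q, of 1] by simp_all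
  moreover have "1 - q ^ 2 = (1 - q) * (1 + q)" by (simp add: power2_eq_square algebra_simps)
  ultimately show ?case
    by (simp add: rank_alpha_def bailey_kernel_def qfact_def divide_simps power2_eq_square)
next
  case (Suc n)
  define N where "N = Suc n"
  have nf: "qfact q j \<noteq> 0" for j using qfact_nonzero[OF q] .
  have step: "(1 - q ^ (2 * N + 1))\<^sup>2 * (rank_alpha q r * bailey_kernel q r N) =
      rank_alpha q r * bailey_kernel q r n + q ^ (2 * N) * (unit_alpha q r * bailey_kernel q r N)"
    if rN: "r \<le> N" for r
  proof -
    obtain j where j: "N = r + j" using le_Suc_ex[OF rN] by blast
    define x y where "x = q ^ (2 * r)" and "y = q ^ (2 * j)"
    have nz: "1 - q ^ (2 * r + 1) \<noteq> 0" by (rule one_minus_power_nonzero[OF q]) simp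
    have xe: "q ^ (2 * r + 1) = x * q" "q ^ (4 * r + 2) = x * x * q * q" "q ^ (2 * N + 1) = x * y * q"
      "q ^ (2 * N) = x * y"
    proof -
    show "q ^ (2 * r + 1) = x * q" by (simp only: x_def power_add power_one_right)
    have "4 * r + 2 = 2 * r + 2 * r + 1 + 1" by simp
    then show "q ^ (4 * r + 2) = x * x * q * q" by (simp only: x_def power_add power_one_right)
    have "2 * N + 1 = 2 * r + 2 * j + 1" by (simp add: j)
    then show "q ^ (2 * N + 1) = x * y * q" by (simp only: x_def y_def power_add power_one_right)
    have "2 * N = 2 * r + 2 * j" by (simp add: j)
    then show "q ^ (2 * N) = x * y" by (simp only: x_def y_def power_add power_one_right)
    qed
    have alpha: "rank_alpha q r * (1 - x * q)\<^sup>2 = unit_alpha q r * x"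
    proof -
      have "r * (r + 1) = r * (r - 1) + 2 * r" by (cases r) auto
      then have "q ^ (r * (r + 1)) = q ^ (r * (r - 1)) * x" by (simp only: power_add x_def)
      moreover have "(1 + x * q) / (1 - x * q) * (1 - x * q)\<^sup>2 = 1 - x * x * q * q"
        using nz unfolding xe by (simp add: power2_eq_square) (simp add: algebra_simps)
      ultimately show ?thesis unfolding rank_alpha_def unit_alpha_def xe
        by (simp only: mult.assoc mult.commute mult.left_commute)
    qed
    have kernel: "bailey_kernel q r n = (1 - y) * (1 - x * x * y * q * q) * bailey_kernel q r N"
    proof (cases j)
      case 0
      then have "\<not> r \<le> n" using j by (simp add: N_def)
      then show ?thesis by (simp add: y_def bailey_kernel_def 0)
    next
      case (Suc i)
      have n: "n = r + i" using j Suc by (simp add: N_def)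
      have "qfact q (N - r) = qfact q (n - r) * (1 - y)"
        using qfact_Suc[of q i] by (simp add: j n Suc y_def)
      moreover have "qfact q (N + r + 1) = qfact q (n + r + 1) * (1 - x * x * y * q * q)"
      proof -
        have "q ^ (2 * (n + r + 1) + 2) = x * x * y * q * q"
        proof -
          have "2 * (n + r + 1) + 2 = 2 * r + 2 * r + 2 * j + 1 + 1" by (simp add: n Suc)
          then show ?thesis by (simp only: x_def y_def power_add power_one_right)
        qed
        then show ?thesis using qfact_Suc[of q "n + r + 1"] by (simp add: N_def)
      qed
      ultimately show ?thesis using nf[of "N - r"] nf[of "N + r + 1"] j n by (simp add: bailey_kernel_def)
    qed
    \<comment> \<open>This is
      \<open>(1 - x y q)^2 = (1 - y) (1 - x^2 y q^2) + y (1 - x q)^2\<close>.\<close>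
    have "(1 - x * y * q)\<^sup>2 * (rank_alpha q r * bailey_kernel q r N) =
        rank_alpha q r * ((1 - y) * (1 - x * x * y * q * q) * bailey_kernel q r N)
        + y * (rank_alpha q r * (1 - x * q)\<^sup>2) * bailey_kernel q r N"
      by (simp add: power2_eq_square algebra_simps)
    then show ?thesis unfolding xe kernel alpha by (simp add: algebra_simps)
  qed
  have nz: "(1 - q ^ (2 * N + 1))\<^sup>2 \<noteq> 0" using one_minus_power_nonzero[OF q, of "2 * N + 1"] by simp
  have "(1 - q ^ (2 * N + 1))\<^sup>2 * (\<Sum>r\<le>N. rank_alpha q r * bailey_kernel q r N) =
      (\<Sum>r\<le>N. rank_alpha q r * bailey_kernel q r n) + q ^ (2 * N) * (\<Sum>r\<le>N. unit_alpha q r * bailey_kernel q r N)"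
    unfolding sum_distrib_left sum.distrib[symmetric] by (rule sum.cong) (use step in auto)
  also have "(\<Sum>r\<le>N. rank_alpha q r * bailey_kernel q r n) = (\<Sum>r\<le>n. rank_alpha q r * bailey_kernel q r n)"
    by (simp add: N_def bailey_kernel_def)
  also have "(\<Sum>r\<le>N. unit_alpha q r * bailey_kernel q r N) = 0"
    using unit_pair[OF q, of N] by (simp add: N_def)
  finally have "(1 - q ^ (2 * N + 1))\<^sup>2 * (\<Sum>r\<le>N. rank_alpha q r * bailey_kernel q r N) =
      1 / (\<Prod>k\<le>n. 1 - q ^ (2 * k + 1))\<^sup>2" using Suc by simp
  moreover have "x = y / c" if "c \<noteq> 0" "c * x = y" for c x y :: complex
    using that by auto
  ultimately have "(\<Sum>r\<le>N. rank_alpha q r * bailey_kernel q r N) =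
      1 / (\<Prod>k\<le>n. 1 - q ^ (2 * k + 1))\<^sup>2 / (1 - q ^ (2 * N + 1))\<^sup>2"
    using nz by blast
  then show ?case by (simp add: N_def power_mult_distrib)
qed

section \<open>Expansion of the rank series in the Bailey kernel\<close>

definition rank_weight :: "complex \<Rightarrow> complex \<Rightarrow> nat \<Rightarrow> complex" where
  "rank_weight a q n = (\<Prod>k<n. a + q ^ (2 * k + 1)) * (\<Prod>k<n. - 1 + q ^ (2 * k + 1)) * q ^ (2 * n + 1)"

lemma rank_weight_Suc:
  "rank_weight a q (Suc n) = (a + q ^ (2 * n + 1)) * (- 1 + q ^ (2 * n + 1)) * q\<^sup>2 * rank_weight a q n"
  by (simp add: rank_weight_def power2_eq_square)

lemma No_term_eq:
  assumes "norm q < 1"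
  shows "No_term a (- 1) 1 q n = rank_weight a q n * (\<Sum>r\<le>n. rank_alpha q r * bailey_kernel q r n)"
proof -
  have "qpoch q (q\<^sup>2) (n + 1) = (\<Prod>k\<le>n. 1 - q ^ (2 * k + 1))"
    unfolding qpoch_def lessThan_Suc_atMost[symmetric] Suc_eq_plus1[symmetric]
    by (rule prod.cong) (auto simp: power_mult)
  then show ?thesis
    unfolding rank_pair[OF assms] No_term_def rank_weight_def by (simp add: power2_eq_square)
qed

text \<open>The ratio of consecutive terms tends to \<open>- a q^2\<close>; the resulting condition
  covers \<open>a = 1 / q\<close>.\<close>

lemma summable_rank_weight:
  assumes q: "norm q < 1" and a: "norm (a * q\<^sup>2) < 1"
  shows "summable (\<lambda>n. norm (rank_weight a q n))"
proof -
  obtain c where c: "norm (a * q\<^sup>2) < c" "c < 1" using a dense by blast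
  have "(\<lambda>n. q ^ n) \<longlonglongrightarrow> 0" using q by (rule LIMSEQ_power_zero)
  then have "((\<lambda>n. q ^ n) \<circ> (\<lambda>n. 2 * n + 1)) \<longlonglongrightarrow> 0"
    by (rule LIMSEQ_subseq_LIMSEQ) (auto simp: strict_mono_def)
  then have z: "(\<lambda>n. q ^ (2 * n + 1)) \<longlonglongrightarrow> 0" by (simp add: o_def)
  have "(\<lambda>n. norm ((a + q ^ (2 * n + 1)) * (- 1 + q ^ (2 * n + 1)) * q\<^sup>2)) \<longlonglongrightarrow> norm ((a + 0) * (- 1 + 0) * q\<^sup>2)"
    by (intro tendsto_intros z)
  then have "\<forall>\<^sub>F n in sequentially. norm ((a + q ^ (2 * n + 1)) * (- 1 + q ^ (2 * n + 1)) * q\<^sup>2) < c"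
    by (rule order_tendstoD) (use c(1) in \<open>simp add: norm_mult\<close>)
  then obtain N where N: "\<And>n. N \<le> n \<Longrightarrow> norm ((a + q ^ (2 * n + 1)) * (- 1 + q ^ (2 * n + 1)) * q\<^sup>2) < c"
    by (auto simp: eventually_sequentially)
  show ?thesis
  proof (rule summable_ratio_test[OF c(2)])
    fix n assume "N \<le> n"
    then have "norm ((a + q ^ (2 * n + 1)) * (- 1 + q ^ (2 * n + 1)) * q\<^sup>2) * norm (rank_weight a q n)
        \<le> c * norm (rank_weight a q n)" using N by (intro mult_right_mono) (auto intro: less_imp_le)
    then show "norm (norm (rank_weight a q (Suc n))) \<le> c * norm (norm (rank_weight a q n))"
      unfolding rank_weight_Suc by (simp add: norm_mult)
  qed
qed

lemma summable_norm_imp_summable_on: "summable (\<lambda>n. norm (f n)) \<Longrightarrow> (\<lambda>n. norm (f n)) summable_on UNIV"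
  for f :: "nat \<Rightarrow> complex"
  by (rule summable_nonneg_imp_summable_on) auto

lemma bailey_kernel_bounded:
  assumes "norm q < 1"
  obtains C where "0 < C" "\<And>r n. norm (bailey_kernel q r n) \<le> C"
proof -
  obtain c where c: "0 < c" "\<And>n. norm (1 / qfact q n) \<le> c"
    by (rule inverse_qfact_bounded[OF assms]) blast
  have "norm (bailey_kernel q r n) \<le> c * c" for r n
  proof (cases "r \<le> n")
    case True
    then have "norm (bailey_kernel q r n) = norm (1 / qfact q (n - r)) * norm (1 / qfact q (n + r + 1))"
      by (simp add: bailey_kernel_def norm_mult norm_divide)
    also have "\<dots> \<le> c * c" using c by (intro mult_mono) auto
    finally show ?thesis .
  qed (use c in \<open>simp add: bailey_kernel_def\<close>)
  then show thesis using c(1) that[of "c * c"] by simp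
qed

definition kernel_sum :: "complex \<Rightarrow> complex \<Rightarrow> nat \<Rightarrow> complex" where
  "kernel_sum a q r = (\<Sum>n. rank_weight a q n * bailey_kernel q r n)"

lemma summable_kernel_sum:
  assumes q: "norm q < 1" and a: "norm (a * q\<^sup>2) < 1"
  shows "summable (\<lambda>n. norm (rank_weight a q n * bailey_kernel q r n))"
proof -
  obtain C where C: "0 < C" "\<And>r n. norm (bailey_kernel q r n) \<le> C" by (rule bailey_kernel_bounded[OF q]) blast
  show ?thesis
  proof (rule summable_comparison_test')
    show "summable (\<lambda>n. norm (rank_weight a q n) * C)"
      using summable_rank_weight[OF q a] by (rule summable_mult2)
    show "norm (norm (rank_weight a q n * bailey_kernel q r n)) \<le> norm (rank_weight a q n) * C" for n
      using C(2) by (simp add: norm_mult mult_left_mono)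
  qed
qed

text \<open>This recurrence replaces the q-Gauss sum; it is the telescoping identity with certificate
  \<open>\<Gamma> n = - (1 - q\<^bsup>4r+4\<^esup>) (1 - q\<^bsup>2(n-r)\<^esup>) w\<^sub>n D\<^sub>r(n)\<close>.\<close>

lemma kernel_sum_recurrence:
  assumes q: "norm q < 1" and a: "norm (a * q\<^sup>2) < 1"
  shows "(1 - q ^ (2 * r + 3)) * (1 + a * q ^ (2 * r + 3)) * kernel_sum a q (Suc r) =
    - q\<^sup>2 * (1 - q ^ (2 * r + 1)) * (a + q ^ (2 * r + 1)) * kernel_sum a q r"
proof -
  define w where "w = rank_weight a q"
  define \<Gamma> where "\<Gamma> n = - (1 - q ^ (4 * r + 4)) * (1 - q ^ (2 * (n - r))) * (w n * bailey_kernel q r n)" for n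
  define \<alpha> where "\<alpha> = (1 - q ^ (2 * r + 3)) * (1 + a * q ^ (2 * r + 3))"
  define \<beta> where "\<beta> = q\<^sup>2 * (1 - q ^ (2 * r + 1)) * (a + q ^ (2 * r + 1))"
  have nf: "qfact q j \<noteq> 0" for j using qfact_nonzero[OF q] .
  have step: "\<alpha> * (w n * bailey_kernel q (Suc r) n) + \<beta> * (w n * bailey_kernel q r n) = \<Gamma> (Suc n) - \<Gamma> n" for n
  proof (cases "r \<le> n")
    case False
    show ?thesis
    proof (cases "Suc n = r")
      case True
      \<comment> \<open>Here the kernel at \<open>Suc n\<close> is nonzero, but the factor
        \<open>1 - q ^ (2 * (Suc n - r))\<close> of the certificate vanishes.\<close>
      then show ?thesis by (simp add: \<Gamma>_def bailey_kernel_def)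
    next
      case nr: False
      with False show ?thesis by (simp add: \<Gamma>_def bailey_kernel_def)
    qed
  next
    case True
    obtain j where n: "n = r + j" using le_Suc_ex[OF True] by blast
    define x y where "x = q ^ (2 * r)" and "y = q ^ (2 * j)"
    define K where "K = bailey_kernel q r n"
    have e: "q ^ (2 * r + 3) = x * q * q * q" "q ^ (2 * r + 1) = x * q" "q ^ (4 * r + 4) = x * x * q * q * q * q"
      "q ^ (2 * n + 1) = x * y * q" "q ^ (2 * (n - r)) = y" "q ^ (2 * (Suc n - r)) = y * q * q"
      "q ^ (2 * (n + r + 1) + 2) = x * x * y * q * q * q * q" "q ^ (2 * j + 2) = y * q * q"
    proof -
      have "2 * r + 3 = 2 * r + 1 + 1 + 1" by simp
      then show "q ^ (2 * r + 3) = x * q * q * q" by (simp only: x_def power_add power_one_right)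
      show "q ^ (2 * r + 1) = x * q" by (simp only: x_def power_add power_one_right)
      have "4 * r + 4 = 2 * r + 2 * r + 1 + 1 + 1 + 1" by simp
      then show "q ^ (4 * r + 4) = x * x * q * q * q * q" by (simp only: x_def power_add power_one_right)
      have "2 * n + 1 = 2 * r + 2 * j + 1" using n by simp
      then show "q ^ (2 * n + 1) = x * y * q" by (simp only: x_def y_def power_add power_one_right)
      show "q ^ (2 * (n - r)) = y" using n by (simp add: y_def)
      have "2 * (Suc n - r) = 2 * j + 1 + 1" using n by simp
      then show "q ^ (2 * (Suc n - r)) = y * q * q" by (simp only: y_def power_add power_one_right)
      have "2 * (n + r + 1) + 2 = 2 * r + 2 * r + 2 * j + 1 + 1 + 1 + 1" using n by simp
      then show "q ^ (2 * (n + r + 1) + 2) = x * x * y * q * q * q * q"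
        by (simp only: x_def y_def power_add power_one_right)
      have "2 * j + 2 = 2 * j + 1 + 1" by simp
      then show "q ^ (2 * j + 2) = y * q * q" by (simp only: y_def power_add power_one_right)
    qed
    define z where "z = 1 - x * x * y * q * q * q * q"
    have z: "z \<noteq> 0"
      using one_minus_power_nonzero[OF q, of "2 * (n + r + 1) + 2"] unfolding e(7) z_def by simp
    have y: "1 - y * q * q \<noteq> 0"
      using one_minus_power_nonzero[OF q, of "2 * j + 2"] unfolding e(8) by simp
    have F: "qfact q (n + r + 1 + 1) = qfact q (n + r + 1) * z"
      using qfact_Suc[of q "n + r + 1"] unfolding e(7) z_def by simp
    have G: "qfact q (j + 1) = qfact q j * (1 - y * q * q)"
      using qfact_Suc[of q j] unfolding e(8) by simp
    have k1: "bailey_kernel q (Suc r) n = (1 - y) / z * K"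
    proof (cases j)
      case 0
      then show ?thesis by (simp add: bailey_kernel_def n y_def)
    next
      case (Suc i)
      have "qfact q (n - r) = qfact q (n - Suc r) * (1 - y)"
        using qfact_Suc[of q i] by (simp add: n Suc y_def)
      then show ?thesis using F nf[of "n - r"] nf[of "n + r + 1 + 1"] z n Suc
        by (simp add: K_def bailey_kernel_def)
    qed
    have k2: "bailey_kernel q r (Suc n) = K / ((1 - y * q * q) * z)"
      using F G nf z y n by (simp add: K_def bailey_kernel_def Suc_diff_le)
    have w: "w (Suc n) = (a + x * y * q) * (- 1 + x * y * q) * (q * q) * w n"
      unfolding w_def rank_weight_Suc e power2_eq_square ..
    have "\<Gamma> (Suc n) - \<Gamma> n = - (1 - x * x * q * q * q * q) *
        ((a + x * y * q) * (- 1 + x * y * q) * (q * q) - (1 - y) * z) * (w n * K) / z"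
      unfolding \<Gamma>_def e k2 w K_def[symmetric] using z y by (simp add: divide_simps) (simp add: algebra_simps)
    \<comment> \<open>With the common factor \<open>w n * K / z\<close> split off, only a polynomial
      identity in \<open>x\<close>, \<open>y\<close>, \<open>a\<close>, \<open>q\<close> is
      left.\<close>
    also have "- (1 - x * x * q * q * q * q) * ((a + x * y * q) * (- 1 + x * y * q) * (q * q) - (1 - y) * z)
        = \<alpha> * (1 - y) + \<beta> * z"
      unfolding \<alpha>_def \<beta>_def e z_def by (simp add: power2_eq_square algebra_simps)
    also have "(\<alpha> * (1 - y) + \<beta> * z) * (w n * K) / z
        = \<alpha> * (w n * bailey_kernel q (Suc r) n) + \<beta> * (w n * bailey_kernel q r n)"
      unfolding k1 K_def[symmetric] using z by (simp add: divide_simps) (simp add: algebra_simps)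
    finally show ?thesis ..
  qed
  have wk: "(\<lambda>n. w n * bailey_kernel q r n) sums kernel_sum a q r" for r
    unfolding w_def kernel_sum_def
    using summable_norm_cancel[OF summable_kernel_sum[OF q a]] by (rule summable_sums)
  have lim: "\<Gamma> \<longlonglongrightarrow> 0"
  proof -
    have 0: "(\<lambda>n. w n * bailey_kernel q r n) \<longlonglongrightarrow> 0"
      using wk sums_summable summable_LIMSEQ_zero by blast
    have "norm (q ^ k) \<le> 1" for k using q by (simp add: norm_power power_le_one)
    then have b: "norm (1 - q ^ k) \<le> 2" for k using norm_triangle_ineq4[of 1 "q ^ k"] by (smt (verit) norm_one)
    have 1: "norm (\<Gamma> n) \<le> 2 * 2 * norm (w n * bailey_kernel q r n)" for n
    proof -
      have "norm (\<Gamma> n) = norm (1 - q ^ (4 * r + 4)) * norm (1 - q ^ (2 * (n - r))) * norm (w n * bailey_kernel q r n)"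
        unfolding \<Gamma>_def norm_mult norm_minus_cancel ..
      also have "\<dots> \<le> 2 * 2 * norm (w n * bailey_kernel q r n)"
        by (intro mult_mono b) auto
      finally show ?thesis .
    qed
    have 2: "(\<lambda>n. 2 * 2 * norm (w n * bailey_kernel q r n)) \<longlonglongrightarrow> 0"
      using tendsto_mult_right_zero[OF tendsto_norm_zero[OF 0]] by blast
    show ?thesis by (rule Lim_null_comparison[OF _ 2]) (use 1 in auto)
  qed
  \<comment> \<open>For \<open>r = 0\<close> the factor \<open>1 - q ^ 0\<close> vanishes, otherwise
    the kernel does; so both ends of the telescoping sum are 0.\<close>
  have "\<Gamma> 0 = 0" by (cases r) (simp_all add: \<Gamma>_def bailey_kernel_def)
  with telescope_sums[OF lim] have "(\<lambda>n. \<Gamma> (Suc n) - \<Gamma> n) sums 0" by simp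
  moreover have "(\<lambda>n. \<Gamma> (Suc n) - \<Gamma> n) sums (\<alpha> * kernel_sum a q (Suc r) + \<beta> * kernel_sum a q r)"
    unfolding step[symmetric] by (intro sums_add sums_mult wk)
  ultimately have "\<alpha> * kernel_sum a q (Suc r) + \<beta> * kernel_sum a q r = 0" by (rule sums_unique2[symmetric])
  then show ?thesis unfolding \<alpha>_def \<beta>_def by (simp add: add_eq_0_iff)
qed

lemma kernel_sum_has_sum:
  assumes "norm q < 1" "norm (a * q\<^sup>2) < 1"
  shows "((\<lambda>n. rank_weight a q n * bailey_kernel q r n) has_sum kernel_sum a q r) UNIV"
  unfolding kernel_sum_def
  using norm_summable_imp_has_sum[OF summable_kernel_sum[OF assms]
      summable_sums[OF summable_norm_cancel[OF summable_kernel_sum[OF assms]]]] .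

text \<open>As the kernel is bounded, the double series is dominated by a product of two convergent
  series.\<close>

lemma bailey_exchange:
  fixes x :: "nat \<Rightarrow> complex"
  assumes q: "norm q < 1" and a: "norm (a * q\<^sup>2) < 1" and x: "summable (\<lambda>r. norm (x r))"
  shows "(\<lambda>n. rank_weight a q n * (\<Sum>r\<le>n. x r * bailey_kernel q r n)) summable_on UNIV"
    and "(\<Sum>\<^sub>\<infinity>n. rank_weight a q n * (\<Sum>r\<le>n. x r * bailey_kernel q r n)) = (\<Sum>\<^sub>\<infinity>r. x r * kernel_sum a q r)"
proof -
  define f where "f n r = rank_weight a q n * (x r * bailey_kernel q r n)" for n r
  obtain C where C: "0 < C" "\<And>r n. norm (bailey_kernel q r n) \<le> C" by (rule bailey_kernel_bounded[OF q]) blast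
  have "(\<lambda>(n, r). norm (rank_weight a q n) * norm (x r)) summable_on UNIV \<times> UNIV"
    by (rule summable_on_prod) (use summable_norm_imp_summable_on summable_rank_weight[OF q a] x in auto)
  then have "(\<lambda>p. C * (case p of (n, r) \<Rightarrow> norm (rank_weight a q n) * norm (x r))) summable_on UNIV \<times> UNIV"
    by (rule summable_on_cmult_right)
  moreover have "norm (case p of (n, r) \<Rightarrow> f n r) \<le> C * (case p of (n, r) \<Rightarrow> norm (rank_weight a q n) * norm (x r))" for p
  proof -
    obtain n r where p: "p = (n, r)" by (cases p)
    have "norm (rank_weight a q n) * norm (x r) * norm (bailey_kernel q r n) \<le> norm (rank_weight a q n) * norm (x r) * C"
      using C(2) by (intro mult_left_mono) auto
    then show ?thesis by (simp add: p f_def norm_mult mult_ac)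
  qed
  ultimately have "(\<lambda>p. norm (case p of (n, r) \<Rightarrow> f n r)) summable_on UNIV \<times> UNIV"
    by (rule Infinite_Sum.abs_summable_on_comparison_test')
  then have s: "(\<lambda>(n, r). f n r) summable_on UNIV \<times> UNIV"
    by (rule abs_summable_summable)
  have row: "infsum (f n) UNIV = rank_weight a q n * (\<Sum>r\<le>n. x r * bailey_kernel q r n)" for n
  proof -
    have "infsum (f n) UNIV = infsum (f n) {..n}"
      by (rule infsum_cong_neutral) (auto simp: f_def bailey_kernel_def)
    then show ?thesis by (simp add: f_def sum_distrib_left)
  qed
  have col: "infsum (\<lambda>n. f n r) UNIV = x r * kernel_sum a q r" for r
    using infsumI[OF has_sum_cmult_right[OF kernel_sum_has_sum[OF q a], of "x r"]]
    by (simp add: f_def mult.left_commute)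
  show "(\<lambda>n. rank_weight a q n * (\<Sum>r\<le>n. x r * bailey_kernel q r n)) summable_on UNIV"
    using summable_on_Sigma_banach[OF s] by (simp add: row)
  show "(\<Sum>\<^sub>\<infinity>n. rank_weight a q n * (\<Sum>r\<le>n. x r * bailey_kernel q r n)) = (\<Sum>\<^sub>\<infinity>r. x r * kernel_sum a q r)"
    using infsum_swap_banach[OF s] by (simp add: row col)
qed

lemma summable_unit_alpha:
  assumes q: "norm q < 1"
  shows "summable (\<lambda>r. norm (unit_alpha q r))"
proof (rule summable_comparison_test')
  show "summable (\<lambda>r. 2 * norm q ^ (r - 1))"
    using q by (intro summable_mult) (subst summable_Suc_iff[symmetric], simp add: summable_geometric)
  fix r :: nat
  have "norm (q ^ k) \<le> 1" for k using q by (simp add: norm_power power_le_one)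
  then have "norm (1 - q ^ (4 * r + 2)) \<le> 2" using norm_triangle_ineq4[of 1 "q ^ (4 * r + 2)"] by (smt (verit) norm_one)
  moreover have "norm q ^ (r * (r - 1)) \<le> norm q ^ (r - 1)"
    using q by (intro power_decreasing) (cases r; auto)+
  ultimately have "norm (q ^ (r * (r - 1))) * norm (1 - q ^ (4 * r + 2)) \<le> norm q ^ (r - 1) * 2"
    unfolding norm_power by (intro mult_mono) auto
  then show "norm (norm (unit_alpha q r)) \<le> 2 * norm q ^ (r - 1)"
    by (simp add: unit_alpha_def norm_mult norm_power mult.commute)
qed

lemma norm_one_minus_power_ge:
  fixes q :: complex
  assumes "norm q < 1" "0 < k"
  shows "1 - norm q \<le> norm (1 - q ^ k)"
proof -
  have "norm (q ^ k) \<le> norm q"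
    using assms power_decreasing[of 1 k "norm q"] by (simp add: norm_power)
  then show ?thesis using norm_triangle_ineq2[of 1 "q ^ k"] by simp
qed

lemma summable_rank_alpha:
  assumes q: "norm q < 1"
  shows "summable (\<lambda>r. norm (rank_alpha q r))"
proof (rule summable_comparison_test')
  show "summable (\<lambda>r. 2 / (1 - norm q) * norm q ^ r)"
    using q by (intro summable_mult) (simp add: summable_geometric)
  fix r :: nat
  have "norm (q ^ (2 * r + 1)) \<le> 1" using q by (simp add: norm_power power_le_one del: power_Suc)
  then have "norm (1 + q ^ (2 * r + 1)) \<le> 2" using norm_triangle_ineq[of 1 "q ^ (2 * r + 1)"] by (smt (verit) norm_one)
  then have "norm ((1 + q ^ (2 * r + 1)) / (1 - q ^ (2 * r + 1))) \<le> 2 / (1 - norm q)"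
    unfolding norm_divide using norm_one_minus_power_ge[OF q, of "2 * r + 1"] q by (intro frac_le) auto
  moreover have "norm q ^ (r * (r + 1)) \<le> norm q ^ r"
    using q by (intro power_decreasing) auto
  ultimately have "norm (q ^ (r * (r + 1))) * norm ((1 + q ^ (2 * r + 1)) / (1 - q ^ (2 * r + 1)))
      \<le> norm q ^ r * (2 / (1 - norm q))"
    unfolding norm_power[of q] by (intro mult_mono) auto
  moreover have "norm (rank_alpha q r) = norm (q ^ (r * (r + 1))) * norm ((1 + q ^ (2 * r + 1)) / (1 - q ^ (2 * r + 1)))"
    unfolding rank_alpha_def norm_mult by (simp add: norm_power)
  ultimately have "norm (rank_alpha q r) \<le> norm q ^ r * (2 / (1 - norm q))" by (simp only:)
  then show "norm (norm (rank_alpha q r)) \<le> 2 / (1 - norm q) * norm q ^ r"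
    by (simp only: real_norm_def abs_norm_cancel mult.commute[of "2 / (1 - norm q)"])
qed

lemma No_term_summable:
  assumes "norm q < 1" "norm (a * q\<^sup>2) < 1"
  shows "No_term a (- 1) 1 q summable_on UNIV"
  using bailey_exchange(1)[OF assms summable_rank_alpha[OF assms(1)]] No_term_eq[OF assms(1)]
  by (simp cong: summable_on_cong)

text \<open>The sequence \<open>\<rho>\<close> is a guess for
  \<open>kernel_sum a q r / kernel_sum a q 0\<close>, verified through the recurrence. For the unit
  pair only the term \<open>n = 0\<close> survives; its value \<open>q\<close> is the factor on the
  right-hand side, and \<open>q \<noteq> 0\<close> gives the nonvanishing.\<close>

lemma No_times_theta:
  assumes q: "norm q < 1" "q \<noteq> 0" and a: "norm (a * q\<^sup>2) < 1"
    and nz: "\<And>r. 1 + a * q ^ (2 * r + 3) \<noteq> 0" and \<rho>0: "\<rho> 0 = 1"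
    and \<rho>: "\<And>r. (1 - q ^ (2 * r + 3)) * (1 + a * q ^ (2 * r + 3)) * \<rho> (Suc r) =
      - q\<^sup>2 * (1 - q ^ (2 * r + 1)) * (a + q ^ (2 * r + 1)) * \<rho> r"
  shows "(\<Sum>\<^sub>\<infinity>r. unit_alpha q r * \<rho> r) \<noteq> 0"
    and "No a (- 1) 1 q * (\<Sum>\<^sub>\<infinity>r. unit_alpha q r * \<rho> r) = q * (\<Sum>\<^sub>\<infinity>r. rank_alpha q r * \<rho> r)"
proof -
  define I where "I = kernel_sum a q"
  have I: "I r = \<rho> r * I 0" for r
  proof (induction r)
    case (Suc r)
    have ne: "(1 - q ^ (2 * r + 3)) * (1 + a * q ^ (2 * r + 3)) \<noteq> 0"
      using one_minus_power_nonzero[OF q(1), of "2 * r + 3"] nz by simp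
    have "(1 - q ^ (2 * r + 3)) * (1 + a * q ^ (2 * r + 3)) * I (Suc r) =
        (- q\<^sup>2 * (1 - q ^ (2 * r + 1)) * (a + q ^ (2 * r + 1)) * \<rho> r) * I 0"
      unfolding I_def kernel_sum_recurrence[OF q(1) a] using Suc by (simp add: I_def mult.assoc)
    also have "\<dots> = (1 - q ^ (2 * r + 3)) * (1 + a * q ^ (2 * r + 3)) * (\<rho> (Suc r) * I 0)"
      unfolding \<rho>[symmetric] by (simp only: mult.assoc)
    finally show ?case using ne by (simp only: mult_cancel_left) blast
  qed (simp add: \<rho>0)
  have pull: "(\<Sum>\<^sub>\<infinity>r. x r * kernel_sum a q r) = (\<Sum>\<^sub>\<infinity>r. x r * \<rho> r) * I 0" for x
    unfolding I_def[symmetric] by (subst I) (simp add: infsum_cmult_left' flip: mult.assoc)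
  have "(\<Sum>\<^sub>\<infinity>n. rank_weight a q n * (\<Sum>r\<le>n. unit_alpha q r * bailey_kernel q r n)) = q"
  proof -
    have "(\<Sum>\<^sub>\<infinity>n. rank_weight a q n * (\<Sum>r\<le>n. unit_alpha q r * bailey_kernel q r n))
        = (\<Sum>\<^sub>\<infinity>n\<in>{0}. rank_weight a q n * (\<Sum>r\<le>n. unit_alpha q r * bailey_kernel q r n))"
      unfolding unit_pair[OF q(1)] by (rule infsum_cong_neutral) auto
    then show ?thesis unfolding unit_pair[OF q(1)] by (simp add: rank_weight_def)
  qed
  then have U: "(\<Sum>\<^sub>\<infinity>r. unit_alpha q r * \<rho> r) * I 0 = q"
    unfolding bailey_exchange(2)[OF q(1) a summable_unit_alpha[OF q(1)]] pull .
  then show "(\<Sum>\<^sub>\<infinity>r. unit_alpha q r * \<rho> r) \<noteq> 0" using q(2) by auto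
  have "No a (- 1) 1 q = (\<Sum>\<^sub>\<infinity>r. rank_alpha q r * \<rho> r) * I 0"
    unfolding No_def No_term_eq[OF q(1)] bailey_exchange(2)[OF q(1) a summable_rank_alpha[OF q(1)]] pull ..
  then show "No a (- 1) 1 q * (\<Sum>\<^sub>\<infinity>r. unit_alpha q r * \<rho> r) = q * (\<Sum>\<^sub>\<infinity>r. rank_alpha q r * \<rho> r)"
    using U by (simp add: mult_ac)
qed

section \<open>The specializations \<open>a = 1\<close>, \<open>a = 0\<close> and
  \<open>a = 1 / q\<close>\<close>

lemma one_minus_power_double:
  "1 - q ^ (4 * r + 2) = (1 - q ^ (2 * r + 1)) * (1 + q ^ (2 * r + 1))" for q :: complex
proof -
  have "4 * r + 2 = (2 * r + 1) + (2 * r + 1)" by simp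
  then have "q ^ (4 * r + 2) = q ^ (2 * r + 1) * q ^ (2 * r + 1)" by (simp only: power_add)
  moreover have "1 - x * x = (1 - x) * (1 + x)" for x :: complex by (simp add: algebra_simps)
  ultimately show ?thesis by (simp only:)
qed

text \<open>For \<open>a = 1\<close> the factors in the recurrence combine to
  \<open>1 - q^(4r+6)\<close> and \<open>1 - q^(4r+2)\<close>, so \<open>\<rho>\<close> is a power
  of \<open>- q^2\<close> divided by \<open>1 - q^(4r+2)\<close>, up to a constant. This cancels the
  last factor of \<open>unit_alpha\<close> and leaves a pure theta series.\<close>

lemma No_1_times_theta:
  assumes q: "norm q < 1" "q \<noteq> 0"
  shows "(\<Sum>\<^sub>\<infinity>r. q ^ (r * (r + 1))) \<noteq> 0"
    and "No 1 (- 1) 1 q * (\<Sum>\<^sub>\<infinity>r. q ^ (r * (r + 1))) = q * (\<Sum>\<^sub>\<infinity>r. q ^ (r * (r + 3)) / (1 - q ^ (2 * r + 1))\<^sup>2)"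
proof -
  define \<rho> where "\<rho> r = (- (q\<^sup>2)) ^ r * ((1 - q\<^sup>2) / (1 - q ^ (4 * r + 2)))" for r
  have n2: "1 - q\<^sup>2 \<noteq> 0" by (rule one_minus_power_nonzero[OF q(1)]) simp
  have n4: "1 - q ^ (4 * r + 2) \<noteq> 0" for r by (rule one_minus_power_nonzero[OF q(1)]) simp
  have n1: "1 - q ^ (2 * r + 1) \<noteq> 0" for r by (rule one_minus_power_nonzero[OF q(1)]) simp
  note p = one_minus_power_double
  have e: "(- 1) ^ r * (- (q\<^sup>2)) ^ r = q ^ (2 * r)" for r
    by (simp flip: power_mult_distrib) (simp add: power_mult)
  have u: "unit_alpha q r * \<rho> r = (1 - q\<^sup>2) * q ^ (r * (r + 1))" for r
  proof -
    have "unit_alpha q r * \<rho> r = ((- 1) ^ r * (- (q\<^sup>2)) ^ r) * q ^ (r * (r - 1)) * (1 - q\<^sup>2)"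
      unfolding unit_alpha_def \<rho>_def using n4[of r] by (simp add: divide_simps)
    also have "\<dots> = q ^ (2 * r + r * (r - 1)) * (1 - q\<^sup>2)" unfolding e power_add ..
    also have "2 * r + r * (r - 1) = r * (r + 1)" by (cases r) auto
    finally show ?thesis by (simp add: mult.commute)
  qed
  have v: "rank_alpha q r * \<rho> r = (1 - q\<^sup>2) * (q ^ (r * (r + 3)) / (1 - q ^ (2 * r + 1))\<^sup>2)" for r
  proof -
    have "rank_alpha q r * \<rho> r = ((- 1) ^ r * (- (q\<^sup>2)) ^ r) * q ^ (r * (r + 1)) * (1 - q\<^sup>2) / (1 - q ^ (2 * r + 1))\<^sup>2"
      unfolding rank_alpha_def \<rho>_def p
      using n1[of r] n4[of r, unfolded p] by (simp add: divide_simps power2_eq_square)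
    also have "\<dots> = q ^ (2 * r + r * (r + 1)) * (1 - q\<^sup>2) / (1 - q ^ (2 * r + 1))\<^sup>2" unfolding e power_add ..
    also have "2 * r + r * (r + 1) = r * (r + 3)" by (simp add: algebra_simps)
    finally show ?thesis by (simp add: mult.commute)
  qed
  have rec: "(1 - q ^ (2 * r + 3)) * (1 + 1 * q ^ (2 * r + 3)) * \<rho> (Suc r) =
      - q\<^sup>2 * (1 - q ^ (2 * r + 1)) * (1 + q ^ (2 * r + 1)) * \<rho> r" for r
  proof -
    have "4 * Suc r + 2 = (2 * r + 3) + (2 * r + 3)" by simp
    then have "q ^ (4 * Suc r + 2) = q ^ (2 * r + 3) * q ^ (2 * r + 3)" by (simp only: power_add)
    then have "(1 - q ^ (2 * r + 3)) * (1 + 1 * q ^ (2 * r + 3)) = 1 - q ^ (4 * Suc r + 2)" by (simp add: algebra_simps)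
    then have "(1 - q ^ (2 * r + 3)) * (1 + 1 * q ^ (2 * r + 3)) * \<rho> (Suc r) = (- (q\<^sup>2)) ^ Suc r * (1 - q\<^sup>2)"
      using n4[of "Suc r"] by (simp add: \<rho>_def del: mult_Suc_right)
    also have "\<dots> = - q\<^sup>2 * (1 - q ^ (4 * r + 2)) * \<rho> r"
      using n4[of r] by (simp add: \<rho>_def)
    finally show ?thesis unfolding p by (simp only: mult.assoc)
  qed
  have a: "norm (1 * q\<^sup>2) < 1" using q by (simp add: norm_power power_less_one_iff)
  have nz: "1 + 1 * q ^ (2 * r + 3) \<noteq> 0" for r
    using one_plus_power_nonzero[OF q(1), of "2 * r + 3"] by simp
  have "\<rho> 0 = 1" using n2 by (simp add: \<rho>_def power2_eq_square)
  note main = No_times_theta[OF q a nz this rec]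
  show "(\<Sum>\<^sub>\<infinity>r. q ^ (r * (r + 1))) \<noteq> 0"
    using main(1) unfolding u infsum_cmult_right' by simp
  show "No 1 (- 1) 1 q * (\<Sum>\<^sub>\<infinity>r. q ^ (r * (r + 1))) = q * (\<Sum>\<^sub>\<infinity>r. q ^ (r * (r + 3)) / (1 - q ^ (2 * r + 1))\<^sup>2)"
    using main(2) n2 unfolding u v infsum_cmult_right' by (simp add: mult.left_commute)
qed

text \<open>For \<open>a = 0\<close> each step contributes \<open>- q^(2r+3)\<close>, whence the
  power \<open>q ^ (r * (r + 2))\<close>. The theta series runs over the triangular numbers, those
  of index \<open>2 r\<close> and \<open>2 r + 1\<close> taken together.\<close>

lemma No_0_times_theta:
  assumes q: "norm q < 1" "q \<noteq> 0"
  shows "(\<Sum>\<^sub>\<infinity>r. q ^ (r * (2 * r + 1)) * (1 + q ^ (2 * r + 1))) \<noteq> 0"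
    and "No 0 (- 1) 1 q * (\<Sum>\<^sub>\<infinity>r. q ^ (r * (2 * r + 1)) * (1 + q ^ (2 * r + 1))) =
      q * (\<Sum>\<^sub>\<infinity>r. q ^ (r * (2 * r + 3)) * (1 + q ^ (2 * r + 1)) / (1 - q ^ (2 * r + 1))\<^sup>2)"
proof -
  define \<rho> where "\<rho> r = (- 1) ^ r * q ^ (r * (r + 2)) * ((1 - q) / (1 - q ^ (2 * r + 1)))" for r
  have n0: "1 - q \<noteq> 0" using one_minus_power_nonzero[OF q(1), of 1] by simp
  have n1: "1 - q ^ (2 * r + 1) \<noteq> 0" for r by (rule one_minus_power_nonzero[OF q(1)]) simp
  note p = one_minus_power_double
  have e: "(- 1) ^ r * (- 1) ^ r = (1::complex)" for r
    by (simp flip: power_mult_distrib)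
  have u: "unit_alpha q r * \<rho> r = (1 - q) * (q ^ (r * (2 * r + 1)) * (1 + q ^ (2 * r + 1)))" for r
  proof -
    have "unit_alpha q r * \<rho> r = ((- 1) ^ r * (- 1) ^ r) * (q ^ (r * (r - 1)) * q ^ (r * (r + 2)))
        * (1 - q) * (1 + q ^ (2 * r + 1))"
      unfolding unit_alpha_def \<rho>_def p using n1[of r] by (simp add: divide_simps)
    also have "\<dots> = q ^ (r * (r - 1) + r * (r + 2)) * (1 - q) * (1 + q ^ (2 * r + 1))" unfolding e power_add by simp
    also have "r * (r - 1) + r * (r + 2) = r * (2 * r + 1)" by (cases r) (auto simp: algebra_simps)
    finally show ?thesis by (simp add: mult_ac)
  qed
  have v: "rank_alpha q r * \<rho> r = (1 - q) * (q ^ (r * (2 * r + 3)) * (1 + q ^ (2 * r + 1)) / (1 - q ^ (2 * r + 1))\<^sup>2)" for r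
  proof -
    have "rank_alpha q r * \<rho> r = ((- 1) ^ r * (- 1) ^ r) * (q ^ (r * (r + 1)) * q ^ (r * (r + 2)))
        * (1 - q) * (1 + q ^ (2 * r + 1)) / (1 - q ^ (2 * r + 1))\<^sup>2"
      unfolding rank_alpha_def \<rho>_def using n1[of r] by (simp add: divide_simps power2_eq_square)
    also have "\<dots> = q ^ (r * (r + 1) + r * (r + 2)) * (1 - q) * (1 + q ^ (2 * r + 1)) / (1 - q ^ (2 * r + 1))\<^sup>2"
      unfolding e power_add by simp
    also have "r * (r + 1) + r * (r + 2) = r * (2 * r + 3)" by (simp add: algebra_simps)
    finally show ?thesis by (simp add: mult_ac)
  qed
  have rec: "(1 - q ^ (2 * r + 3)) * (1 + 0 * q ^ (2 * r + 3)) * \<rho> (Suc r) =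
      - q\<^sup>2 * (1 - q ^ (2 * r + 1)) * (0 + q ^ (2 * r + 1)) * \<rho> r" for r
  proof -
    have s: "2 * Suc r + 1 = 2 * r + 3" "Suc r * (Suc r + 2) = r * (r + 2) + (2 * r + 1) + 1 + 1" by simp_all
    have "(1 - q ^ (2 * r + 3)) * (1 + 0 * q ^ (2 * r + 3)) * \<rho> (Suc r) = (- 1) ^ Suc r * q ^ (Suc r * (Suc r + 2)) * (1 - q)"
      using n1[of "Suc r"] unfolding \<rho>_def s(1) by simp
    also have "\<dots> = - q\<^sup>2 * (0 + q ^ (2 * r + 1)) * ((- 1) ^ r * q ^ (r * (r + 2)) * (1 - q))"
      unfolding s(2) power_add[of q _ 1] power_add[of q "r * (r + 2)" "2 * r + 1"] by (simp add: power2_eq_square mult_ac)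
    also have "\<dots> = - q\<^sup>2 * (1 - q ^ (2 * r + 1)) * (0 + q ^ (2 * r + 1)) * \<rho> r"
      using n1[of r] by (simp add: \<rho>_def)
    finally show ?thesis .
  qed
  have "\<rho> 0 = 1" using n0 by (simp add: \<rho>_def)
  note main = No_times_theta[OF q _ _ this rec, simplified]
  show "(\<Sum>\<^sub>\<infinity>r. q ^ (r * (2 * r + 1)) * (1 + q ^ (2 * r + 1))) \<noteq> 0"
    using main(1) unfolding u infsum_cmult_right' by simp
  show "No 0 (- 1) 1 q * (\<Sum>\<^sub>\<infinity>r. q ^ (r * (2 * r + 1)) * (1 + q ^ (2 * r + 1))) =
      q * (\<Sum>\<^sub>\<infinity>r. q ^ (r * (2 * r + 3)) * (1 + q ^ (2 * r + 1)) / (1 - q ^ (2 * r + 1))\<^sup>2)"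
    using main(2) n0 unfolding u v infsum_cmult_right' by (simp add: mult.left_commute)
qed

text \<open>For \<open>a = 1 / q\<close> both \<open>1 + a q^(2r+3)\<close> and
  \<open>q (a + q^(2r+1))\<close> equal \<open>1 + q^(2r+2)\<close> and cancel in the recurrence.
  The theta series is that of the squares of all integers, \<open>r\<close> and
  \<open>- 1 - r\<close> taken together.\<close>

lemma No_inverse_times_theta:
  assumes q: "norm q < 1" "q \<noteq> 0"
  shows "(\<Sum>\<^sub>\<infinity>r. q ^ (r * r) * (1 + q ^ (2 * r + 1))) \<noteq> 0"
    and "No (1 / q) (- 1) 1 q * (\<Sum>\<^sub>\<infinity>r. q ^ (r * r) * (1 + q ^ (2 * r + 1))) =
      q * (\<Sum>\<^sub>\<infinity>r. q ^ (r * (r + 2)) * (1 + q ^ (2 * r + 1)) / (1 - q ^ (2 * r + 1))\<^sup>2)"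
proof -
  define \<rho> where "\<rho> r = (- q) ^ r * ((1 - q) / (1 - q ^ (2 * r + 1)))" for r
  have n0: "1 - q \<noteq> 0" using one_minus_power_nonzero[OF q(1), of 1] by simp
  have n1: "1 - q ^ (2 * r + 1) \<noteq> 0" for r by (rule one_minus_power_nonzero[OF q(1)]) simp
  note p = one_minus_power_double
  have e: "(- 1) ^ r * (- q) ^ r = q ^ r" for r
    by (simp flip: power_mult_distrib)
  have u: "unit_alpha q r * \<rho> r = (1 - q) * (q ^ (r * r) * (1 + q ^ (2 * r + 1)))" for r
  proof -
    have "unit_alpha q r * \<rho> r = ((- 1) ^ r * (- q) ^ r) * q ^ (r * (r - 1)) * (1 - q) * (1 + q ^ (2 * r + 1))"
      unfolding unit_alpha_def \<rho>_def p using n1[of r] by (simp add: divide_simps)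
    also have "\<dots> = q ^ (r + r * (r - 1)) * (1 - q) * (1 + q ^ (2 * r + 1))" unfolding e power_add by simp
    also have "r + r * (r - 1) = r * r" by (cases r) auto
    finally show ?thesis by (simp add: mult_ac)
  qed
  have v: "rank_alpha q r * \<rho> r = (1 - q) * (q ^ (r * (r + 2)) * (1 + q ^ (2 * r + 1)) / (1 - q ^ (2 * r + 1))\<^sup>2)" for r
  proof -
    have "rank_alpha q r * \<rho> r = ((- 1) ^ r * (- q) ^ r) * q ^ (r * (r + 1))
        * (1 - q) * (1 + q ^ (2 * r + 1)) / (1 - q ^ (2 * r + 1))\<^sup>2"
      unfolding rank_alpha_def \<rho>_def using n1[of r] by (simp add: divide_simps power2_eq_square)
    also have "\<dots> = q ^ (r + r * (r + 1)) * (1 - q) * (1 + q ^ (2 * r + 1)) / (1 - q ^ (2 * r + 1))\<^sup>2"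
      unfolding e power_add by simp
    also have "r + r * (r + 1) = r * (r + 2)" by (simp add: algebra_simps)
    finally show ?thesis by (simp add: mult_ac)
  qed
  have s: "1 / q * q ^ (2 * r + 3) = q ^ (2 * r + 2)" "1 / q + q ^ (2 * r + 1) = (1 + q ^ (2 * r + 2)) / q" for r
    using q(2) by (simp_all add: field_simps power3_eq_cube power2_eq_square numeral_3_eq_3)
  have rec: "(1 - q ^ (2 * r + 3)) * (1 + 1 / q * q ^ (2 * r + 3)) * \<rho> (Suc r) =
      - q\<^sup>2 * (1 - q ^ (2 * r + 1)) * (1 / q + q ^ (2 * r + 1)) * \<rho> r" for r
  proof -
    have s1: "2 * Suc r + 1 = 2 * r + 3" by simp
    have "(1 - q ^ (2 * r + 3)) * (1 + 1 / q * q ^ (2 * r + 3)) * \<rho> (Suc r) = (1 + q ^ (2 * r + 2)) * ((- q) ^ Suc r * (1 - q))"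
      using n1[of "Suc r"] unfolding \<rho>_def s s1 by simp
    also have "\<dots> = - q\<^sup>2 * ((1 + q ^ (2 * r + 2)) / q) * ((- q) ^ r * (1 - q))"
      using q(2) by (simp add: power2_eq_square)
    also have "\<dots> = - q\<^sup>2 * (1 - q ^ (2 * r + 1)) * (1 / q + q ^ (2 * r + 1)) * \<rho> r"
      unfolding s using n1[of r] by (simp add: \<rho>_def)
    finally show ?thesis .
  qed
  have a: "norm (1 / q * q\<^sup>2) < 1" using q by (simp add: power2_eq_square)
  have nz: "1 + 1 / q * q ^ (2 * r + 3) \<noteq> 0" for r
    unfolding s by (rule one_plus_power_nonzero[OF q(1)]) simp
  have "\<rho> 0 = 1" using n0 by (simp add: \<rho>_def)
  note main = No_times_theta[OF q a nz this rec]
  show "(\<Sum>\<^sub>\<infinity>r. q ^ (r * r) * (1 + q ^ (2 * r + 1))) \<noteq> 0"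
    using main(1) unfolding u infsum_cmult_right' by simp
  show "No (1 / q) (- 1) 1 q * (\<Sum>\<^sub>\<infinity>r. q ^ (r * r) * (1 + q ^ (2 * r + 1))) =
      q * (\<Sum>\<^sub>\<infinity>r. q ^ (r * (r + 2)) * (1 + q ^ (2 * r + 1)) / (1 - q ^ (2 * r + 1))\<^sup>2)"
    using main(2) n0 unfolding u v infsum_cmult_right' by (simp add: mult.left_commute)
qed

section \<open>Multiplication of the class number series by theta functions\<close>

text \<open>This is \<open>coth (n t)\<close> for \<open>q = exp (- 2 t)\<close>; the next two
  lemmas are its addition theorem.\<close>

definition coth_q :: "complex \<Rightarrow> nat \<Rightarrow> complex" where
  "coth_q q n = (1 + q ^ n) / (1 - q ^ n)"

lemma coth_q_diff:
  assumes q: "norm q < 1" and "0 < n" "0 < f"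
  shows "(coth_q q n - coth_q q (n + f)) / (1 - q ^ f) = 2 * q ^ n / ((1 - q ^ n) * (1 - q ^ (n + f)))"
proof -
  have "1 - q ^ n \<noteq> 0" "1 - q ^ (n + f) \<noteq> 0" "1 - q ^ f \<noteq> 0"
    using one_minus_power_nonzero[OF q] assms by auto
  then show ?thesis unfolding coth_q_def power_add
    by (simp add: divide_simps) (simp add: algebra_simps)
qed

lemma coth_q_add:
  assumes q: "norm q < 1" and "0 < m" "0 < e"
  shows "(coth_q q m + coth_q q e) / (1 - q ^ (m + e)) = 2 / ((1 - q ^ m) * (1 - q ^ e))"
proof -
  have "1 - q ^ m \<noteq> 0" "1 - q ^ e \<noteq> 0" "1 - q ^ (m + e) \<noteq> 0"
    using one_minus_power_nonzero[OF q] assms by auto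
  then show ?thesis unfolding coth_q_def power_add
    by (simp add: divide_simps) (simp add: algebra_simps)
qed

lemma norm_inverse_one_minus_power_le:
  fixes q :: complex
  assumes "norm q < 1" "0 < n"
  shows "norm (1 / (1 - q ^ n)) \<le> 1 / (1 - norm q)"
  using norm_one_minus_power_ge[OF assms] assms(1) unfolding norm_divide by (intro frac_le) auto

text \<open>Since \<open>coth_q q n\<close> tends to 1, the limit is subtracted first to obtain
  absolutely convergent series; this is where \<open>of_nat f\<close> comes from.\<close>

lemma coth_q_telescope:
  assumes q: "norm q < 1"
  shows "((\<lambda>n. coth_q q n - coth_q q (n + f)) has_sum (\<Sum>n\<in>{1..f}. coth_q q n) - of_nat f) {1..}"
proof -
  define b where "b n = coth_q q n - 1" for n
  have b: "b n = 2 * q ^ n / (1 - q ^ n)" if "0 < n" for n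
    using one_minus_power_nonzero[OF q that] by (simp add: b_def coth_q_def field_simps)
  have "(\<lambda>n. norm (b n)) summable_on {1..}"
  proof (rule Infinite_Sum.abs_summable_on_comparison_test')
    have "(\<lambda>n. norm q ^ n) summable_on {1..}"
      using summable_on_power[of "norm q"] q by (auto intro: summable_on_subset)
    then show "(\<lambda>n. norm q ^ n * (2 * (1 / (1 - norm q)))) summable_on {1..}"
      by (rule summable_on_cmult_left)
    fix n :: nat assume "n \<in> {1..}"
    then have n: "0 < n" by simp
    have "norm (b n) = norm q ^ n * (2 * norm (1 / (1 - q ^ n)))"
      unfolding b[OF n] by (simp add: norm_mult norm_divide norm_power)
    also have "\<dots> \<le> norm q ^ n * (2 * (1 / (1 - norm q)))"
      using norm_inverse_one_minus_power_le[OF q n] by (intro mult_left_mono) auto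
    finally show "norm (b n) \<le> norm q ^ n * (2 * (1 / (1 - norm q)))" .
  qed
  then have "b summable_on {1..}" by (rule abs_summable_summable)
  then obtain T where T: "(b has_sum T) {1..}" by (auto simp: summable_on_def)
  have "b summable_on {f + 1..}" using \<open>b summable_on {1..}\<close> by (rule summable_on_subset) auto
  then obtain R where R: "(b has_sum R) {f + 1..}" by (auto simp: summable_on_def)
  have "(b has_sum (\<Sum>n\<in>{1..f}. b n) + R) ({1..f} \<union> {f + 1..})"
    by (rule has_sum_Un_disjoint[OF _ R]) auto
  moreover have "{1..f} \<union> {f + 1..} = {1..}" by auto
  ultimately have TR: "T = (\<Sum>n\<in>{1..f}. b n) + R" using T has_sum_unique by metis
  have "((\<lambda>n. b (n + f)) has_sum R) {1..}"
    by (rule iffD1[OF has_sum_reindex_bij_witness[of "{f + 1..}" "\<lambda>n. n + f" "\<lambda>n. n - f"] R]) auto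
  then have "((\<lambda>n. b n + - b (n + f)) has_sum (T + - R)) {1..}"
    using T by (intro has_sum_add) (auto simp: has_sum_uminus)
  moreover have "T + - R = (\<Sum>n\<in>{1..f}. coth_q q n) - of_nat f"
    unfolding TR by (simp add: b_def sum_subtractf)
  ultimately show ?thesis by (simp add: b_def)
qed

section \<open>The double sum over an odd and an even index\<close>

definition odds :: "nat set" where "odds = {m. odd m}"
definition evens :: "nat set" where "evens = {e. even e \<and> 0 < e}"

text \<open>By truncated subtraction \<open>m - e + (e - m)\<close> is the distance of
  \<open>m\<close> and \<open>e\<close>. For suitable \<open>w\<close> such a term, or half of it,
  is what two opposite theta indices contribute to the product with the \<open>m\<close>-th summand
  of a class number series.\<close>

definition pair_term :: "complex \<Rightarrow> (nat \<Rightarrow> complex) \<Rightarrow> nat \<Rightarrow> nat \<Rightarrow> complex" where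
  "pair_term q w m e =
     2 * (w (m - e + (e - m)) * q ^ min m e - w (m + e)) / ((1 - q ^ m) * (1 - q ^ e))"

text \<open>Let \<open>f\<close> be the distance and \<open>n\<close> the minimum of the two
  indices. Then \<open>f\<close> is odd and the parity of \<open>n\<close> tells which index is the
  smaller one, so \<open>(f, n)\<close> runs freely; for fixed \<open>f\<close> the sum over
  \<open>n\<close> telescopes by \<open>coth_q_diff\<close>.\<close>

lemma pair_sum_diff:
  assumes q: "norm q < 1" and w: "(\<lambda>g. norm (w g)) summable_on odds"
  obtains U where "((\<lambda>(m, e). 2 * w (m - e + (e - m)) * q ^ min m e / ((1 - q ^ m) * (1 - q ^ e))) has_sum U) (odds \<times> evens)"
    "((\<lambda>f. w f / (1 - q ^ f) * ((\<Sum>n\<in>{1..f}. coth_q q n) - of_nat f)) has_sum U) odds"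
proof -
  define h where "h = (\<lambda>(f, n). 2 * w f * q ^ n / ((1 - q ^ n) * (1 - q ^ (n + f))))"
  define c where "c = 2 * (1 / (1 - norm q) * (1 / (1 - norm q)))"
  have "(\<lambda>p. norm (h p)) summable_on odds \<times> {1..}"
  proof (rule Infinite_Sum.abs_summable_on_comparison_test')
    have "(\<lambda>n. norm q ^ n) summable_on {1..}"
      using summable_on_power[of "norm q"] q by (auto intro: summable_on_subset)
    with w have "(\<lambda>(f, n). norm (w f) * norm q ^ n) summable_on odds \<times> {1..}"
      by (rule summable_on_prod) auto
    then show "(\<lambda>p. (case p of (f, n) \<Rightarrow> norm (w f) * norm q ^ n) * c) summable_on odds \<times> {1..}"
      by (rule summable_on_cmult_left)
    fix p assume "p \<in> odds \<times> {1::nat..}"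
    then obtain f n where p: "p = (f, n)" and n: "0 < n" "0 < n + f" by (cases p) auto
    have "norm (h p) = norm (w f) * norm q ^ n * (2 * (norm (1 / (1 - q ^ n)) * norm (1 / (1 - q ^ (n + f)))))"
      by (simp add: p h_def norm_mult norm_divide norm_power)
    also have "\<dots> \<le> norm (w f) * norm q ^ n * c"
      unfolding c_def using norm_inverse_one_minus_power_le[OF q n(1)] norm_inverse_one_minus_power_le[OF q n(2)] q
      by (intro mult_left_mono mult_mono) auto
    finally show "norm (h p) \<le> (case p of (f, n) \<Rightarrow> norm (w f) * norm q ^ n) * c" by (simp add: p)
  qed
  then have "h summable_on odds \<times> {1..}" by (rule abs_summable_summable)
  then obtain U where U: "(h has_sum U) (odds \<times> {1..})" by (auto simp: summable_on_def)
  have "((\<lambda>(m, e). 2 * w (m - e + (e - m)) * q ^ min m e / ((1 - q ^ m) * (1 - q ^ e))) has_sum U) (odds \<times> evens)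
    \<longleftrightarrow> (h has_sum U) (odds \<times> {1..})"
  proof (rule has_sum_reindex_bij_witness[of _ "\<lambda>(f, n). if odd n then (n, n + f) else (n + f, n)"
        "\<lambda>(m, e). (m - e + (e - m), min m e)"])
    fix p assume "p \<in> odds \<times> evens"
    then obtain m e where p: "p = (m, e)" and me: "odd m" "even e" "0 < e" by (auto simp: odds_def evens_def)
    have "m \<noteq> e" "0 < m" using me odd_pos by auto
    then consider "m < e" | "e < m" by linarith
    then show "(case case p of (m, e) \<Rightarrow> (m - e + (e - m), min m e) of
        (f, n) \<Rightarrow> if odd n then (n, n + f) else (n + f, n)) = p"
      "(case p of (m, e) \<Rightarrow> (m - e + (e - m), min m e)) \<in> odds \<times> {1..}"
      "h (case p of (m, e) \<Rightarrow> (m - e + (e - m), min m e)) =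
        (case p of (m, e) \<Rightarrow> 2 * w (m - e + (e - m)) * q ^ min m e / ((1 - q ^ m) * (1 - q ^ e)))"
      using me \<open>0 < m\<close> by (cases; simp add: p odds_def h_def)+
  next
    fix p assume "p \<in> odds \<times> {1::nat..}"
    then obtain f n where p: "p = (f, n)" and "odd f" "0 < n" by (auto simp: odds_def)
    then have "0 < f" using odd_pos by blast
    show "(case case p of (f, n) \<Rightarrow> if odd n then (n, n + f) else (n + f, n) of
        (m, e) \<Rightarrow> (m - e + (e - m), min m e)) = p"
      by (simp add: p)
    show "(case p of (f, n) \<Rightarrow> if odd n then (n, n + f) else (n + f, n)) \<in> odds \<times> evens"
      using \<open>odd f\<close> \<open>0 < n\<close> by (simp add: p odds_def evens_def)
  qed simp
  with U have 1: "((\<lambda>(m, e). 2 * w (m - e + (e - m)) * q ^ min m e / ((1 - q ^ m) * (1 - q ^ e))) has_sum U) (odds \<times> evens)"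
    by simp
  have 2: "((\<lambda>f. w f / (1 - q ^ f) * ((\<Sum>n\<in>{1..f}. coth_q q n) - of_nat f)) has_sum U) odds"
  proof (rule has_sum_SigmaD[OF U])
    fix f assume "f \<in> odds"
    then have f: "0 < f" using odd_pos by (auto simp: odds_def)
    have "((\<lambda>n. w f / (1 - q ^ f) * (coth_q q n - coth_q q (n + f))) has_sum
        w f / (1 - q ^ f) * ((\<Sum>n\<in>{1..f}. coth_q q n) - of_nat f)) {1..}"
      by (rule has_sum_cmult_right[OF coth_q_telescope[OF q]])
    also have "?this \<longleftrightarrow> ((\<lambda>n. h (f, n)) has_sum
        w f / (1 - q ^ f) * ((\<Sum>n\<in>{1..f}. coth_q q n) - of_nat f)) {1..}"
    proof (rule has_sum_cong)
      fix n :: nat assume "n \<in> {1..}"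
      then have "0 < n" by simp
      have "w f / (1 - q ^ f) * (coth_q q n - coth_q q (n + f)) = w f * ((coth_q q n - coth_q q (n + f)) / (1 - q ^ f))"
        by simp
      also have "\<dots> = h (f, n)" unfolding coth_q_diff[OF q \<open>0 < n\<close> f] h_def by simp
      finally show "w f / (1 - q ^ f) * (coth_q q n - coth_q q (n + f)) = h (f, n)" .
    qed
    finally show "((\<lambda>n. h (f, n)) has_sum w f / (1 - q ^ f) * ((\<Sum>n\<in>{1..f}. coth_q q n) - of_nat f)) {1..}" .
  qed
  show thesis using that 1 2 by blast
qed

text \<open>For fixed odd \<open>g = m + e\<close> the sum is finite, and every \<open>n\<close>
  with \<open>0 < n < g\<close> occurs exactly once, as an even \<open>e\<close> or as an odd
  \<open>g - e\<close>. The factor \<open>real g\<close> in the hypothesis accounts for the number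
  of pairs.\<close>

lemma pair_sum_add:
  assumes q: "norm q < 1" and w: "(\<lambda>g. real g * norm (w g)) summable_on odds"
  obtains V where "((\<lambda>(m, e). 2 * w (m + e) / ((1 - q ^ m) * (1 - q ^ e))) has_sum V) (odds \<times> evens)"
    "((\<lambda>g. w g / (1 - q ^ g) * (\<Sum>n\<in>{1..<g}. coth_q q n)) has_sum V) odds"
proof -
  define E where "E g = {e. even e \<and> 0 < e \<and> e < (g::nat)}" for g
  define h where "h = (\<lambda>(g, e). 2 * w g / ((1 - q ^ (g - e)) * (1 - q ^ e)))"
  define c where "c = 2 * (1 / (1 - norm q) * (1 / (1 - norm q)))"
  have c0: "0 \<le> c" using q by (simp add: c_def)
  have finE: "finite (E g)" for g by (simp add: E_def)
  have cardE: "card (E g) \<le> g" for g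
    using card_mono[of "{..<g}" "E g"] by (auto simp: E_def)
  have "(\<lambda>p. norm (h p)) summable_on (SIGMA g:odds. E g)"
  proof (rule Infinite_Sum.abs_summable_on_comparison_test')
    show "(\<lambda>(g, e). norm (w g) * c) summable_on (SIGMA g:odds. E g)"
    proof (rule summable_on_SigmaI)
      show "((\<lambda>e. case (g, e) of (g, e) \<Rightarrow> norm (w g) * c) has_sum real (card (E g)) * (norm (w g) * c)) (E g)" for g
        using finE by (intro has_sum_finiteI) auto
      show "(\<lambda>g. real (card (E g)) * (norm (w g) * c)) summable_on odds"
      proof (rule summable_on_comparison_test)
        show "(\<lambda>g. real g * norm (w g) * c) summable_on odds" using w by (rule summable_on_cmult_left)
        show "real (card (E g)) * (norm (w g) * c) \<le> real g * norm (w g) * c" for g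
          unfolding mult.assoc using cardE c0 by (intro mult_right_mono) auto
      qed (use c0 in auto)
    qed (use c0 in auto)
    fix p assume "p \<in> (SIGMA g:odds. E g)"
    then obtain g e where p: "p = (g, e)" and ge: "0 < g - e" "0 < e" by (cases p) (auto simp: E_def)
    have "norm (h p) = norm (w g) * (2 * (norm (1 / (1 - q ^ (g - e))) * norm (1 / (1 - q ^ e))))"
      by (simp add: p h_def norm_mult norm_divide)
    also have "\<dots> \<le> norm (w g) * c"
      unfolding c_def using norm_inverse_one_minus_power_le[OF q ge(1)] norm_inverse_one_minus_power_le[OF q ge(2)] q
      by (intro mult_left_mono mult_mono) auto
    finally show "norm (h p) \<le> (case p of (g, e) \<Rightarrow> norm (w g) * c)" by (simp add: p)
  qed
  then have "h summable_on (SIGMA g:odds. E g)" by (rule abs_summable_summable)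
  then obtain V where V: "(h has_sum V) (SIGMA g:odds. E g)" by (auto simp: summable_on_def)
  have "((\<lambda>(m, e). 2 * w (m + e) / ((1 - q ^ m) * (1 - q ^ e))) has_sum V) (odds \<times> evens)
    \<longleftrightarrow> (h has_sum V) (SIGMA g:odds. E g)"
    by (rule has_sum_reindex_bij_witness[of _ "\<lambda>(g, e). (g - e, e)" "\<lambda>(m, e). (m + e, e)"])
      (auto simp: odds_def evens_def E_def h_def intro: odd_pos)
  with V have 1: "((\<lambda>(m, e). 2 * w (m + e) / ((1 - q ^ m) * (1 - q ^ e))) has_sum V) (odds \<times> evens)"
    by simp
  have 2: "((\<lambda>g. w g / (1 - q ^ g) * (\<Sum>n\<in>{1..<g}. coth_q q n)) has_sum V) odds"
  proof (rule has_sum_SigmaD[OF V])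
    fix g assume "g \<in> odds"
    then have g: "odd g" by (simp add: odds_def)
    have "(\<Sum>e\<in>E g. coth_q q (g - e)) = (\<Sum>n\<in>{n \<in> {1..<g}. odd n}. coth_q q n)"
      by (rule sum.reindex_bij_witness[of _ "\<lambda>n. g - n" "\<lambda>e. g - e"]) (use g in \<open>auto simp: E_def\<close>)
    moreover have "(\<Sum>e\<in>E g. coth_q q e) = (\<Sum>n\<in>{n \<in> {1..<g}. \<not> odd n}. coth_q q n)"
      by (rule sum.cong) (auto simp: E_def)
    moreover have "(\<Sum>n\<in>{1..<g}. coth_q q n) =
        (\<Sum>n\<in>{n \<in> {1..<g}. odd n}. coth_q q n) + (\<Sum>n\<in>{n \<in> {1..<g}. \<not> odd n}. coth_q q n)"
      by (subst sum.union_disjoint[symmetric]) (auto intro!: sum.cong)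
    ultimately have s: "(\<Sum>n\<in>{1..<g}. coth_q q n) = (\<Sum>e\<in>E g. coth_q q (g - e) + coth_q q e)"
      by (simp add: sum.distrib)
    have "h (g, e) = w g / (1 - q ^ g) * (coth_q q (g - e) + coth_q q e)" if "e \<in> E g" for e
    proof -
      have ge: "0 < g - e" "0 < e" "g - e + e = g" using that by (auto simp: E_def)
      have "w g * ((coth_q q (g - e) + coth_q q e) / (1 - q ^ (g - e + e))) = h (g, e)"
        unfolding coth_q_add[OF q ge(1,2)] h_def by simp
      then show ?thesis unfolding ge(3) by simp
    qed
    then have "(\<Sum>e\<in>E g. h (g, e)) = w g / (1 - q ^ g) * (\<Sum>n\<in>{1..<g}. coth_q q n)"
      unfolding s sum_distrib_left by (rule sum.cong[OF refl])
    then show "((\<lambda>e. h (g, e)) has_sum w g / (1 - q ^ g) * (\<Sum>n\<in>{1..<g}. coth_q q n)) (E g)"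
      using finE by (intro has_sum_finiteI) auto
  qed
  show thesis using that 1 2 by blast
qed

lemma has_sum_diff_complex:
  fixes f g :: "'a \<Rightarrow> complex"
  assumes "(f has_sum a) A" "(g has_sum b) A"
  shows "((\<lambda>x. f x - g x) has_sum a - b) A"
  using has_sum_add[OF assms(1), of "\<lambda>x. - g x" "- b"] assms(2) by (simp add: has_sum_uminus)

text \<open>The addition theorem for the hyperbolic cotangent makes the double sum telescope along
  \<open>\<bar>m - e\<bar> = f\<close> and collapse along \<open>m + e = g\<close>; the two results nearly cancel.\<close>

lemma pair_term_has_sum:
  assumes q: "norm q < 1" and w: "(\<lambda>g. real g * norm (w g)) summable_on odds"
  obtains S where "((\<lambda>(m, e). pair_term q w m e) has_sum S) (odds \<times> evens)"
    "((\<lambda>g. w g / (1 - q ^ g) * (coth_q q g - of_nat g)) has_sum S) odds"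
proof -
  have "(\<lambda>g. norm (w g)) summable_on odds"
  proof (rule summable_on_comparison_test[OF w])
    fix g assume "g \<in> odds"
    then have "1 \<le> real g" using odd_pos[of g] by (simp add: odds_def)
    then have "1 * norm (w g) \<le> real g * norm (w g)" by (intro mult_right_mono) auto
    then show "norm (w g) \<le> real g * norm (w g)" by simp
  qed auto
  from pair_sum_diff[OF q this] obtain U where
    U: "((\<lambda>(m, e). 2 * w (m - e + (e - m)) * q ^ min m e / ((1 - q ^ m) * (1 - q ^ e))) has_sum U) (odds \<times> evens)"
    "((\<lambda>f. w f / (1 - q ^ f) * ((\<Sum>n\<in>{1..f}. coth_q q n) - of_nat f)) has_sum U) odds" .
  from pair_sum_add[OF q w] obtain V where
    V: "((\<lambda>(m, e). 2 * w (m + e) / ((1 - q ^ m) * (1 - q ^ e))) has_sum V) (odds \<times> evens)"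
    "((\<lambda>g. w g / (1 - q ^ g) * (\<Sum>n\<in>{1..<g}. coth_q q n)) has_sum V) odds" .
  have "((\<lambda>(m, e). pair_term q w m e) has_sum U - V) (odds \<times> evens)"
  proof -
    have "pair_term q w m e = 2 * w (m - e + (e - m)) * q ^ min m e / ((1 - q ^ m) * (1 - q ^ e)) -
        2 * w (m + e) / ((1 - q ^ m) * (1 - q ^ e))" for m e
      unfolding pair_term_def diff_divide_distrib[symmetric] by (simp only: right_diff_distrib mult.assoc)
    then show ?thesis using has_sum_diff_complex[OF U(1) V(1)] by (simp add: case_prod_unfold)
  qed
  moreover have "((\<lambda>g. w g / (1 - q ^ g) * (coth_q q g - of_nat g)) has_sum U - V) odds"
  proof -
    have "((\<lambda>g. w g / (1 - q ^ g) * ((\<Sum>n\<in>{1..g}. coth_q q n) - of_nat g) -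
        w g / (1 - q ^ g) * (\<Sum>n\<in>{1..<g}. coth_q q n)) has_sum U - V) odds"
      by (rule has_sum_diff_complex[OF U(2) V(2)])
    also have "?this \<longleftrightarrow> ?thesis"
    proof (rule has_sum_cong)
      fix g assume "g \<in> odds"
      then have "0 < g" using odd_pos by (auto simp: odds_def)
      then have "{1..g} = insert g {1..<g}" by auto
      then have "(\<Sum>n\<in>{1..g}. coth_q q n) = coth_q q g + (\<Sum>n\<in>{1..<g}. coth_q q n)" by simp
      then show "w g / (1 - q ^ g) * ((\<Sum>n\<in>{1..g}. coth_q q n) - of_nat g) -
          w g / (1 - q ^ g) * (\<Sum>n\<in>{1..<g}. coth_q q n) = w g / (1 - q ^ g) * (coth_q q g - of_nat g)"
        by (simp only: right_diff_distrib[symmetric]) simp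
    qed
    finally show ?thesis .
  qed
  ultimately show thesis using that by blast
qed

section \<open>Two-sided theta series\<close>

lemma has_sum_finite_sum:
  fixes f :: "'i \<Rightarrow> 'a \<Rightarrow> complex"
  assumes "finite I" "\<And>i. i \<in> I \<Longrightarrow> (f i has_sum s i) A"
  shows "((\<lambda>x. \<Sum>i\<in>I. f i x) has_sum (\<Sum>i\<in>I. s i)) A"
  using assms by (induction I rule: finite_induct) (auto intro!: has_sum_add)

lemma has_sum_int_split:
  fixes f :: "int \<Rightarrow> complex"
  assumes f: "(f has_sum S) D" and D: "\<And>x. x \<in> D \<Longrightarrow> - x \<in> D"
  shows "((\<lambda>n. f (int n) + f (- int n)) has_sum (S - (if 0 \<in> D then f 0 else 0))) {n. 0 < n \<and> int n \<in> D}"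
proof -
  define P N where "P = {x \<in> D. 0 < x}" and "N = {x \<in> D. x < 0}"
  have "f summable_on P" "f summable_on N"
    using f summable_on_subset[of f D] by (auto simp: P_def N_def has_sum_imp_summable)
  then obtain p n where p: "(f has_sum p) P" and n: "(f has_sum n) N" by (auto simp: summable_on_def)
  have z: "(f has_sum (if 0 \<in> D then f 0 else 0)) (D \<inter> {0})"
    by (intro has_sum_finiteI) auto
  have "(f has_sum p + n) (P \<union> N)"
    by (rule has_sum_Un_disjoint[OF p n]) (auto simp: P_def N_def)
  from has_sum_Un_disjoint[OF this z]
  have "(f has_sum p + n + (if 0 \<in> D then f 0 else 0)) (P \<union> N \<union> (D \<inter> {0}))"
    by (auto simp: P_def N_def)
  moreover have "P \<union> N \<union> (D \<inter> {0}) = D" by (auto simp: P_def N_def)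
  ultimately have S: "S - (if 0 \<in> D then f 0 else 0) = p + n"
    using has_sum_unique[OF f] by fastforce
  have "((\<lambda>n. f (int n)) has_sum p) {n. 0 < n \<and> int n \<in> D}"
    by (rule iffD1[OF has_sum_reindex_bij_witness[of P int nat] p]) (auto simp: P_def)
  moreover have "((\<lambda>n. f (- int n)) has_sum n) {n. 0 < n \<and> int n \<in> D}"
    by (rule iffD1[OF has_sum_reindex_bij_witness[of N "\<lambda>n. - int n" "\<lambda>x. nat (- x)"] n])
      (auto simp: N_def dest: D)
  ultimately show ?thesis unfolding S by (rule has_sum_add)
qed

lemma has_sum_int_join:
  fixes f :: "int \<Rightarrow> complex"
  assumes "((\<lambda>r. f (int r)) has_sum a) UNIV" "((\<lambda>r. f (- 1 - int r)) has_sum b) UNIV"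
  shows "(f has_sum a + b) UNIV"
proof -
  have "(f has_sum a) {0..}"
    by (rule iffD1[OF has_sum_reindex_bij_witness[of UNIV nat int] assms(1)]) auto
  moreover have "(f has_sum b) {..<0}"
    by (rule iffD1[OF has_sum_reindex_bij_witness[of UNIV "\<lambda>x. nat (- 1 - x)" "\<lambda>r. - 1 - int r"] assms(2)]) auto
  ultimately have "(f has_sum a + b) ({0..} \<union> {..<0})" by (rule has_sum_Un_disjoint) auto
  moreover have "{0..} \<union> {..<0} = (UNIV :: int set)" by auto
  ultimately show ?thesis by simp
qed

lemma has_sum_int_shift:
  fixes f :: "int \<Rightarrow> complex"
  assumes "(f has_sum S) UNIV"
  shows "((\<lambda>c. f (k + c)) has_sum S) UNIV"
  by (rule iffD1[OF has_sum_reindex_bij_witness[of UNIV "\<lambda>c. k + c" "\<lambda>x. x - k"] assms]) auto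

lemma summable_on_q_power:
  fixes q :: complex
  assumes q: "norm q < 1" and e: "\<And>r. r \<le> e r"
  shows "(\<lambda>r :: nat. q ^ e r) summable_on UNIV"
proof -
  have "(\<lambda>r. norm (q ^ e r)) summable_on UNIV"
  proof (rule Infinite_Sum.abs_summable_on_comparison_test')
    show "(\<lambda>r :: nat. norm q ^ r) summable_on UNIV" using summable_on_power q by auto
    show "norm (q ^ e r) \<le> norm q ^ r" for r
      using q e by (simp add: norm_power power_decreasing)
  qed
  then show ?thesis by (rule abs_summable_summable)
qed

lemma power_int_eq_power: "0 \<le> k \<Longrightarrow> int n = k \<Longrightarrow> q powi k = q ^ n" for q :: complex
  by (metis power_int_of_nat)

lemma theta_pronic:
  fixes q :: complex
  assumes "norm q < 1"
  shows "((\<lambda>i. q powi (i * (i + 1))) has_sum 2 * (\<Sum>\<^sub>\<infinity>r. q ^ (r * (r + 1)))) UNIV"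
proof -
  have "(\<lambda>r. q ^ (r * (r + 1))) summable_on UNIV" by (rule summable_on_q_power[OF assms]) auto
  then have s: "((\<lambda>r. q ^ (r * (r + 1))) has_sum (\<Sum>\<^sub>\<infinity>r. q ^ (r * (r + 1)))) UNIV" by simp
  have "q powi (int r * (int r + 1)) = q ^ (r * (r + 1))" for r
    by (rule power_int_eq_power) (auto simp: algebra_simps)
  moreover have "q powi ((- 1 - int r) * (- 1 - int r + 1)) = q ^ (r * (r + 1))" for r
    by (rule power_int_eq_power) (auto simp: algebra_simps)
  ultimately have "((\<lambda>i. q powi (i * (i + 1))) has_sum
      (\<Sum>\<^sub>\<infinity>r. q ^ (r * (r + 1))) + (\<Sum>\<^sub>\<infinity>r. q ^ (r * (r + 1)))) UNIV"
    using s by (intro has_sum_int_join) simp_all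
  then show ?thesis by (simp only: mult_2)
qed

lemma theta_square:
  fixes q :: complex
  assumes "norm q < 1"
  shows "((\<lambda>i. q powi (i * i)) has_sum (\<Sum>\<^sub>\<infinity>r. q ^ (r * r) * (1 + q ^ (2 * r + 1)))) UNIV"
proof -
  have s1: "(\<lambda>r. q ^ (r * r)) summable_on UNIV" by (rule summable_on_q_power[OF assms]) auto
  have s2: "(\<lambda>r. q ^ (r * r + (2 * r + 1))) summable_on UNIV" by (rule summable_on_q_power[OF assms]) auto
  have "q powi (int r * int r) = q ^ (r * r)" for r
    by (rule power_int_eq_power) auto
  moreover have "q powi ((- 1 - int r) * (- 1 - int r)) = q ^ (r * r + (2 * r + 1))" for r
    by (rule power_int_eq_power) (auto simp: algebra_simps)
  ultimately have "((\<lambda>i. q powi (i * i)) has_sum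
      (\<Sum>\<^sub>\<infinity>r. q ^ (r * r)) + (\<Sum>\<^sub>\<infinity>r. q ^ (r * r + (2 * r + 1)))) UNIV"
    using s1 s2 by (intro has_sum_int_join) simp_all
  also have "(\<Sum>\<^sub>\<infinity>r. q ^ (r * r)) + (\<Sum>\<^sub>\<infinity>r. q ^ (r * r + (2 * r + 1))) = (\<Sum>\<^sub>\<infinity>r. q ^ (r * r) * (1 + q ^ (2 * r + 1)))"
    unfolding infsum_add[OF s1 s2, symmetric] by (simp only: power_add distrib_left mult_1_right)
  finally show ?thesis .
qed

text \<open>The reflection of \<open>x\<close> to \<open>- 1 - x\<close> preserves
  \<open>x (x + 1) / 2\<close> and changes the parity of \<open>x\<close>, so the sum over one
  residue class modulo 2 does not depend on \<open>p\<close>.\<close>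

lemma theta_triangular:
  fixes q :: complex
  assumes "norm q < 1"
  shows "((\<lambda>s. q powi ((p + 2 * s) * (p + 2 * s + 1) div 2)) has_sum
    (\<Sum>\<^sub>\<infinity>r. q ^ (r * (2 * r + 1)) * (1 + q ^ (2 * r + 1)))) UNIV"
proof -
  define \<theta> where "\<theta> = (\<Sum>\<^sub>\<infinity>r. q ^ (r * (2 * r + 1)) * (1 + q ^ (2 * r + 1)))"
  have s1: "(\<lambda>r. q ^ (r * (2 * r + 1))) summable_on UNIV" by (rule summable_on_q_power[OF assms]) auto
  have s2: "(\<lambda>r. q ^ (r * (2 * r + 1) + (2 * r + 1))) summable_on UNIV"
    by (rule summable_on_q_power[OF assms]) auto
  have "q powi (int r * (2 * int r + 1)) = q ^ (r * (2 * r + 1))" for r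
    by (rule power_int_eq_power) (auto simp: algebra_simps)
  moreover have "q powi ((- 1 - int r) * (2 * (- 1 - int r) + 1)) = q ^ (r * (2 * r + 1) + (2 * r + 1))" for r
    by (rule power_int_eq_power) (auto simp: algebra_simps intro: mult_nonpos_nonpos)
  ultimately have "((\<lambda>s. q powi (s * (2 * s + 1))) has_sum
      (\<Sum>\<^sub>\<infinity>r. q ^ (r * (2 * r + 1))) + (\<Sum>\<^sub>\<infinity>r. q ^ (r * (2 * r + 1) + (2 * r + 1)))) UNIV"
    using s1 s2 by (intro has_sum_int_join) simp_all
  also have "(\<Sum>\<^sub>\<infinity>r. q ^ (r * (2 * r + 1))) + (\<Sum>\<^sub>\<infinity>r. q ^ (r * (2 * r + 1) + (2 * r + 1))) = \<theta>"
    unfolding infsum_add[OF s1 s2, symmetric] \<theta>_def by (simp only: power_add distrib_left mult_1_right)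
  finally have even: "((\<lambda>s. q powi (s * (2 * s + 1))) has_sum \<theta>) UNIV" .
  have half: "(2 * x) * y div 2 = x * y" "y * (2 * x) div 2 = x * y" for x y :: int by simp_all
  show ?thesis
  proof (cases "even p")
    case True
    then obtain u where p: "p = 2 * u" by (rule evenE)
    have "(p + 2 * s) * (p + 2 * s + 1) div 2 = (u + s) * (2 * (u + s) + 1)" for s
      using half(1)[of "u + s" "2 * (u + s) + 1"] by (simp add: p algebra_simps)
    then show ?thesis using has_sum_int_shift[OF even, of u] by (simp add: \<theta>_def)
  next
    case False
    then obtain u where p: "p = 2 * u + 1" by (rule oddE)
    have odd: "((\<lambda>s. q powi ((2 * s + 1) * (s + 1))) has_sum \<theta>) UNIV"
      by (rule iffD1[OF has_sum_reindex_bij_witness[of UNIV "\<lambda>s. - 1 - s" "\<lambda>s. - 1 - s"] even])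
        (auto simp: algebra_simps)
    have "(p + 2 * s) * (p + 2 * s + 1) div 2 = (2 * (u + s) + 1) * (u + s + 1)" for s
      using half(2)[of "2 * (u + s) + 1" "u + s + 1"] by (simp add: p algebra_simps)
    then show ?thesis using has_sum_int_shift[OF odd, of u] by (simp add: \<theta>_def)
  qed
qed

lemma power_int_add_power:
  fixes q :: complex
  assumes "q \<noteq> 0" "k = j + int n"
  shows "q powi k = q powi j * q ^ n"
  using assms by (simp add: power_int_add)

section \<open>Rows of the double sum as theta multiples\<close>

lemma geometric_sum_reversed:
  fixes y :: complex
  assumes "y \<noteq> 1"
  shows "(\<Sum>a<m. y ^ a) = (1 - y ^ m) / (1 - y)" "(\<Sum>a<m. y ^ (m - Suc a)) = (1 - y ^ m) / (1 - y)"
proof -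
  show "(\<Sum>a<m. y ^ a) = (1 - y ^ m) / (1 - y)" using assms by (simp add: sum_gp_strict)
  then show "(\<Sum>a<m. y ^ (m - Suc a)) = (1 - y ^ m) / (1 - y)"
    using sum.nat_diff_reindex[of "\<lambda>a. y ^ a" m] by simp
qed

text \<open>For odd \<open>g\<close> the exponent is \<open>(g^2 - 1) / 4\<close>.\<close>

definition pronic_weight :: "complex \<Rightarrow> nat \<Rightarrow> complex" where
  "pronic_weight q g = q ^ ((g - 1) div 2 * ((g - 1) div 2 + 1))"

text \<open>Let \<open>L = (m - 1) / 2\<close>. With the theta index written as
  \<open>L - a + c\<close>, the product with \<open>q ^ (a * (m - a))\<close> has the exponent
  \<open>L (L + 1) + c^2 + c (m - 2 a)\<close>, linear in \<open>a\<close>, so for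
  \<open>c \<noteq> 0\<close> the sum over \<open>a\<close> is geometric. The terms for
  \<open>c\<close> and \<open>- c\<close> combine to the pair term with \<open>e = 2 c\<close>. At
  \<open>c = 0\<close> all \<open>m\<close> summands are equal, which gives the subtracted
  correction.\<close>

lemma pair_row_pronic:
  fixes q :: complex
  assumes q: "norm q < 1" "q \<noteq> 0" and "odd m"
  defines "w \<equiv> \<lambda>g. pronic_weight q g * (1 + q ^ g)"
  shows "((\<lambda>e. pair_term q w m e) has_sum
    2 * (\<Sum>\<^sub>\<infinity>r. q ^ (r * (r + 1))) * (coth_q q m * (\<Sum>a<m. q ^ (a * (m - a))) - 1)
      - (coth_q q m * of_nat m * pronic_weight q m - pronic_weight q m)) evens"
proof -
  obtain l where m: "m = 2 * l + 1" using \<open>odd m\<close> by (rule oddE)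
  define L where "L = int l"
  have mL: "int m = 2 * L + 1" by (simp add: m L_def)
  define \<theta> where "\<theta> = 2 * (\<Sum>\<^sub>\<infinity>r. q ^ (r * (r + 1)))"
  define F where "F c = coth_q q m * (\<Sum>a<m. q powi (L * (L + 1) + c * c + c * (int m - 2 * int a)))
    - q powi ((L + c) * (L + c + 1))" for c
  note \<theta> = theta_pronic[OF q(1), folded \<theta>_def]
  have "((\<lambda>c. q powi (L * (L + 1) + c * c + c * (int m - 2 * int a))) has_sum q ^ (a * (m - a)) * \<theta>) UNIV"
    if "a < m" for a
  proof -
    have "q ^ (a * (m - a)) * q powi ((L - int a + c) * (L - int a + c + 1)) =
        q powi (L * (L + 1) + c * c + c * (int m - 2 * int a))" for c
    proof -
      have "L * (L + 1) + c * c + c * (int m - 2 * int a) =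
          (L - int a + c) * (L - int a + c + 1) + int (a * (m - a))"
        using that by (simp add: mL of_nat_diff algebra_simps)
      from power_int_add_power[OF q(2) this] show ?thesis by (simp add: mult.commute)
    qed
    then show ?thesis
      using has_sum_cmult_right[OF has_sum_int_shift[OF \<theta>, of "L - int a"], of "q ^ (a * (m - a))"] by simp
  qed
  then have "((\<lambda>c. \<Sum>a<m. q powi (L * (L + 1) + c * c + c * (int m - 2 * int a))) has_sum (\<Sum>a<m. q ^ (a * (m - a)) * \<theta>)) UNIV"
    by (intro has_sum_finite_sum) auto
  from has_sum_diff_complex[OF has_sum_cmult_right[OF this, of "coth_q q m"] has_sum_int_shift[OF \<theta>, of L]]
  have "(F has_sum coth_q q m * (\<Sum>a<m. q ^ (a * (m - a)) * \<theta>) - \<theta>) UNIV"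
    unfolding F_def[abs_def] .
  also have "coth_q q m * (\<Sum>a<m. q ^ (a * (m - a)) * \<theta>) - \<theta> = \<theta> * (coth_q q m * (\<Sum>a<m. q ^ (a * (m - a))) - 1)"
    unfolding sum_distrib_right[symmetric] by (simp add: right_diff_distrib mult.left_commute)
  finally have F: "(F has_sum \<theta> * (coth_q q m * (\<Sum>a<m. q ^ (a * (m - a))) - 1)) UNIV" .
  have F0: "F 0 = coth_q q m * of_nat m * pronic_weight q m - pronic_weight q m"
  proof -
    have "q powi (L * (L + 1)) = pronic_weight q m"
      unfolding pronic_weight_def by (rule power_int_eq_power) (auto simp: L_def m algebra_simps)
    then show ?thesis by (simp add: F_def mult.assoc)
  qed
  have key: "F (int c) + F (- int c) = pair_term q w m (2 * c)" if c: "0 < c" for c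
  proof -
    \<comment> \<open>Every exponent that belongs to \<open>c\<close> or \<open>- c\<close> is
      \<open>Y\<close> plus a natural multiple of \<open>2 c\<close>; measuring from
      \<open>Y\<close> leaves only natural powers of \<open>E\<close>.\<close>
    define Y where "Y = (L - int c) * (L - int c + 1)"
    define M E a b where "M = q ^ m" and "E = q ^ (2 * c)" and "a = q powi Y" and "b = a * E ^ m"
    have nz: "1 - M \<noteq> 0" "1 - E \<noteq> 0"
      using one_minus_power_nonzero[OF q(1), of m] one_minus_power_nonzero[OF q(1), of "2 * c"] c m
      by (auto simp: M_def E_def)
    have t1: "q powi (L * (L + 1) + int c * int c + int c * (int m - 2 * int i)) = a * (E * E ^ (m - Suc i))"
      if "i < m" for i
    proof -
      have "L * (L + 1) + int c * int c + int c * (int m - 2 * int i) = Y + int (2 * c * Suc (m - Suc i))"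
      proof -
        have d: "int (Suc (m - Suc i)) = 2 * L + 1 - int i" using that mL by simp
        show ?thesis unfolding of_nat_mult d by (simp add: Y_def mL algebra_simps)
      qed
      from power_int_add_power[OF q(2) this] show ?thesis by (simp only: a_def E_def power_mult power_Suc)
    qed
    have t2: "q powi (L * (L + 1) + - int c * - int c + - int c * (int m - 2 * int i)) = a * E ^ i" for i
    proof -
      have "L * (L + 1) + - int c * - int c + - int c * (int m - 2 * int i) = Y + int (2 * c * i)"
        by (simp add: Y_def mL algebra_simps)
      from power_int_add_power[OF q(2) this] show ?thesis by (simp add: a_def E_def power_mult)
    qed
    have s: "(\<Sum>i<m. q powi (L * (L + 1) + int c * int c + int c * (int m - 2 * int i))) = a * E * ((1 - E ^ m) / (1 - E))"
      "(\<Sum>i<m. q powi (L * (L + 1) + - int c * - int c + - int c * (int m - 2 * int i))) = a * ((1 - E ^ m) / (1 - E))"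
    proof -
      have "E \<noteq> 1" using nz by simp
      note g = geometric_sum_reversed[OF this, of m]
      have "(\<Sum>i<m. q powi (L * (L + 1) + int c * int c + int c * (int m - 2 * int i)))
          = (\<Sum>i<m. a * E * E ^ (m - Suc i))"
        by (rule sum.cong[OF refl]) (simp only: t1 lessThan_iff mult.assoc)
      then show "(\<Sum>i<m. q powi (L * (L + 1) + int c * int c + int c * (int m - 2 * int i)))
          = a * E * ((1 - E ^ m) / (1 - E))" unfolding sum_distrib_left[symmetric] g .
      show "(\<Sum>i<m. q powi (L * (L + 1) + - int c * - int c + - int c * (int m - 2 * int i)))
          = a * ((1 - E ^ m) / (1 - E))" unfolding t2 sum_distrib_left[symmetric] g ..
    qed
    have b: "q powi ((L + int c) * (L + int c + 1)) = b"
    proof -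
      have "(L + int c) * (L + int c + 1) = Y + int (2 * c * m)" by (simp add: Y_def m L_def algebra_simps)
      from power_int_add_power[OF q(2) this] show ?thesis by (simp add: a_def b_def E_def power_mult)
    qed
    have FF: "F (int c) + F (- int c) = coth_q q m * ((1 + E) * (a - b) / (1 - E)) - b - a"
    proof -
      have ya: "q powi ((L + - int c) * (L + - int c + 1)) = a" by (simp add: a_def Y_def)
      have "a * E * ((1 - E ^ m) / (1 - E)) + a * ((1 - E ^ m) / (1 - E)) = (1 + E) * (a - b) / (1 - E)"
        using nz unfolding b_def by (simp add: divide_simps) (simp add: algebra_simps)
      moreover have "k * x - b + (k * y - a) = k * (x + y) - b - a" for k x y :: complex
        by (simp add: algebra_simps)
      ultimately show ?thesis unfolding F_def s b ya by (simp only:)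
    qed
    have wg: "w (m + 2 * c) = b * (1 + M * E)"
    proof -
      have "(L + int c) * (L + int c + 1) = int ((l + c) * (l + c + 1))" by (simp add: L_def algebra_simps)
      from b[unfolded this power_int_of_nat] have "b = q ^ ((l + c) * (l + c + 1))" by (rule sym)
      then show ?thesis by (simp add: w_def pronic_weight_def m M_def E_def power_add)
    qed
    \<comment> \<open>In both cases \<open>a\<close> is the pronic weight of the distance of
      \<open>m\<close> and \<open>2 c\<close>; the factor \<open>1 + q ^ g\<close> of
      \<open>w\<close> turns the power with exponent \<open>min m (2 * c)\<close> into
      \<open>M + E\<close>.\<close>
    have wf: "w (m - 2 * c + (2 * c - m)) * q ^ min m (2 * c) = a * (M + E)"
    proof (cases "c \<le> l")
      case True
      then obtain i where i: "l = c + i" using le_Suc_ex by blast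
      have f: "m - 2 * c + (2 * c - m) = 2 * i + 1" "min m (2 * c) = 2 * c" using i m by auto
      have "a = q ^ (i * (i + 1))" unfolding a_def
        by (rule power_int_eq_power) (auto simp: Y_def L_def i algebra_simps)
      moreover have "M = q ^ (2 * i + 1) * E" by (simp add: M_def E_def m i algebra_simps flip: power_add)
      ultimately show ?thesis unfolding f by (simp add: w_def pronic_weight_def E_def algebra_simps)
    next
      case False
      then obtain i where i: "c = l + 1 + i" using less_imp_Suc_add[of l c] by auto
      have f: "m - 2 * c + (2 * c - m) = 2 * i + 1" "min m (2 * c) = m" using i m by auto
      have "a = q ^ (i * (i + 1))" unfolding a_def
        by (rule power_int_eq_power) (auto simp: Y_def L_def i algebra_simps)
      moreover have "E = q ^ (2 * i + 1) * M" by (simp add: M_def E_def m i algebra_simps flip: power_add)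
      ultimately show ?thesis unfolding f by (simp add: w_def pronic_weight_def M_def algebra_simps)
    qed
    have "coth_q q m * ((1 + E) * (a - b) / (1 - E)) - b - a = 2 * (a * (M + E) - b * (1 + M * E)) / ((1 - M) * (1 - E))"
      unfolding coth_q_def M_def[symmetric] using nz by (simp add: divide_simps) (simp add: algebra_simps)
    then show ?thesis unfolding FF pair_term_def wf wg by (simp add: M_def E_def)
  qed
  have rows: "((\<lambda>c. F (int c) + F (- int c)) has_sum (\<theta> * (coth_q q m * (\<Sum>a<m. q ^ (a * (m - a))) - 1) - F 0)) {n. 0 < n}"
    using has_sum_int_split[OF F] by simp
  have "((\<lambda>e. pair_term q w m e) has_sum (\<theta> * (coth_q q m * (\<Sum>a<m. q ^ (a * (m - a))) - 1) - F 0)) evens"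
    by (rule iffD1[OF has_sum_reindex_bij_witness[of "{n. 0 < n}" "\<lambda>e. e div 2" "\<lambda>c. 2 * c"] rows])
      (auto simp: evens_def key)
  then show ?thesis unfolding F0 \<theta>_def .
qed

definition square_weight :: "complex \<Rightarrow> nat \<Rightarrow> complex" where
  "square_weight q g = q ^ ((g + 1) div 2 * ((g + 1) div 2))"

text \<open>The same shift of the theta index gives the exponent
  \<open>(L + 1)^2 + 2 (L - a) c + c^2\<close>, again linear in \<open>a\<close>. Replacing
  \<open>a\<close> by \<open>m - 1 - a\<close> exchanges \<open>c\<close> and \<open>- c\<close>, so
  both contribute equally; this is the factor 2 in \<open>pair_term\<close>.\<close>

lemma pair_row_square:
  fixes q :: complex
  assumes q: "norm q < 1" "q \<noteq> 0" and "odd m"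
  shows "((\<lambda>e. pair_term q (square_weight q) m e) has_sum
    ((\<Sum>\<^sub>\<infinity>r. q ^ (r * r) * (1 + q ^ (2 * r + 1))) * (\<Sum>a<m. q ^ ((a + 1) * (m - a)))
      - of_nat m * square_weight q m) / (1 - q ^ m)) evens"
proof -
  obtain l where m: "m = 2 * l + 1" using \<open>odd m\<close> by (rule oddE)
  define L where "L = int l"
  have mL: "int m = 2 * L + 1" by (simp add: m L_def)
  define \<theta> where "\<theta> = (\<Sum>\<^sub>\<infinity>r. q ^ (r * r) * (1 + q ^ (2 * r + 1)))"
  define F where "F c = (\<Sum>a<m. q powi ((L + 1) * (L + 1) + 2 * (L - int a) * c + c * c))" for c
  note \<theta> = theta_square[OF q(1), folded \<theta>_def]
  have "((\<lambda>c. q powi ((L + 1) * (L + 1) + 2 * (L - int a) * c + c * c)) has_sum q ^ ((a + 1) * (m - a)) * \<theta>) UNIV"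
    if "a < m" for a
  proof -
    have "q ^ ((a + 1) * (m - a)) * q powi ((L - int a + c) * (L - int a + c)) =
        q powi ((L + 1) * (L + 1) + 2 * (L - int a) * c + c * c)" for c
    proof -
      have "(L + 1) * (L + 1) + 2 * (L - int a) * c + c * c =
          (L - int a + c) * (L - int a + c) + int ((a + 1) * (m - a))"
      proof -
        have d: "int (m - a) = 2 * L + 1 - int a" using that mL by (simp add: of_nat_diff)
        show ?thesis unfolding of_nat_mult d by (simp add: algebra_simps)
      qed
      from power_int_add_power[OF q(2) this] show ?thesis by (simp add: mult.commute)
    qed
    then show ?thesis
      using has_sum_cmult_right[OF has_sum_int_shift[OF \<theta>, of "L - int a"], of "q ^ ((a + 1) * (m - a))"] by simp
  qed
  then have "(F has_sum (\<Sum>a<m. q ^ ((a + 1) * (m - a)) * \<theta>)) UNIV"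
    unfolding F_def by (intro has_sum_finite_sum) auto
  then have F: "(F has_sum \<theta> * (\<Sum>a<m. q ^ ((a + 1) * (m - a)))) UNIV"
    by (simp only: sum_distrib_left mult.commute[of _ \<theta>])
  have F0: "F 0 = of_nat m * square_weight q m"
  proof -
    have "q powi ((L + 1) * (L + 1)) = square_weight q m"
      unfolding square_weight_def by (rule power_int_eq_power) (auto simp: L_def m algebra_simps)
    then show ?thesis by (simp add: F_def)
  qed
  have key: "(F (int c) + F (- int c)) / (1 - q ^ m) = pair_term q (square_weight q) m (2 * c)" if c: "0 < c" for c
  proof -
    define Z where "Z = (L + 1) * (L + 1) + int c * int c - 2 * L * int c"
    define E a where "E = q ^ (2 * c)" and "a = q powi Z"
    have nz: "E \<noteq> 1"
      using one_minus_power_nonzero[OF q(1), of "2 * c"] c by (auto simp: E_def)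
    have t1: "q powi ((L + 1) * (L + 1) + 2 * (L - int i) * int c + int c * int c) = a * E ^ (m - Suc i)"
      if "i < m" for i
    proof -
      have "(L + 1) * (L + 1) + 2 * (L - int i) * int c + int c * int c = Z + int (2 * c * (m - Suc i))"
      proof -
        have d: "int (m - Suc i) = 2 * L - int i" using that mL by (simp add: of_nat_diff)
        show ?thesis unfolding of_nat_mult d by (simp add: Z_def algebra_simps)
      qed
      from power_int_add_power[OF q(2) this] show ?thesis by (simp add: a_def E_def power_mult)
    qed
    have t2: "q powi ((L + 1) * (L + 1) + 2 * (L - int i) * - int c + - int c * - int c) = a * E ^ i" for i
    proof -
      have "(L + 1) * (L + 1) + 2 * (L - int i) * - int c + - int c * - int c = Z + int (2 * c * i)"
        by (simp add: Z_def algebra_simps)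
      from power_int_add_power[OF q(2) this] show ?thesis by (simp add: a_def E_def power_mult)
    qed
    have s: "F (int c) = a * ((1 - E ^ m) / (1 - E))" "F (- int c) = a * ((1 - E ^ m) / (1 - E))"
    proof -
      note g = geometric_sum_reversed[OF nz, of m]
      have "F (int c) = (\<Sum>i<m. a * E ^ (m - Suc i))"
        unfolding F_def by (rule sum.cong[OF refl]) (simp only: t1 lessThan_iff)
      then show "F (int c) = a * ((1 - E ^ m) / (1 - E))" unfolding sum_distrib_left[symmetric] g .
      show "F (- int c) = a * ((1 - E ^ m) / (1 - E))" unfolding F_def t2 sum_distrib_left[symmetric] g ..
    qed
    have wg: "square_weight q (m + 2 * c) = a * E ^ m"
    proof -
      have "int ((l + c + 1) * (l + c + 1)) = Z + int (2 * c * m)" by (simp add: Z_def m L_def algebra_simps)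
      from power_int_add_power[OF q(2) this]
      have "q ^ ((l + c + 1) * (l + c + 1)) = a * E ^ m"
        by (simp only: a_def E_def power_mult power_int_of_nat)
      moreover have "(m + 2 * c + 1) div 2 = l + c + 1" using m by simp
      ultimately show ?thesis unfolding square_weight_def by (simp only:)
    qed
    have wf: "square_weight q (m - 2 * c + (2 * c - m)) * q ^ min m (2 * c) = a"
    proof (cases "c \<le> l")
      case True
      then obtain i where i: "l = c + i" using le_Suc_ex by blast
      have f: "m - 2 * c + (2 * c - m) = 2 * i + 1" "min m (2 * c) = 2 * c" using i m by auto
      have "a = q ^ ((i + 1) * (i + 1) + 2 * c)" unfolding a_def
        by (rule power_int_eq_power) (auto simp: Z_def L_def i algebra_simps)
      moreover have "(2 * i + 1 + 1) div 2 = i + 1" by simp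
      ultimately show ?thesis unfolding f square_weight_def by (simp only: power_add)
    next
      case False
      then obtain i where i: "c = l + 1 + i" using less_imp_Suc_add[of l c] by auto
      have f: "m - 2 * c + (2 * c - m) = 2 * i + 1" "min m (2 * c) = m" using i m by auto
      have "a = q ^ ((i + 1) * (i + 1) + m)" unfolding a_def
        by (rule power_int_eq_power) (auto simp: Z_def L_def i m algebra_simps)
      moreover have "(2 * i + 1 + 1) div 2 = i + 1" by simp
      ultimately show ?thesis unfolding f square_weight_def by (simp only: power_add)
    qed
    have "(a * (x / z) + a * (x / z)) / y = 2 * (a * x) / (y * z)" for x y z :: complex
      by (simp add: mult.commute)
    moreover have "a - a * E ^ m = a * (1 - E ^ m)" by (simp add: algebra_simps)
    ultimately show ?thesis unfolding s pair_term_def wf wg E_def[symmetric] by (simp only:)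
  qed
  have "((\<lambda>c. F (int c) + F (- int c)) has_sum (\<theta> * (\<Sum>a<m. q ^ ((a + 1) * (m - a))) - F 0)) {n. 0 < n}"
    using has_sum_int_split[OF F] by simp
  then have rows: "((\<lambda>c. (F (int c) + F (- int c)) / (1 - q ^ m)) has_sum
      (\<theta> * (\<Sum>a<m. q ^ ((a + 1) * (m - a))) - F 0) / (1 - q ^ m)) {n. 0 < n}"
    by (rule has_sum_divide_const)
  have "((\<lambda>e. pair_term q (square_weight q) m e) has_sum
      (\<theta> * (\<Sum>a<m. q ^ ((a + 1) * (m - a))) - F 0) / (1 - q ^ m)) evens"
    by (rule iffD1[OF has_sum_reindex_bij_witness[of "{n. 0 < n}" "\<lambda>e. e div 2" "\<lambda>c. 2 * c"] rows])
      (auto simp: evens_def key)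
  then show ?thesis unfolding F0 \<theta>_def .
qed

definition triangular_weight :: "complex \<Rightarrow> nat \<Rightarrow> complex" where
  "triangular_weight q g = q ^ (g * (g + 1) div 2)"

text \<open>Here \<open>m\<close> may have either parity, and theta is summed over one residue class
  modulo 2, at the index \<open>2 m - a + 2 s\<close>. In terms of \<open>d = m + 1 + 2 s\<close>
  the exponent is linear in \<open>a\<close>. The geometric sums for \<open>d\<close> and
  \<open>- d\<close> merge into a single one, which is half a pair term; \<open>d = 0\<close> occurs
  only for odd \<open>m\<close>.\<close>

lemma pair_row_triangular:
  fixes q :: complex
  assumes q: "norm q < 1" "q \<noteq> 0" and "0 < m"
  shows "((\<lambda>d. pair_term q (triangular_weight q) m d / 2) has_sum
    ((\<Sum>\<^sub>\<infinity>r. q ^ (r * (2 * r + 1)) * (1 + q ^ (2 * r + 1))) * (\<Sum>a<m. q ^ (a * (2 * m - 1 - a) div 2 + m))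
      - (if odd m then of_nat m * triangular_weight q m else 0)) / (1 - q ^ m)) {d. 0 < d \<and> even (d + m + 1)}"
proof -
  define L where "L = int m"
  define \<theta> where "\<theta> = (\<Sum>\<^sub>\<infinity>r. q ^ (r * (2 * r + 1)) * (1 + q ^ (2 * r + 1)))"
  define t where "t x = x * (x + 1) div 2" for x :: int
  have t2: "2 * t x = x * x + x" for x
  proof -
    have "even (x * (x + 1))" by simp
    then have "2 * t x = x * (x + 1)" unfolding t_def by (rule dvd_mult_div_cancel)
    then show ?thesis by (simp add: algebra_simps)
  qed
  define D where "D = {d::int. even (d + L + 1)}"
  define F where "F d = (\<Sum>a<m. q powi (t L + t d + d * (L - 1 - int a)))" for d
  have "((\<lambda>d. q powi (t L + t d + d * (L - 1 - int a))) has_sum q ^ (a * (2 * m - 1 - a) div 2 + m) * \<theta>) D"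
    if "a < m" for a
  proof -
    define n where "n = a * (2 * m - 1 - a) div 2"
    have n2: "2 * int n = int a * (2 * L - 1 - int a)"
    proof -
      have "even (a * (2 * m - 1 - a))" using that by (cases "even a") auto
      then have "2 * n = a * (2 * m - 1 - a)" unfolding n_def by (rule dvd_mult_div_cancel)
      then have "2 * int n = int a * int (2 * m - 1 - a)" by (metis of_nat_mult of_nat_numeral)
      moreover have "int (2 * m - 1 - a) = 2 * L - 1 - int a" using that by (simp add: L_def of_nat_diff)
      ultimately show ?thesis by simp
    qed
    have "((\<lambda>s. q ^ (n + m) * q powi (t (2 * L - int a + 2 * s))) has_sum q ^ (n + m) * \<theta>) UNIV"
      using has_sum_cmult_right[OF theta_triangular[OF q(1), of "2 * L - int a"], of "q ^ (n + m)"]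
      by (simp only: t_def \<theta>_def)
    moreover have "q ^ (n + m) * q powi (t (2 * L - int a + 2 * s)) =
        q powi (t L + t (L + 1 + 2 * s) + (L + 1 + 2 * s) * (L - 1 - int a))" for s
    proof -
      have "2 * (t L + t (L + 1 + 2 * s) + (L + 1 + 2 * s) * (L - 1 - int a)) =
          2 * t (2 * L - int a + 2 * s) + 2 * int n + 2 * L"
        unfolding distrib_left t2 n2 by (simp add: algebra_simps)
      then have "t L + t (L + 1 + 2 * s) + (L + 1 + 2 * s) * (L - 1 - int a) =
          t (2 * L - int a + 2 * s) + int (n + m)" by (simp add: L_def)
      from power_int_add_power[OF q(2) this] show ?thesis by (simp add: mult.commute)
    qed
    ultimately have row: "((\<lambda>s. q powi (t L + t (L + 1 + 2 * s) + (L + 1 + 2 * s) * (L - 1 - int a))) has_sum q ^ (n + m) * \<theta>) UNIV"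
      by simp
    show ?thesis unfolding n_def[symmetric]
      by (rule iffD1[OF has_sum_reindex_bij_witness[of UNIV "\<lambda>d. (d - L - 1) div 2" "\<lambda>s. L + 1 + 2 * s"] row])
        (auto simp: D_def elim!: evenE)
  qed
  then have "(F has_sum (\<Sum>a<m. q ^ (a * (2 * m - 1 - a) div 2 + m) * \<theta>)) D"
    unfolding F_def by (intro has_sum_finite_sum) auto
  then have F: "(F has_sum \<theta> * (\<Sum>a<m. q ^ (a * (2 * m - 1 - a) div 2 + m))) D"
    by (simp only: sum_distrib_left mult.commute[of _ \<theta>])
  have tw: "triangular_weight q g = q powi (t (int g))" for g
  proof -
    have "int (g * (g + 1) div 2) = t (int g)" by (simp add: t_def zdiv_int algebra_simps)
    then show ?thesis unfolding triangular_weight_def by (metis power_int_of_nat)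
  qed
  have F0: "(if 0 \<in> D then F 0 else 0) = (if odd m then of_nat m * triangular_weight q m else 0)"
    unfolding tw by (simp add: D_def F_def L_def t_def)
  have key: "(F (int c) + F (- int c)) / (1 - q ^ m) = pair_term q (triangular_weight q) m c / 2" if c: "0 < c" for c
  proof -
    define Z where "Z = t L + t (int c) - int c * L"
    define E a where "E = q ^ c" and "a = q powi Z"
    have Z2: "2 * Z = (L - int c) * (L - int c) + L + int c"
      unfolding Z_def right_diff_distrib distrib_left t2 by (simp add: algebra_simps)
    have nz: "E \<noteq> 1"
      using one_minus_power_nonzero[OF q(1) c] by (auto simp: E_def)
    have t1: "q powi (t L + t (int c) + int c * (L - 1 - int i)) = a * E ^ m * E ^ (m - Suc i)" if "i < m" for i
    proof -
      have d: "int (m - Suc i) = L - 1 - int i" using that by (simp add: L_def of_nat_diff)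
      have "t L + t (int c) + int c * (L - 1 - int i) = Z + int (c * (m + (m - Suc i)))"
        unfolding of_nat_mult of_nat_add d by (simp add: Z_def L_def algebra_simps)
      from power_int_add_power[OF q(2) this] show ?thesis
        by (simp only: a_def E_def power_mult power_add mult.assoc)
    qed
    have tneg: "q powi (t L + t (- int c) + - int c * (L - 1 - int i)) = a * E ^ i" for i
    proof -
      have "2 * (t L + t (- int c) + - int c * (L - 1 - int i)) = 2 * Z + 2 * int (c * i)"
        unfolding distrib_left t2 Z2 by (simp add: algebra_simps)
      then have "t L + t (- int c) + - int c * (L - 1 - int i) = Z + int (c * i)" by simp
      from power_int_add_power[OF q(2) this] show ?thesis by (simp add: a_def E_def power_mult)
    qed
    have s: "F (int c) = a * E ^ m * ((1 - E ^ m) / (1 - E))" "F (- int c) = a * ((1 - E ^ m) / (1 - E))"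
    proof -
      note g = geometric_sum_reversed[OF nz, of m]
      have "F (int c) = (\<Sum>i<m. a * E ^ m * E ^ (m - Suc i))"
        unfolding F_def by (rule sum.cong[OF refl]) (simp only: t1 lessThan_iff)
      then show "F (int c) = a * E ^ m * ((1 - E ^ m) / (1 - E))" unfolding sum_distrib_left[symmetric] g .
      show "F (- int c) = a * ((1 - E ^ m) / (1 - E))" unfolding F_def tneg sum_distrib_left[symmetric] g ..
    qed
    have wg: "triangular_weight q (m + c) = a * E ^ m * E ^ m"
    proof -
      have "2 * t (int (m + c)) = 2 * Z + 2 * int (c * (m + m))"
        unfolding t2 Z2 by (simp add: L_def algebra_simps)
      then have "t (int (m + c)) = Z + int (c * (m + m))" by simp
      from power_int_add_power[OF q(2) this] show ?thesis
        unfolding tw by (simp only: a_def E_def power_mult power_add mult.assoc)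
    qed
    have wf: "triangular_weight q (m - c + (c - m)) * q ^ min m c = a"
    proof -
      define f where "f = m - c + (c - m)"
      have "int f * int f + int f + 2 * int (min m c) = 2 * Z"
        unfolding Z2 f_def by (cases "c \<le> m") (auto simp: L_def of_nat_diff min_def algebra_simps)
      then have "2 * Z = 2 * t (int f) + 2 * int (min m c)" unfolding t2 by simp
      then have "Z = t (int f) + int (min m c)" by simp
      from power_int_add_power[OF q(2) this] show ?thesis unfolding tw f_def a_def by simp
    qed
    have e: "a * E ^ m * ((1 - E ^ m) / (1 - E)) + a * ((1 - E ^ m) / (1 - E)) = (a - a * E ^ m * E ^ m) / (1 - E)"
      using nz by (simp add: divide_simps) (simp add: algebra_simps)
    have "x / z / y = 2 * x / (y * z) / 2" for x y z :: complex by (simp add: mult.commute)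
    moreover have "2 * (triangular_weight q (m - c + (c - m)) * q ^ min m c - triangular_weight q (m + c)) =
        2 * (a - a * E ^ m * E ^ m)" unfolding wf wg ..
    ultimately show ?thesis unfolding s e pair_term_def E_def[symmetric] by (simp only:)
  qed
  have "((\<lambda>c. F (int c) + F (- int c)) has_sum
      (\<theta> * (\<Sum>a<m. q ^ (a * (2 * m - 1 - a) div 2 + m)) - (if 0 \<in> D then F 0 else 0))) {n. 0 < n \<and> int n \<in> D}"
    by (rule has_sum_int_split[OF F]) (auto simp: D_def)
  then have "((\<lambda>c. (F (int c) + F (- int c)) / (1 - q ^ m)) has_sum
      (\<theta> * (\<Sum>a<m. q ^ (a * (2 * m - 1 - a) div 2 + m)) - (if 0 \<in> D then F 0 else 0)) / (1 - q ^ m)) {n. 0 < n \<and> int n \<in> D}"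
    by (rule has_sum_divide_const)
  also have "?this \<longleftrightarrow> ((\<lambda>d. pair_term q (triangular_weight q) m d / 2) has_sum
      (\<theta> * (\<Sum>a<m. q ^ (a * (2 * m - 1 - a) div 2 + m)) - (if 0 \<in> D then F 0 else 0)) / (1 - q ^ m)) {n. 0 < n \<and> int n \<in> D}"
    by (rule has_sum_cong) (use key in auto)
  finally have "((\<lambda>d. pair_term q (triangular_weight q) m d / 2) has_sum
      (\<theta> * (\<Sum>a<m. q ^ (a * (2 * m - 1 - a) div 2 + m)) - (if 0 \<in> D then F 0 else 0)) / (1 - q ^ m)) {n. 0 < n \<and> int n \<in> D}" .
  moreover have "{n. 0 < n \<and> int n \<in> D} = {d. 0 < d \<and> even (d + m + 1)}"
    by (auto simp: D_def L_def)
  ultimately show ?thesis unfolding F0 \<theta>_def by simp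
qed

section \<open>Comparison of the row sums with the telescoped double sum\<close>

lemma has_sum_odds_iff: "(f has_sum S) odds \<longleftrightarrow> ((\<lambda>r. f (2 * r + 1)) has_sum S) UNIV"
  by (rule has_sum_reindex_bij_witness[of _ "\<lambda>r. 2 * r + 1" "\<lambda>g. g div 2"]) (auto simp: odds_def)

lemma summable_on_odds_weight:
  fixes w :: "nat \<Rightarrow> complex"
  assumes "0 \<le> r" "r < 1" and w: "\<And>i. norm (w (2 * i + 1)) \<le> C * r ^ i"
  shows "(\<lambda>g. real g * norm (w g)) summable_on odds"
proof -
  have "summable (\<lambda>i. real (Suc i) * r ^ i)"
    using geometric_deriv_sums[of r] assms(1,2) sums_summable by fastforce
  then have "summable (\<lambda>i. 2 * C * (real (Suc i) * r ^ i))" by (rule summable_mult)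
  then have "summable (\<lambda>i. real (2 * i + 1) * norm (w (2 * i + 1)))"
  proof (rule summable_comparison_test')
    fix i :: nat
    have "0 \<le> C * r ^ i" using w[of i] norm_ge_zero[of "w (2 * i + 1)"] by linarith
    then have "real (2 * i + 1) * norm (w (2 * i + 1)) \<le> (2 * real (Suc i)) * (C * r ^ i)"
      using w[of i] by (intro mult_mono) auto
    then show "norm (real (2 * i + 1) * norm (w (2 * i + 1))) \<le> 2 * C * (real (Suc i) * r ^ i)"
      by (simp add: mult_ac)
  qed
  then have "(\<lambda>i. real (2 * i + 1) * norm (w (2 * i + 1))) summable_on UNIV"
    by (rule summable_nonneg_imp_summable_on) auto
  then show ?thesis unfolding summable_on_def has_sum_odds_iff .
qed

lemma pair_term_commute: "pair_term q w m e = pair_term q w e m"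
  by (simp add: pair_term_def add.commute min.commute mult.commute)

text \<open>The cancellation of the terms with a factor \<open>g\<close>: those of the central theta
  index against those left by telescoping.\<close>

lemma coth_collect:
  "of_nat g * w g / (1 - q ^ g) + w g / (1 - q ^ g) * (coth_q q g - of_nat g) = w g / (1 - q ^ g) * coth_q q g"
  by (simp add: algebra_simps diff_divide_distrib)

text \<open>The double sum \<open>K\<close> is computed by rows and by telescoping, and eliminated.
  The terms with a factor \<open>g\<close> cancel because \<open>w g / (1 - q ^ g)\<close> is
  \<open>pronic_weight q g * coth_q q g\<close>; what remains is the weight times
  \<open>coth^2 - 1\<close>, and this is \<open>4 q^g / (1 - q^g)^2\<close>.\<close>

lemma F_times_theta:
  fixes q :: complex
  assumes q: "norm q < 1" "q \<noteq> 0"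
    and S: "((\<lambda>m. (1 + q ^ m) / (1 - q ^ m) * (1 + (\<Sum>a\<in>{1..<m}. q ^ (a * (m - a)))) - 1) has_sum 2 * S) {m. odd m}"
  shows "S * (\<Sum>\<^sub>\<infinity>r. q ^ (r * (r + 1))) = q * (\<Sum>\<^sub>\<infinity>r. q ^ (r * (r + 3)) / (1 - q ^ (2 * r + 1))\<^sup>2)"
proof -
  define \<theta> where "\<theta> = (\<Sum>\<^sub>\<infinity>r. q ^ (r * (r + 1)))"
  define \<omega> where "\<omega> = pronic_weight q"
  define w where "w = (\<lambda>g. \<omega> g * (1 + q ^ g))"
  have \<omega>: "\<omega> (2 * i + 1) = q ^ (i * (i + 1))" for i by (simp add: \<omega>_def pronic_weight_def)
  have w_le: "norm (w (2 * i + 1)) \<le> 2 * norm q ^ i" for i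
  proof -
    have "norm (q ^ (2 * i + 1)) \<le> 1" using q by (simp add: norm_power power_le_one del: power_Suc)
    then have "norm (1 + q ^ (2 * i + 1)) \<le> 2"
      using norm_triangle_ineq[of 1 "q ^ (2 * i + 1)"] by (smt (verit) norm_one)
    moreover have "norm q ^ (i * (i + 1)) \<le> norm q ^ i" using q by (intro power_decreasing) auto
    ultimately have "norm q ^ (i * (i + 1)) * norm (1 + q ^ (2 * i + 1)) \<le> norm q ^ i * 2"
      by (intro mult_mono) auto
    then show ?thesis unfolding w_def \<omega> norm_mult norm_power[of q] by (simp only: mult.commute)
  qed
  from pair_term_has_sum[OF q(1) summable_on_odds_weight[OF _ q(1) w_le]] obtain K where
    K: "((\<lambda>(m, e). pair_term q w m e) has_sum K) (odds \<times> evens)"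
    "((\<lambda>g. w g / (1 - q ^ g) * (coth_q q g - of_nat g)) has_sum K) odds" by auto
  have rows: "((\<lambda>m. 2 * \<theta> * (coth_q q m * (\<Sum>a<m. q ^ (a * (m - a))) - 1)
      - (coth_q q m * of_nat m * \<omega> m - \<omega> m)) has_sum K) odds"
  proof (rule has_sum_SigmaD[OF K(1)])
    fix m assume "m \<in> odds"
    then have "odd m" by (simp add: odds_def)
    from pair_row_pronic[OF q this]
    show "((\<lambda>e. case (m, e) of (m, e) \<Rightarrow> pair_term q w m e) has_sum
        2 * \<theta> * (coth_q q m * (\<Sum>a<m. q ^ (a * (m - a))) - 1) - (coth_q q m * of_nat m * \<omega> m - \<omega> m)) evens"
      by (simp add: w_def \<omega>_def \<theta>_def)
  qed
  have "((\<lambda>m. coth_q q m * (\<Sum>a<m. q ^ (a * (m - a))) - 1) has_sum 2 * S) odds"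
  proof (rule iffD1[OF has_sum_cong S[folded odds_def]])
    fix m assume "m \<in> odds"
    then have "0 < m" using odd_pos by (auto simp: odds_def)
    then have "{..<m} = insert 0 {1..<m}" by auto
    then show "(1 + q ^ m) / (1 - q ^ m) * (1 + (\<Sum>a\<in>{1..<m}. q ^ (a * (m - a)))) - 1 =
        coth_q q m * (\<Sum>a<m. q ^ (a * (m - a))) - 1"
      by (simp add: coth_q_def)
  qed
  from has_sum_diff_complex[OF has_sum_cmult_right[OF this, of "2 * \<theta>"] rows]
  have "((\<lambda>m. coth_q q m * of_nat m * \<omega> m - \<omega> m) has_sum 2 * \<theta> * (2 * S) - K) odds" by simp
  from has_sum_add[OF this K(2)]
  have "((\<lambda>g. coth_q q g * of_nat g * \<omega> g - \<omega> g + w g / (1 - q ^ g) * (coth_q q g - of_nat g)) has_sum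
      2 * \<theta> * (2 * S) - K + K) odds" .
  then have "((\<lambda>r. 4 * q * (q ^ (r * (r + 3)) / (1 - q ^ (2 * r + 1))\<^sup>2)) has_sum 2 * \<theta> * (2 * S) - K + K) UNIV"
    unfolding has_sum_odds_iff
  proof (rule iffD1[OF has_sum_cong, rotated])
    fix r :: nat
    define g where "g = 2 * r + 1"
    have ne: "1 - q ^ g \<noteq> 0" using one_minus_power_nonzero[OF q(1), of g] by (simp add: g_def)
    have "w g / (1 - q ^ g) = \<omega> g * coth_q q g" by (simp add: w_def coth_q_def)
    then have "coth_q q g * of_nat g * \<omega> g - \<omega> g + w g / (1 - q ^ g) * (coth_q q g - of_nat g) = \<omega> g * (coth_q q g ^ 2 - 1)"
      by (simp only:) (simp add: power2_eq_square algebra_simps)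
    also have "coth_q q g ^ 2 - 1 = 4 * q ^ g / (1 - q ^ g)\<^sup>2"
      unfolding coth_q_def using ne by (simp add: power2_eq_square divide_simps) (simp add: algebra_simps)
    also have "\<omega> g * (4 * q ^ g / (1 - q ^ g)\<^sup>2) = 4 * q * (q ^ (r * (r + 3)) / (1 - q ^ g)\<^sup>2)"
    proof -
      have "r * (r + 1) + g = r * (r + 3) + 1" by (simp add: g_def algebra_simps)
      then have "\<omega> g * q ^ g = q ^ (r * (r + 3) + 1)" by (simp only: \<omega>[of r, folded g_def] flip: power_add)
      then show ?thesis by simp
    qed
    finally show "coth_q q (2 * r + 1) * of_nat (2 * r + 1) * \<omega> (2 * r + 1) - \<omega> (2 * r + 1) +
        w (2 * r + 1) / (1 - q ^ (2 * r + 1)) * (coth_q q (2 * r + 1) - of_nat (2 * r + 1)) =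
        4 * q * (q ^ (r * (r + 3)) / (1 - q ^ (2 * r + 1))\<^sup>2)"
      unfolding g_def .
  qed
  from infsumI[OF this] have "4 * (S * \<theta>) = 4 * (q * (\<Sum>\<^sub>\<infinity>r. q ^ (r * (r + 3)) / (1 - q ^ (2 * r + 1))\<^sup>2))"
    unfolding infsum_cmult_right' by (simp add: mult_ac)
  then show ?thesis unfolding \<theta>_def by simp
qed

text \<open>Rows with odd \<open>m\<close> cover \<open>odds \<times> evens\<close>, rows with even
  \<open>m\<close> cover \<open>evens \<times> odds\<close>. As \<open>pair_term\<close> is
  symmetric, each family of halved terms adds up to \<open>K / 2\<close>; only the odd rows carry a
  central term.\<close>

lemma H_times_theta:
  fixes q :: complex
  assumes q: "norm q < 1" "q \<noteq> 0"
    and S: "((\<lambda>m. (\<Sum>a<m. q ^ (a * (2 * m - 1 - a) div 2 + m)) / (1 - q ^ m)) has_sum S) {1..}"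
  shows "S * (\<Sum>\<^sub>\<infinity>r. q ^ (r * (2 * r + 1)) * (1 + q ^ (2 * r + 1))) =
    q * (\<Sum>\<^sub>\<infinity>r. q ^ (r * (2 * r + 3)) * (1 + q ^ (2 * r + 1)) / (1 - q ^ (2 * r + 1))\<^sup>2)"
proof -
  define \<theta> where "\<theta> = (\<Sum>\<^sub>\<infinity>r. q ^ (r * (2 * r + 1)) * (1 + q ^ (2 * r + 1)))"
  define w where "w = triangular_weight q"
  define I where "I m = (\<Sum>a<m. q ^ (a * (2 * m - 1 - a) div 2 + m))" for m
  have w: "w (2 * i + 1) = q ^ ((2 * i + 1) * (i + 1))" for i
  proof -
    have "(2 * i + 1) * (2 * i + 1 + 1) div 2 = (2 * i + 1) * (i + 1)" by simp
    then show ?thesis unfolding w_def triangular_weight_def by (simp only:)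
  qed
  have w_le: "norm (w (2 * i + 1)) \<le> 1 * norm q ^ i" for i
  proof -
    have "norm q ^ ((2 * i + 1) * (i + 1)) \<le> norm q ^ i" using q by (intro power_decreasing) auto
    then show ?thesis unfolding w norm_power by simp
  qed
  from pair_term_has_sum[OF q(1) summable_on_odds_weight[OF _ q(1) w_le]] obtain K where
    K: "((\<lambda>(m, e). pair_term q w m e) has_sum K) (odds \<times> evens)"
    "((\<lambda>g. w g / (1 - q ^ g) * (coth_q q g - of_nat g)) has_sum K) odds" by auto
  from has_sum_divide_const[OF K(1), of 2]
  have half: "((\<lambda>(m, e). pair_term q w m e / 2) has_sum K / 2) (odds \<times> evens)"
    by (simp add: case_prod_unfold)
  have half': "((\<lambda>(m, e). pair_term q w m e / 2) has_sum K / 2) (evens \<times> odds)"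
    using half unfolding has_sum_swap[of _ _ odds] by (simp add: case_prod_unfold pair_term_commute)
  have 1: "((\<lambda>m. (\<theta> * I m - of_nat m * w m) / (1 - q ^ m)) has_sum K / 2) odds"
  proof (rule has_sum_SigmaD[OF half])
    fix m assume "m \<in> odds"
    then have m: "odd m" "0 < m" using odd_pos by (auto simp: odds_def)
    have "{d. 0 < d \<and> even (d + m + 1)} = evens" using m by (auto simp: evens_def)
    then show "((\<lambda>e. case (m, e) of (m, e) \<Rightarrow> pair_term q w m e / 2) has_sum (\<theta> * I m - of_nat m * w m) / (1 - q ^ m)) evens"
      using pair_row_triangular[OF q m(2)] m(1) by (simp add: w_def I_def \<theta>_def)
  qed
  have 2: "((\<lambda>m. \<theta> * I m / (1 - q ^ m)) has_sum K / 2) evens"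
  proof (rule has_sum_SigmaD[OF half'])
    fix m assume "m \<in> evens"
    then have m: "even m" "0 < m" by (auto simp: evens_def)
    have "{d. 0 < d \<and> even (d + m + 1)} = odds" using m by (auto simp: odds_def intro: odd_pos)
    then show "((\<lambda>e. case (m, e) of (m, e) \<Rightarrow> pair_term q w m e / 2) has_sum \<theta> * I m / (1 - q ^ m)) odds"
      using pair_row_triangular[OF q m(2)] m(1) by (simp add: w_def I_def \<theta>_def)
  qed
  have T: "((\<lambda>m. \<theta> * I m / (1 - q ^ m)) has_sum \<theta> * S) {1..}"
    using has_sum_cmult_right[OF S[folded I_def], of \<theta>] by simp
  have "(\<lambda>m. \<theta> * I m / (1 - q ^ m)) summable_on odds"
    using has_sum_imp_summable[OF T] by (rule summable_on_subset) (auto simp: odds_def Suc_le_eq intro: odd_pos)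
  then obtain R where R: "((\<lambda>m. \<theta> * I m / (1 - q ^ m)) has_sum R) odds" by (auto simp: summable_on_def)
  have "((\<lambda>m. \<theta> * I m / (1 - q ^ m)) has_sum R + K / 2) (odds \<union> evens)"
    by (rule has_sum_Un_disjoint[OF R 2]) (auto simp: odds_def evens_def)
  moreover have "odds \<union> evens = {1..}" by (auto simp: odds_def evens_def Suc_le_eq intro: odd_pos)
  ultimately have R': "R = \<theta> * S - K / 2" using has_sum_unique[OF T] by (simp add: eq_diff_eq)
  from has_sum_diff_complex[OF R 1] have "((\<lambda>m. of_nat m * w m / (1 - q ^ m)) has_sum R - K / 2) odds"
    by (simp add: diff_divide_distrib)
  from has_sum_add[OF this K(2), unfolded coth_collect]
  have "((\<lambda>g. w g / (1 - q ^ g) * coth_q q g) has_sum \<theta> * S) odds"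
    unfolding R' by (simp add: algebra_simps)
  then have "((\<lambda>r. q * (q ^ (r * (2 * r + 3)) * (1 + q ^ (2 * r + 1)) / (1 - q ^ (2 * r + 1))\<^sup>2)) has_sum \<theta> * S) UNIV"
    unfolding has_sum_odds_iff
  proof (rule iffD1[OF has_sum_cong, rotated])
    fix r :: nat
    have "(2 * r + 1) * (r + 1) = r * (2 * r + 3) + 1" by (simp add: algebra_simps)
    then have "w (2 * r + 1) = q * q ^ (r * (2 * r + 3))" unfolding w by simp
    then show "w (2 * r + 1) / (1 - q ^ (2 * r + 1)) * coth_q q (2 * r + 1) =
        q * (q ^ (r * (2 * r + 3)) * (1 + q ^ (2 * r + 1)) / (1 - q ^ (2 * r + 1))\<^sup>2)"
      by (simp only:) (simp add: coth_q_def power2_eq_square)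
  qed
  from infsumI[OF this] show ?thesis unfolding infsum_cmult_right' \<theta>_def by (simp add: mult.commute)
qed

lemma F_4n_minus_1_times_theta:
  fixes q :: complex
  assumes q: "norm q < 1" "q \<noteq> 0"
    and S: "((\<lambda>m. (\<Sum>a<m. q ^ ((a + 1) * (m - a))) / (1 - q ^ m)) has_sum S) {m. odd m}"
  shows "S * (\<Sum>\<^sub>\<infinity>r. q ^ (r * r) * (1 + q ^ (2 * r + 1))) =
    q * (\<Sum>\<^sub>\<infinity>r. q ^ (r * (r + 2)) * (1 + q ^ (2 * r + 1)) / (1 - q ^ (2 * r + 1))\<^sup>2)"
proof -
  define \<theta> where "\<theta> = (\<Sum>\<^sub>\<infinity>r. q ^ (r * r) * (1 + q ^ (2 * r + 1)))"
  define w where "w = square_weight q"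
  define I where "I m = (\<Sum>a<m. q ^ ((a + 1) * (m - a)))" for m
  have w: "w (2 * i + 1) = q ^ ((i + 1) * (i + 1))" for i
  proof -
    have "(2 * i + 1 + 1) div 2 = i + 1" by simp
    then show ?thesis unfolding w_def square_weight_def by (simp only:)
  qed
  have w_le: "norm (w (2 * i + 1)) \<le> 1 * norm q ^ i" for i
  proof -
    have "norm q ^ ((i + 1) * (i + 1)) \<le> norm q ^ i" using q by (intro power_decreasing) auto
    then show ?thesis unfolding w norm_power by simp
  qed
  from pair_term_has_sum[OF q(1) summable_on_odds_weight[OF _ q(1) w_le]] obtain K where
    K: "((\<lambda>(m, e). pair_term q w m e) has_sum K) (odds \<times> evens)"
    "((\<lambda>g. w g / (1 - q ^ g) * (coth_q q g - of_nat g)) has_sum K) odds" by auto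
  have rows: "((\<lambda>m. (\<theta> * I m - of_nat m * w m) / (1 - q ^ m)) has_sum K) odds"
  proof (rule has_sum_SigmaD[OF K(1)])
    fix m assume "m \<in> odds"
    then have "odd m" by (simp add: odds_def)
    from pair_row_square[OF q this]
    show "((\<lambda>e. case (m, e) of (m, e) \<Rightarrow> pair_term q w m e) has_sum (\<theta> * I m - of_nat m * w m) / (1 - q ^ m)) evens"
      by (simp add: w_def \<theta>_def I_def)
  qed
  have "((\<lambda>m. \<theta> * I m / (1 - q ^ m)) has_sum \<theta> * S) odds"
    using has_sum_cmult_right[OF S[folded I_def odds_def], of \<theta>] by simp
  from has_sum_diff_complex[OF this rows] have "((\<lambda>m. of_nat m * w m / (1 - q ^ m)) has_sum \<theta> * S - K) odds"
    by (simp add: diff_divide_distrib)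
  from has_sum_add[OF this K(2), unfolded coth_collect]
  have "((\<lambda>g. w g / (1 - q ^ g) * coth_q q g) has_sum \<theta> * S) odds" by simp
  then have "((\<lambda>r. q * (q ^ (r * (r + 2)) * (1 + q ^ (2 * r + 1)) / (1 - q ^ (2 * r + 1))\<^sup>2)) has_sum \<theta> * S) UNIV"
    unfolding has_sum_odds_iff
  proof (rule iffD1[OF has_sum_cong, rotated])
    fix r :: nat
    have "(r + 1) * (r + 1) = r * (r + 2) + 1" by (simp add: algebra_simps)
    then have "w (2 * r + 1) = q * q ^ (r * (r + 2))" unfolding w by simp
    then show "w (2 * r + 1) / (1 - q ^ (2 * r + 1)) * coth_q q (2 * r + 1) =
        q * (q ^ (r * (r + 2)) * (1 + q ^ (2 * r + 1)) / (1 - q ^ (2 * r + 1))\<^sup>2)"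
      by (simp only:) (simp add: coth_q_def power2_eq_square)
  qed
  from infsumI[OF this] show ?thesis unfolding infsum_cmult_right' \<theta>_def by (simp add: mult.commute)
qed

section \<open>The identities\<close>

text \<open>In both residue classes the two class numbers are counted by the same set
  \<open>T_triples\<close>.\<close>

lemma kronecker_F_hurwitz_H:
  assumes "1 \<le> m"
  shows "kronecker_F (8 * m - 5) = 3 * hurwitz_H (8 * m - 5)" "kronecker_F (8 * m - 1) = hurwitz_H (8 * m - 1)"
proof -
  obtain k where "m = k + 1" using assms by (metis le_add_diff_inverse2)
  then have "8 * m - 5 = 3 + 8 * k" "8 * m - 5 = 3 + 4 * (2 * k)" "8 * m - 1 = 7 + 8 * k" "8 * m - 1 = 3 + 4 * (2 * k + 1)"
    by simp_all
  then have "(8 * m - 5) mod 8 = 3" "(8 * m - 5) mod 4 = 3" "(8 * m - 1) mod 8 = 7" "(8 * m - 1) mod 4 = 3"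
    by (metis mod_mult_self2 mod_less numeral_less_iff semiring_norm(76-81))+
  then show "kronecker_F (8 * m - 5) = 3 * hurwitz_H (8 * m - 5)" "kronecker_F (8 * m - 1) = hurwitz_H (8 * m - 1)"
    using kronecker_F_3_mod_4 hurwitz_H_8n_minus_5 hurwitz_H_8n_minus_1 by simp_all
qed

lemma No_term_zero: "No_term a b z 0 n = 0"
  by (simp add: No_term_def)

text \<open>Each pair of factors is \<open>q ^ (4 * k + 2) - 1\<close>, even in \<open>q\<close>,
  and \<open>z q\<close>, \<open>q / z\<close> are unchanged; the sign is that of
  \<open>q ^ (2 * n + 1)\<close>.\<close>

lemma No_term_negate_1: "No_term 1 (- 1) (- 1) (- q) n = - No_term 1 (- 1) 1 q n"
proof -
  have "(\<Prod>k<n. 1 + (- q) ^ (2 * k + 1)) * (\<Prod>k<n. - 1 + (- q) ^ (2 * k + 1)) =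
      (\<Prod>k<n. 1 + q ^ (2 * k + 1)) * (\<Prod>k<n. - 1 + q ^ (2 * k + 1))"
    unfolding prod.distrib[symmetric] by (rule prod.cong) (auto simp: algebra_simps)
  then show ?thesis by (simp add: No_term_def)
qed

text \<open>In each pair both factors are negated and trade places, which brings the third series to
  the parameters \<open>b = -1\<close>, \<open>z = 1\<close> at the argument
  \<open>- q\<close>.\<close>

lemma No_term_negate_inverse: "No_term 1 (1 / q) (- 1) q n = - No_term (1 / (- q)) (- 1) 1 (- q) n"
proof -
  have "(\<Prod>k<n. 1 + q ^ (2 * k + 1)) * (\<Prod>k<n. 1 / q + q ^ (2 * k + 1)) =
      (\<Prod>k<n. 1 / (- q) + (- q) ^ (2 * k + 1)) * (\<Prod>k<n. - 1 + (- q) ^ (2 * k + 1))"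
    unfolding prod.distrib[symmetric] by (rule prod.cong) (auto simp: algebra_simps)
  then show ?thesis by (simp add: No_term_def)
qed

lemma has_sum_zero_powers: "((\<lambda>n. c n * (0::complex) ^ n) has_sum 0) {1..}"
  by (rule has_sum_0) auto

lemma No_1_has_sum:
  assumes q: "norm q < 1"
  shows "No_term 1 (- 1) 1 q summable_on UNIV \<and>
    ((\<lambda>n. complex_of_real (2 * kronecker_F n) * q ^ n) has_sum No 1 (- 1) 1 q) {1..}"
proof (cases "q = 0")
  case True
  \<comment> \<open>The nonvanishing of theta was derived from \<open>q \<noteq> 0\<close>; at
    \<open>q = 0\<close> both sides vanish term by term.\<close>
  have "No_term a b z 0 = (\<lambda>n. 0)" for a b z by (rule ext) (rule No_term_zero)
  then show ?thesis using has_sum_zero_powers True by (simp add: No_def)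
next
  case False
  obtain S where S: "((\<lambda>n. complex_of_real (2 * kronecker_F n) * q ^ n) has_sum S) {1..}"
    "((\<lambda>m. (1 + q ^ m) / (1 - q ^ m) * (1 + (\<Sum>a\<in>{1..<m}. q ^ (a * (m - a)))) - 1) has_sum 2 * S) {m. odd m}"
    by (rule F_generating_function[OF q])
  have "norm (1 * q\<^sup>2) < 1" using q by (simp add: norm_power power_less_one_iff)
  from No_term_summable[OF q this] have s: "No_term 1 (- 1) 1 q summable_on UNIV" .
  have "No 1 (- 1) 1 q = S"
    by (rule iffD1[OF mult_right_cancel[OF No_1_times_theta(1)[OF q False]]
          trans[OF No_1_times_theta(2)[OF q False] F_times_theta[OF q False S(2), symmetric]]])
  then show ?thesis using S(1) s by simp
qed

lemma No_0_has_sum: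
  assumes q: "norm q < 1"
  shows "No_term 0 (- 1) 1 q summable_on UNIV \<and>
    ((\<lambda>n. complex_of_real (hurwitz_H (8 * n - 1)) * q ^ n) has_sum No 0 (- 1) 1 q) {1..}"
proof (cases "q = 0")
  case True
  have "No_term a b z 0 = (\<lambda>n. 0)" for a b z by (rule ext) (rule No_term_zero)
  then show ?thesis using has_sum_zero_powers True by (simp add: No_def)
next
  case False
  obtain S where S: "((\<lambda>n. complex_of_real (hurwitz_H (8 * n - 1)) * q ^ n) has_sum S) {1..}"
    "((\<lambda>m. (\<Sum>a<m. q ^ (a * (2 * m - 1 - a) div 2 + m)) / (1 - q ^ m)) has_sum S) {1..}"
    by (rule H_8n_minus_1_generating_function[OF q])
  have s: "No_term 0 (- 1) 1 q summable_on UNIV" by (rule No_term_summable[OF q]) simp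
  have "No 0 (- 1) 1 q = S"
    by (rule iffD1[OF mult_right_cancel[OF No_0_times_theta(1)[OF q False]]
          trans[OF No_0_times_theta(2)[OF q False] H_times_theta[OF q False S(2), symmetric]]])
  then show ?thesis using S(1) s by simp
qed

lemma No_inverse_has_sum:
  assumes q: "norm q < 1" "q \<noteq> 0"
  shows "No_term (1 / q) (- 1) 1 q summable_on UNIV \<and>
    ((\<lambda>n. complex_of_real (kronecker_F (4 * n - 1)) * q ^ n) has_sum No (1 / q) (- 1) 1 q) {1..}"
proof -
  obtain S where S: "((\<lambda>n. complex_of_real (kronecker_F (4 * n - 1)) * q ^ n) has_sum S) {1..}"
    "((\<lambda>m. (\<Sum>a<m. q ^ ((a + 1) * (m - a))) / (1 - q ^ m)) has_sum S) {m. odd m}"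
    by (rule F_4n_minus_1_generating_function[OF q(1)])
  have "norm (1 / q * q\<^sup>2) < 1" using q by (simp add: power2_eq_square)
  from No_term_summable[OF q(1) this] have s: "No_term (1 / q) (- 1) 1 q summable_on UNIV" .
  have "No (1 / q) (- 1) 1 q = S"
    by (rule iffD1[OF mult_right_cancel[OF No_inverse_times_theta(1)[OF q]]
          trans[OF No_inverse_times_theta(2)[OF q] F_4n_minus_1_times_theta[OF q S(2), symmetric]]])
  then show ?thesis using S(1) s by simp
qed

text \<open>For the exponents \<open>2 n - 1\<close> and \<open>2 n\<close> the argument of
  \<open>kronecker_F\<close> is \<open>8 n - 5\<close> and \<open>8 n - 1\<close>. The odd exponents
  bring a sign from \<open>- q\<close> and the factor 3.\<close>

lemma F_4n_minus_1_split:
  fixes q :: complex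
  assumes S: "((\<lambda>n. complex_of_real (kronecker_F (4 * n - 1)) * (- q) ^ n) has_sum S) {1..}"
  obtains X Y where "((\<lambda>n. complex_of_real (hurwitz_H (8 * n - 5)) * q ^ (2 * n - 1)) has_sum X) {1..}"
    "((\<lambda>n. complex_of_real (hurwitz_H (8 * n - 1)) * q ^ (2 * n)) has_sum Y) {1..}" "- S = 3 * X - Y"
proof -
  define f where "f n = complex_of_real (kronecker_F (4 * n - 1)) * (- q) ^ n" for n
  have S: "(f has_sum S) {1..}" using assms unfolding f_def[abs_def] .
  have un: "{1..} = odds \<union> evens" and disj: "odds \<inter> evens = {}"
    by (auto simp: odds_def evens_def Suc_le_eq intro: odd_pos)
  have "f summable_on odds" "f summable_on evens"
    using has_sum_imp_summable[OF S] un by (auto intro: summable_on_subset)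
  then obtain A B where A: "(f has_sum A) odds" and B: "(f has_sum B) evens" by (auto simp: summable_on_def)
  have "S = A + B" using has_sum_unique[OF S] has_sum_Un_disjoint[OF A B disj] un by simp
  have fo: "f (2 * n - 1) = - 3 * (complex_of_real (hurwitz_H (8 * n - 5)) * q ^ (2 * n - 1))" if n: "1 \<le> n" for n
  proof -
    obtain k where k: "n = k + 1" using n by (metis le_add_diff_inverse2)
    have "4 * (2 * n - 1) - 1 = 8 * n - 5" "2 * n - 1 = 2 * k + 1" by (simp_all add: k)
    then show ?thesis unfolding f_def using kronecker_F_hurwitz_H(1)[OF n] by simp
  qed
  have fe: "f (2 * n) = complex_of_real (hurwitz_H (8 * n - 1)) * q ^ (2 * n)" if "1 \<le> n" for n
    unfolding f_def using kronecker_F_hurwitz_H(2)[OF that] by simp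
  have "((\<lambda>n. f (2 * n - 1)) has_sum A) {1..}"
    by (rule iffD1[OF has_sum_reindex_bij_witness[of odds "\<lambda>n. 2 * n - 1" "\<lambda>n. (n + 1) div 2"] A])
      (auto simp: odds_def elim!: oddE)
  then have "((\<lambda>n. - 3 * (complex_of_real (hurwitz_H (8 * n - 5)) * q ^ (2 * n - 1))) has_sum A) {1..}"
    by (rule iffD1[OF has_sum_cong, rotated]) (simp only: fo atLeast_iff)
  from has_sum_cmult_right[OF this, of "- (1 / 3)"]
  have "((\<lambda>n. complex_of_real (hurwitz_H (8 * n - 5)) * q ^ (2 * n - 1)) has_sum - (A / 3)) {1..}" by simp
  moreover have "((\<lambda>n. f (2 * n)) has_sum B) {1..}"
    by (rule iffD1[OF has_sum_reindex_bij_witness[of evens "\<lambda>n. 2 * n" "\<lambda>n. n div 2"] B])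
      (auto simp: evens_def elim!: evenE)
  then have "((\<lambda>n. complex_of_real (hurwitz_H (8 * n - 1)) * q ^ (2 * n)) has_sum B) {1..}"
    by (rule iffD1[OF has_sum_cong, rotated]) (simp only: fe atLeast_iff)
  moreover have "- S = 3 * (- (A / 3)) - B" using \<open>S = A + B\<close> by simp
  ultimately show thesis using that by blast
qed

theorem theorem1p6:
  fixes q :: complex
  assumes "norm q < 1"
  shows
   "(No_term 1 (-1) 1 q summable_on UNIV
     \<and> No_term 1 (-1) (-1) (-q) summable_on UNIV
     \<and> (\<lambda>n. complex_of_real (2 * kronecker_F n) * q ^ n) summable_on {1..}
     \<and> No 1 (-1) 1 q = - No 1 (-1) (-1) (-q)
     \<and> - No 1 (-1) (-1) (-q) = (\<Sum>\<^sub>\<infinity>n\<in>{1..}. complex_of_real (2 * kronecker_F n) * q ^ n))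
    \<and>
    (No_term 0 (-1) 1 q summable_on UNIV
     \<and> (\<lambda>n. complex_of_real (hurwitz_H (8 * n - 1)) * q ^ n) summable_on {1..}
     \<and> No 0 (-1) 1 q = (\<Sum>\<^sub>\<infinity>n\<in>{1..}. complex_of_real (hurwitz_H (8 * n - 1)) * q ^ n))
    \<and>
    (q \<noteq> 0 \<longrightarrow>
       No_term 1 (1 / q) (-1) q summable_on UNIV
     \<and> (\<lambda>n. complex_of_real (kronecker_F (4 * n - 1)) * (-q) ^ n) summable_on {1..}
     \<and> (\<lambda>n. complex_of_real (hurwitz_H (8 * n - 5)) * q ^ (2 * n - 1)) summable_on {1..}
     \<and> (\<lambda>n. complex_of_real (hurwitz_H (8 * n - 1)) * q ^ (2 * n)) summable_on {1..}
     \<and> No 1 (1 / q) (-1) q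
         = - (\<Sum>\<^sub>\<infinity>n\<in>{1..}. complex_of_real (kronecker_F (4 * n - 1)) * (-q) ^ n)
     \<and> - (\<Sum>\<^sub>\<infinity>n\<in>{1..}. complex_of_real (kronecker_F (4 * n - 1)) * (-q) ^ n)
         = 3 * (\<Sum>\<^sub>\<infinity>n\<in>{1..}. complex_of_real (hurwitz_H (8 * n - 5)) * q ^ (2 * n - 1))
           - (\<Sum>\<^sub>\<infinity>n\<in>{1..}. complex_of_real (hurwitz_H (8 * n - 1)) * q ^ (2 * n)))"
proof (intro conjI impI)
  note F = No_1_has_sum[OF assms]
  have neg: "No_term 1 (-1) (-1) (-q) = (\<lambda>n. - No_term 1 (-1) 1 q n)"
    by (rule ext) (rule No_term_negate_1)
  show "No_term 1 (-1) 1 q summable_on UNIV" using F by blast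
  then show "No_term 1 (-1) (-1) (-q) summable_on UNIV" unfolding neg summable_on_uminus .
  show "(\<lambda>n. complex_of_real (2 * kronecker_F n) * q ^ n) summable_on {1..}"
    using F has_sum_imp_summable by blast
  have No: "No 1 (-1) (-1) (-q) = - No 1 (-1) 1 q" unfolding No_def neg infsum_uminus ..
  then show "No 1 (-1) 1 q = - No 1 (-1) (-1) (-q)" by simp
  show "- No 1 (-1) (-1) (-q) = (\<Sum>\<^sub>\<infinity>n\<in>{1..}. complex_of_real (2 * kronecker_F n) * q ^ n)"
    unfolding No using F infsumI by fastforce
next
  note H = No_0_has_sum[OF assms]
  show "No_term 0 (-1) 1 q summable_on UNIV" using H by blast
  show "(\<lambda>n. complex_of_real (hurwitz_H (8 * n - 1)) * q ^ n) summable_on {1..}"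
    using H has_sum_imp_summable by blast
  show "No 0 (-1) 1 q = (\<Sum>\<^sub>\<infinity>n\<in>{1..}. complex_of_real (hurwitz_H (8 * n - 1)) * q ^ n)"
    using H infsumI by fastforce
next
  assume "q \<noteq> 0"
  \<comment> \<open>The third chain is \<open>No_inverse_has_sum\<close> at
    \<open>- q\<close>.\<close>
  then have q: "norm (- q) < 1" "- q \<noteq> 0" using assms by simp_all
  note K = No_inverse_has_sum[OF q]
  have neg: "No_term 1 (1 / q) (-1) q = (\<lambda>n. - No_term (1 / (- q)) (-1) 1 (- q) n)"
    by (rule ext) (rule No_term_negate_inverse)
  show "No_term 1 (1 / q) (-1) q summable_on UNIV"
    unfolding neg summable_on_uminus using K by blast
  have S: "((\<lambda>n. complex_of_real (kronecker_F (4 * n - 1)) * (-q) ^ n) has_sum No (1 / (- q)) (-1) 1 (- q)) {1..}"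
    using K by blast
  then show "(\<lambda>n. complex_of_real (kronecker_F (4 * n - 1)) * (-q) ^ n) summable_on {1..}"
    by (rule has_sum_imp_summable)
  obtain X Y where XY: "((\<lambda>n. complex_of_real (hurwitz_H (8 * n - 5)) * q ^ (2 * n - 1)) has_sum X) {1..}"
    "((\<lambda>n. complex_of_real (hurwitz_H (8 * n - 1)) * q ^ (2 * n)) has_sum Y) {1..}"
    "- No (1 / (- q)) (-1) 1 (- q) = 3 * X - Y"
    by (rule F_4n_minus_1_split[OF S])
  show "(\<lambda>n. complex_of_real (hurwitz_H (8 * n - 5)) * q ^ (2 * n - 1)) summable_on {1..}"
    using XY(1) by (rule has_sum_imp_summable)
  show "(\<lambda>n. complex_of_real (hurwitz_H (8 * n - 1)) * q ^ (2 * n)) summable_on {1..}"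
    using XY(2) by (rule has_sum_imp_summable)
  show "No 1 (1 / q) (-1) q = - (\<Sum>\<^sub>\<infinity>n\<in>{1..}. complex_of_real (kronecker_F (4 * n - 1)) * (-q) ^ n)"
    unfolding infsumI[OF S] unfolding No_def neg infsum_uminus ..
  show "- (\<Sum>\<^sub>\<infinity>n\<in>{1..}. complex_of_real (kronecker_F (4 * n - 1)) * (-q) ^ n)
         = 3 * (\<Sum>\<^sub>\<infinity>n\<in>{1..}. complex_of_real (hurwitz_H (8 * n - 5)) * q ^ (2 * n - 1))
           - (\<Sum>\<^sub>\<infinity>n\<in>{1..}. complex_of_real (hurwitz_H (8 * n - 1)) * q ^ (2 * n))"
    unfolding infsumI[OF S] infsumI[OF XY(1)] infsumI[OF XY(2)] by (rule XY(3))
qed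

end
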